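(* Fix an integer $n>1$. Then $\displaystyle\lim_{d\to\infty}\frac{E_{n,d}}{\sqrt{D(n,d)}}=1$.
   Context: A real tensor $A=(A_{i_0,i_1,\ldots,i_d})\in(\mathbb{R}^n)^{\otimes(d+1)}$ defines $Av^d\in\mathbb{R}^n$ by $(Av^d)_{i}=\sum_{i_1,\ldots,i_d=1}^n A_{i,i_1,\ldots,i_d}v_{i_1}\cdots v_{i_d}$. A real eigenpair of $A$ is $(v,\lambda)\in(\mathbb{R}^n\setminus\{0\})\times\mathbb{R}$ with $Av^d=\lambda v$; $(v,\lambda)$ and $(tv,t^{d-1}\lambda)$, $t\in\mathbb{R}\setminus\{0\}$, are equivalent. $\#_\mathbb{R}(A)$ is the number of equivalence classes of real eigenpairs. $A$ is gaussian if its entries are i.i.d. $N(0,1)$, and $E_{n,d}:=\mathbb{E}_{A\text{ gaussian}}\,\#_\mathbb{R}(A)$. $D(n,d):=\sum_{i=0}^{n-1}d^i$. *)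

theory Defs
  imports "HOL-Probability.Probability"
begin

definition tidx :: "nat \<Rightarrow> nat \<Rightarrow> (nat \<Rightarrow> nat) set" where
  "tidx n d = {j. (\<forall>k\<le>d. j k < n) \<and> (\<forall>k>d. j k = 0)}"

definition rvec :: "nat \<Rightarrow> (nat \<Rightarrow> real) set" where
  "rvec n = {v. \<forall>i\<ge>n. v i = 0}"

definition tapply :: "nat \<Rightarrow> nat \<Rightarrow> ((nat \<Rightarrow> nat) \<Rightarrow> real) \<Rightarrow> (nat \<Rightarrow> real) \<Rightarrow> nat \<Rightarrow> real" where
  "tapply n d A v i = (\<Sum>j\<in>{j\<in>tidx n d. j 0 = i}. A j * (\<Prod>k\<in>{1..d}. v (j k)))"

definition real_eigenpairs :: "nat \<Rightarrow> nat \<Rightarrow> ((nat \<Rightarrow> nat) \<Rightarrow> real) \<Rightarrow> ((nat \<Rightarrow> real) \<times> real) set" where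
  "real_eigenpairs n d A = {(v, lam). v \<in> rvec n \<and> (\<exists>i<n. v i \<noteq> 0) \<and>
      (\<forall>i<n. tapply n d A v i = lam * v i)}"

definition eigen_equiv :: "nat \<Rightarrow> nat \<Rightarrow> ((nat \<Rightarrow> nat) \<Rightarrow> real) \<Rightarrow> (((nat \<Rightarrow> real) \<times> real) \<times> ((nat \<Rightarrow> real) \<times> real)) set" where
  "eigen_equiv n d A = {((v, lam), (w, mu)). (v, lam) \<in> real_eigenpairs n d A \<and> (w, mu) \<in> real_eigenpairs n d A \<and>
      (\<exists>t::real. t \<noteq> 0 \<and> w = (\<lambda>i. t * v i) \<and> mu = t powi (int d - 1) * lam)}"

definition num_real_eig :: "nat \<Rightarrow> nat \<Rightarrow> ((nat \<Rightarrow> nat) \<Rightarrow> real) \<Rightarrow> ennreal" where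
  "num_real_eig n d A = (let Q = real_eigenpairs n d A // eigen_equiv n d A in
      if finite Q then of_nat (card Q) else \<infinity>)"

definition gauss_tensor :: "nat \<Rightarrow> nat \<Rightarrow> ((nat \<Rightarrow> nat) \<Rightarrow> real) measure" where
  "gauss_tensor n d = PiM (tidx n d) (\<lambda>_. density lborel std_normal_density)"

definition E_nd :: "nat \<Rightarrow> nat \<Rightarrow> ennreal" where
  "E_nd n d = (\<integral>\<^sup>+ A. num_real_eig n d A \<partial>gauss_tensor n d)"

definition D_nd :: "nat \<Rightarrow> nat \<Rightarrow> real" where
  "D_nd n d = (\<Sum>i<n. real d ^ i)"

end

theory Submission
  imports Defs "HOL-Probability.Probability" "HOL-Computational_Algebra.Polynomial" "Jordan_Normal_Form.Determinant"
begin

text \<open>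
  The eigenvectors of a Gaussian tensor form a random cone whose law is invariant under rotations.
  For such a cone, double counting the pairs of a line and an independent Gaussian direction close
  to it shows that the expected number of lines is the limit, as the angle tends to \<open>0\<close>, of the
  probability that the cone meets the cap around the first axis, divided by the probability that a
  Gaussian direction falls into this cap. In the affine chart around the axis the defining system
  is solved for the coefficients of its constant terms and rescaled; a contraction argument and
  dominated convergence show that the cone meets the ball of radius \<open>r\<close> with probability asymptotic
  to a constant times \<open>r ^ (n - 1)\<close> times the expected volume of the image of the unit ball under
  the linear part. For eigenvectors, this linear part has the law of \<open>sqrt d * G + \<lambda> * I\<close> with \<open>G\<close> a
  Gaussian matrix and \<open>\<lambda>\<close> an independent Gaussian. The same computation for \<open>n - 1\<close> Gaussian linear
  equations in \<open>n\<close> unknowns, which almost surely have exactly one solution line, has linear part \<open>G\<close>.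
  So \<open>E_nd n d\<close> is the quotient of the two expected volumes, and after division by
  \<open>sqrt d ^ (n - 1)\<close> it tends to \<open>1\<close>. As \<open>n\<close> is a term, Lebesgue measure on the \<open>n\<close>-dimensional
  space is a product measure on functions throughout.
\<close>

section \<open>Gaussian product measures\<close>

text \<open>The obstacle is that a count of real zeros has no evident regularity: it may be
  infinite, and neither its measurability nor the nondegeneracy of the zeros is at hand. It
  therefore enters only through an upper bound valid at every angle and a lower bound obtained from
  Fatou's lemma. Near the axis each equation contains its constant coefficient additively, so
  meeting the cap means that a Gaussian vector lies in the image of a ball under an explicit map; no
  zero has to be followed under a change of the coefficients. The factor \<open>sqrt d\<close>
  arises because \<open>d\<close> tensor entries contribute to each linear coefficient in the chart,
  so their sum has variance \<open>d\<close>. The eigenvalue is to leading order the single entry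
  with all indices \<open>0\<close>, has variance \<open>1\<close>, and becomes negligible beside
  them. Dilating a volume of dimension \<open>n - 1\<close> by \<open>sqrt d\<close> gives
  \<open>sqrt d ^ (n - 1)\<close>, which is the order of the square root of
  \<open>D_nd n d\<close>.\<close>

abbreviation lebesgue_on_pi :: "'i set \<Rightarrow> ('i \<Rightarrow> real) measure" where
  "lebesgue_on_pi I \<equiv> PiM I (\<lambda>_. lborel)"

definition gauss :: "'i set \<Rightarrow> ('i \<Rightarrow> real) measure" where
  "gauss I = PiM I (\<lambda>_. density lborel std_normal_density)"

lemma sets_gauss [measurable_cong]: "sets (gauss I) = sets (PiM I (\<lambda>_. borel))"
  unfolding gauss_def by (intro sets_PiM_cong) auto

lemma space_gauss: "space (gauss I) = extensional I"
  by (simp add: gauss_def space_PiM PiE_def)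

lemma sets_lebesgue_on_pi [measurable_cong]: "sets (lebesgue_on_pi I) = sets (PiM I (\<lambda>_. borel))"
  by (intro sets_PiM_cong) auto

lemma prob_space_std_normal: "prob_space (density lborel std_normal_density)"
  by (rule prob_space_normal_density) simp

lemma prob_space_gauss: "prob_space (gauss I)"
  unfolding gauss_def by (intro prob_space_PiM prob_space_std_normal)

interpretation leb: product_sigma_finite "\<lambda>_::'i. lborel :: real measure"
  by standard

interpretation gau: product_sigma_finite "\<lambda>_::'i. density lborel std_normal_density"
  by (rule product_sigma_finite.intro, rule prob_space_imp_sigma_finite, rule prob_space_std_normal)

lemma sigma_finite_lebesgue_on_pi: "finite I \<Longrightarrow> sigma_finite_measure (lebesgue_on_pi I)"
  by (rule leb.sigma_finite)

definition gauss_density :: "'i set \<Rightarrow> ('i \<Rightarrow> real) \<Rightarrow> ennreal" where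
  "gauss_density I x = (\<Prod>i\<in>I. ennreal (std_normal_density (x i)))"

lemma measurable_gauss_density [measurable]:
  "gauss_density I \<in> borel_measurable (PiM I (\<lambda>_. borel))"
  unfolding gauss_density_def[abs_def] by measurable

text \<open>Both measures are determined by boxes, where density and indicator are products over the
  coordinates and the integral factorises.\<close>

lemma gauss_eq_density:
  assumes "finite I"
  shows "gauss I = density (lebesgue_on_pi I) (gauss_density I)"
proof -
  have "density (lebesgue_on_pi I) (gauss_density I) = gauss I"
    unfolding gauss_def
  proof (rule gau.PiM_eqI[OF assms])
    show "sets (density (lebesgue_on_pi I) (gauss_density I)) =
        sets (PiM I (\<lambda>_. density lborel std_normal_density))"
      by (simp add: sets_gauss[unfolded gauss_def] sets_lebesgue_on_pi)
    fix A :: "'a \<Rightarrow> real set" assume "\<And>i. i \<in> I \<Longrightarrow> A i \<in> sets (density lborel std_normal_density)"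
    then have A: "\<And>i. i \<in> I \<Longrightarrow> A i \<in> sets borel" by simp
    have S: "PiE I A \<in> sets (lebesgue_on_pi I)"
      using assms A by (intro sets_PiM_I_finite) auto
    have "emeasure (density (lebesgue_on_pi I) (gauss_density I)) (PiE I A)
      = (\<integral>\<^sup>+x. gauss_density I x * indicator (PiE I A) x \<partial>lebesgue_on_pi I)"
      by (rule emeasure_density[OF _ S]) measurable
    also have "\<dots> = (\<integral>\<^sup>+x. (\<Prod>i\<in>I. ennreal (std_normal_density (x i)) * indicator (A i) (x i)) \<partial>lebesgue_on_pi I)"
    proof (rule nn_integral_cong)
      fix x :: "'a \<Rightarrow> real" assume "x \<in> space (lebesgue_on_pi I)"
      then have "x \<in> PiE I A \<longleftrightarrow> (\<forall>i\<in>I. x i \<in> A i)"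
        by (auto simp: space_PiM PiE_iff)
      then have "indicator (PiE I A) x = (\<Prod>i\<in>I. indicator (A i) (x i) :: ennreal)"
        using assms by (auto simp: indicator_def prod_eq_1_iff prod_zero_iff)
      then show "gauss_density I x * indicator (PiE I A) x
          = (\<Prod>i\<in>I. ennreal (std_normal_density (x i)) * indicator (A i) (x i))"
        by (simp add: gauss_density_def prod.distrib)
    qed
    also have "\<dots> = (\<Prod>i\<in>I. \<integral>\<^sup>+x. ennreal (std_normal_density x) * indicator (A i) x \<partial>lborel)"
      using assms A by (intro leb.product_nn_integral_prod) auto
    also have "\<dots> = (\<Prod>i\<in>I. emeasure (density lborel std_normal_density) (A i))"
      using A by (intro prod.cong refl emeasure_density[symmetric]) auto
    finally show "emeasure (density (lebesgue_on_pi I) (gauss_density I)) (PiE I A)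
      = (\<Prod>i\<in>I. emeasure (density lborel std_normal_density) (A i))" .
  qed
  then show ?thesis by simp
qed

lemma nn_integral_gauss:
  assumes "finite I" and [measurable]: "f \<in> borel_measurable (PiM I (\<lambda>_. borel))"
  shows "(\<integral>\<^sup>+x. f x \<partial>gauss I) = (\<integral>\<^sup>+x. gauss_density I x * f x \<partial>lebesgue_on_pi I)"
  unfolding gauss_eq_density[OF assms(1)] by (subst nn_integral_density) auto

lemma nn_integral_gauss_density:
  assumes "finite I" shows "(\<integral>\<^sup>+x. gauss_density I x \<partial>lebesgue_on_pi I) = 1"
  using nn_integral_gauss[OF assms, of "\<lambda>_. 1"] prob_space.emeasure_space_1[OF prob_space_gauss, of I]
  by simp

section \<open>Translations and dilations of Lebesgue measure\<close>

text \<open>The preimage of a box under a coordinatewise map is again a box, so invariance in each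
  coordinate gives invariance of the product.\<close>

lemma distr_lebesgue_on_pi_component:
  assumes "finite I" and \<phi>: "\<And>i. i \<in> I \<Longrightarrow> distr lborel borel (\<phi> i) = lborel"
    and [measurable]: "\<And>i. i \<in> I \<Longrightarrow> \<phi> i \<in> borel_measurable borel"
  shows "distr (lebesgue_on_pi I) (lebesgue_on_pi I) (\<lambda>x. \<lambda>i\<in>I. \<phi> i (x i)) = lebesgue_on_pi I"
proof (rule leb.PiM_eqI[OF assms(1)])
  fix A :: "'a \<Rightarrow> real set" assume A: "\<And>i. i \<in> I \<Longrightarrow> A i \<in> sets lborel"
  have "emeasure (distr (lebesgue_on_pi I) (lebesgue_on_pi I) (\<lambda>x. \<lambda>i\<in>I. \<phi> i (x i))) (PiE I A)
    = emeasure (lebesgue_on_pi I) ((\<lambda>x. \<lambda>i\<in>I. \<phi> i (x i)) -` PiE I A \<inter> space (lebesgue_on_pi I))"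
    using A assms(1) by (intro emeasure_distr sets_PiM_I_finite) auto
  also have "(\<lambda>x. \<lambda>i\<in>I. \<phi> i (x i)) -` PiE I A \<inter> space (lebesgue_on_pi I) = PiE I (\<lambda>i. \<phi> i -` A i \<inter> space lborel)"
    by (auto simp: space_PiM PiE_iff)
  also have "emeasure (lebesgue_on_pi I) \<dots> = (\<Prod>i\<in>I. emeasure lborel (\<phi> i -` A i \<inter> space lborel))"
    using A assms(1) measurable_sets[OF assms(3), of _ "A _"] by (intro leb.emeasure_PiM) auto
  also have "\<dots> = (\<Prod>i\<in>I. emeasure (distr lborel borel (\<phi> i)) (A i))"
    using A by (intro prod.cong refl emeasure_distr[symmetric]) auto
  also have "\<dots> = (\<Prod>i\<in>I. emeasure lborel (A i))"
    using \<phi> by (intro prod.cong) auto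
  finally show "emeasure (distr (lebesgue_on_pi I) (lebesgue_on_pi I) (\<lambda>x. \<lambda>i\<in>I. \<phi> i (x i))) (PiE I A)
    = (\<Prod>i\<in>I. emeasure lborel (A i))" .
qed simp

lemma nn_integral_lebesgue_on_pi_shift:
  assumes "finite I" and [measurable]: "f \<in> borel_measurable (PiM I (\<lambda>_. borel))"
  shows "(\<integral>\<^sup>+x. f (\<lambda>i\<in>I. x i + t i) \<partial>lebesgue_on_pi I) = (\<integral>\<^sup>+x. f x \<partial>lebesgue_on_pi I)"
proof -
  have "distr lborel borel (\<lambda>x. x + c) = lborel" for c :: real
    using lborel_distr_plus[of c] by (simp add: add.commute[of _ c])
  then have "distr (lebesgue_on_pi I) (lebesgue_on_pi I) (\<lambda>x. \<lambda>i\<in>I. x i + t i) = lebesgue_on_pi I"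
    by (intro distr_lebesgue_on_pi_component assms(1)) auto
  then have "(\<integral>\<^sup>+x. f x \<partial>lebesgue_on_pi I) = (\<integral>\<^sup>+x. f x \<partial>distr (lebesgue_on_pi I) (lebesgue_on_pi I) (\<lambda>x. \<lambda>i\<in>I. x i + t i))"
    by simp
  also have "\<dots> = (\<integral>\<^sup>+x. f (\<lambda>i\<in>I. x i + t i) \<partial>lebesgue_on_pi I)"
    by (subst nn_integral_distr) auto
  finally show ?thesis by simp
qed

lemma nn_integral_lebesgue_on_pi_scale:
  assumes "finite I" and [measurable]: "f \<in> borel_measurable (PiM I (\<lambda>_. borel))" and r: "r > 0"
  shows "(\<integral>\<^sup>+x. f x \<partial>lebesgue_on_pi I) = ennreal (r ^ card I) * (\<integral>\<^sup>+x. f (\<lambda>i\<in>I. r * x i) \<partial>lebesgue_on_pi I)"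
proof -
  let ?s = "\<lambda>x. \<lambda>i\<in>I. r * x i"
  \<comment> \<open>The push-forward under the dilation is Lebesgue measure divided by
    \<open>r ^ card I\<close>; the constant density restores it.\<close>
  let ?D = "density (distr (lebesgue_on_pi I) (lebesgue_on_pi I) ?s) (\<lambda>_. ennreal (r ^ card I))"
  have "?D = lebesgue_on_pi I"
  proof (rule leb.PiM_eqI[OF assms(1)])
    fix A :: "'a \<Rightarrow> real set" assume A: "\<And>i. i \<in> I \<Longrightarrow> A i \<in> sets lborel"
    have S: "PiE I A \<in> sets (lebesgue_on_pi I)"
      using A assms(1) by (intro sets_PiM_I_finite) auto
    then have "emeasure ?D (PiE I A) = ennreal (r ^ card I) *
        emeasure (lebesgue_on_pi I) (?s -` PiE I A \<inter> space (lebesgue_on_pi I))"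
      by (subst emeasure_density_const) (auto simp: emeasure_distr)
    also have "?s -` PiE I A \<inter> space (lebesgue_on_pi I) = PiE I (\<lambda>i. (\<lambda>x. r * x) -` A i \<inter> space lborel)"
      by (auto simp: space_PiM PiE_iff)
    also have "emeasure (lebesgue_on_pi I) \<dots> = (\<Prod>i\<in>I. emeasure lborel ((\<lambda>x. r * x) -` A i \<inter> space lborel))"
      using A assms(1) measurable_sets[of "\<lambda>x. r * x" borel borel "A _"] by (intro leb.emeasure_PiM) auto
    also have "ennreal (r ^ card I) * \<dots> = (\<Prod>i\<in>I. ennreal r * emeasure lborel ((\<lambda>x. r * x) -` A i \<inter> space lborel))"
      using r by (simp add: prod.distrib ennreal_power)
    also have "\<dots> = (\<Prod>i\<in>I. emeasure lborel (A i))"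
    proof (rule prod.cong[OF refl])
      fix i assume "i \<in> I"
      then have Ai: "A i \<in> sets borel" using A by simp
      have "emeasure lborel (A i) = emeasure (density (distr lborel borel (\<lambda>x. 0 + r * x)) (\<lambda>_. ennreal \<bar>r\<bar>)) (A i)"
        using lborel_real_affine[of r 0] r by simp
      also have "\<dots> = ennreal r * emeasure lborel ((\<lambda>x. r * x) -` A i \<inter> space lborel)"
        using Ai r by (subst emeasure_density_const) (auto simp: emeasure_distr)
      finally show "ennreal r * emeasure lborel ((\<lambda>x. r * x) -` A i \<inter> space lborel) = emeasure lborel (A i)" ..
    qed
    finally show "emeasure ?D (PiE I A) = (\<Prod>i\<in>I. emeasure lborel (A i))" .
  qed simp
  then have "(\<integral>\<^sup>+x. f x \<partial>lebesgue_on_pi I) = (\<integral>\<^sup>+x. f x \<partial>?D)" by simp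
  also have "\<dots> = ennreal (r ^ card I) * (\<integral>\<^sup>+x. f (?s x) \<partial>lebesgue_on_pi I)"
    by (subst nn_integral_density, simp, simp, subst nn_integral_distr, simp, simp, subst nn_integral_cmult) auto
  finally show ?thesis .
qed

section \<open>Orthogonal invariance of Lebesgue and Gaussian measure\<close>

text \<open>The result is restricted to \<open>I\<close>, hence \<open>undefined\<close> outside, so
  that it lies in the space of the product measure on \<open>I\<close>.\<close>

definition lin :: "'i set \<Rightarrow> ('i \<Rightarrow> 'i \<Rightarrow> real) \<Rightarrow> ('i \<Rightarrow> real) \<Rightarrow> 'i \<Rightarrow> real" where
  "lin I U x = (\<lambda>i\<in>I. \<Sum>j\<in>I. U i j * x j)"

lemma measurable_lin [measurable]: "lin I U \<in> PiM I (\<lambda>_. borel) \<rightarrow>\<^sub>M PiM I (\<lambda>_. borel)"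
  unfolding lin_def[abs_def] by measurable

text \<open>Only orthogonal matrices that are symmetric, hence their own inverses, are considered.
  Householder reflections are of this kind and suffice to carry any vector to a coordinate
  axis.\<close>

definition sym_orth :: "'i set \<Rightarrow> ('i \<Rightarrow> 'i \<Rightarrow> real) \<Rightarrow> bool" where
  "sym_orth I U \<longleftrightarrow> (\<forall>i\<in>I. \<forall>j\<in>I. U i j = U j i \<and> (\<Sum>k\<in>I. U i k * U k j) = of_bool (i = j))"

lemma lin_lin:
  assumes "finite I" "sym_orth I U" "i \<in> I"
  shows "lin I U (lin I U x) i = x i"
proof -
  have "lin I U (lin I U x) i = (\<Sum>j\<in>I. U i j * (\<Sum>k\<in>I. U j k * x k))"
    using assms(3) by (simp add: lin_def)
  also have "\<dots> = (\<Sum>j\<in>I. \<Sum>k\<in>I. U i j * U j k * x k)"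
    by (simp add: sum_distrib_left mult.assoc)
  also have "\<dots> = (\<Sum>k\<in>I. (\<Sum>j\<in>I. U i j * U j k) * x k)"
    by (subst sum.swap) (simp add: sum_distrib_right)
  also have "\<dots> = (\<Sum>k\<in>I. of_bool (i = k) * x k)"
  proof (rule sum.cong[OF refl])
    fix k assume "k \<in> I"
    then have "(\<Sum>j\<in>I. U i j * U j k) = of_bool (i = k)"
      using assms unfolding sym_orth_def by blast
    then show "(\<Sum>j\<in>I. U i j * U j k) * x k = of_bool (i = k) * x k" by simp
  qed
  also have "\<dots> = x i"
    using assms by (simp add: of_bool_def if_distrib[of "\<lambda>a. a * _"] sum.delta cong: if_cong)
  finally show ?thesis .
qed

lemma inner_lin:
  assumes "finite I" "sym_orth I U"
  shows "(\<Sum>i\<in>I. lin I U x i * y i) = (\<Sum>i\<in>I. x i * lin I U y i)"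
proof -
  have "(\<Sum>i\<in>I. lin I U x i * y i) = (\<Sum>i\<in>I. \<Sum>j\<in>I. U i j * x j * y i)"
    by (simp add: lin_def sum_distrib_right)
  also have "\<dots> = (\<Sum>j\<in>I. \<Sum>i\<in>I. U j i * x j * y i)"
    using assms by (subst sum.swap) (auto simp: sym_orth_def intro!: sum.cong)
  also have "\<dots> = (\<Sum>i\<in>I. x i * lin I U y i)"
    by (simp add: lin_def sum_distrib_left mult_ac)
  finally show ?thesis .
qed

lemma inner_lin_lin:
  assumes "finite I" "sym_orth I U"
  shows "(\<Sum>i\<in>I. lin I U x i * lin I U y i) = (\<Sum>i\<in>I. x i * y i)"
  using inner_lin[OF assms, of x "lin I U y"] lin_lin[OF assms] by simp

lemma gauss_density_eq:
  assumes "finite I"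
  shows "gauss_density I x = ennreal ((1 / sqrt (2 * pi)) ^ card I * exp (- (\<Sum>i\<in>I. x i * x i) / 2))"
  using assms
  by (simp add: gauss_density_def prod_ennreal std_normal_density_def prod_dividef exp_sum[symmetric]
      sum_negf power_one_over power2_eq_square flip: sum_divide_distrib)

text \<open>Averaging over translations by a Gaussian vector, whose density is rotation invariant,
  reduces this to the translation invariance of Lebesgue measure and Fubini.\<close>

lemma nn_integral_lebesgue_on_pi_orth:
  assumes fin: "finite I" and U: "sym_orth I U" and [measurable]: "g \<in> borel_measurable (PiM I (\<lambda>_. borel))"
  shows "(\<integral>\<^sup>+x. g (lin I U x) \<partial>lebesgue_on_pi I) = (\<integral>\<^sup>+x. g x \<partial>lebesgue_on_pi I)"
proof -
  let ?L = "lebesgue_on_pi I" and ?F = "gauss_density I" and ?T = "lin I U"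
  interpret L: sigma_finite_measure ?L by (rule sigma_finite_lebesgue_on_pi[OF fin])
  interpret P: pair_sigma_finite ?L ?L ..
  \<comment> \<open>Since \<open>?T\<close> is an involution, shifting the argument by
    \<open>?T y\<close> exchanges the roles of \<open>x\<close> and \<open>y\<close>.\<close>
  have T1: "?T (\<lambda>i\<in>I. x i + ?T y i) = (\<lambda>i\<in>I. y i + ?T x i)" for x y
  proof
    fix i
    have "?T (\<lambda>i\<in>I. x i + ?T y i) i = ?T x i + ?T (?T y) i" if "i \<in> I"
      using that by (simp add: lin_def distrib_left sum.distrib)
    then show "?T (\<lambda>i\<in>I. x i + ?T y i) i = (\<lambda>i\<in>I. y i + ?T x i) i"
      using lin_lin[OF fin U, of i y] by (auto simp: lin_def)
  qed
  have F1: "?F (\<lambda>i\<in>I. y i - (if i \<in> I then y i + ?T x i else undefined)) = ?F x" for x y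
    using inner_lin_lin[OF fin U, of x x] by (simp add: gauss_density_eq[OF fin])
  have "(\<integral>\<^sup>+x. g (?T x) \<partial>?L) = (\<integral>\<^sup>+x. (\<integral>\<^sup>+y. ?F y * g (?T x) \<partial>?L) \<partial>?L)"
    by (simp add: nn_integral_multc nn_integral_gauss_density[OF fin])
  also have "\<dots> = (\<integral>\<^sup>+y. (\<integral>\<^sup>+x. ?F y * g (?T x) \<partial>?L) \<partial>?L)"
    by (rule P.Fubini') measurable
  \<comment> \<open>Shift \<open>x\<close> by \<open>?T y\<close>; the Gaussian weight depends on
    \<open>y\<close> alone and is not affected.\<close>
  also have "\<dots> = (\<integral>\<^sup>+y. (\<integral>\<^sup>+x. ?F y * g (\<lambda>i\<in>I. y i + ?T x i) \<partial>?L) \<partial>?L)"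
  proof (rule nn_integral_cong)
    fix y
    show "(\<integral>\<^sup>+x. ?F y * g (?T x) \<partial>?L) = (\<integral>\<^sup>+x. ?F y * g (\<lambda>i\<in>I. y i + ?T x i) \<partial>?L)"
      by (subst nn_integral_lebesgue_on_pi_shift[OF fin, of "\<lambda>x. ?F y * g (?T x)" "?T y", symmetric])
        (simp_all add: T1)
  qed
  also have "\<dots> = (\<integral>\<^sup>+x. (\<integral>\<^sup>+y. ?F y * g (\<lambda>i\<in>I. y i + ?T x i) \<partial>?L) \<partial>?L)"
    by (rule P.Fubini') measurable
  \<comment> \<open>Shift \<open>y\<close> by \<open>- ?T x\<close>: the argument of
    \<open>g\<close> becomes \<open>y\<close> alone, and the dependence on \<open>?T\<close> moves
    into the Gaussian weight.\<close>
  also have "\<dots> = (\<integral>\<^sup>+x. (\<integral>\<^sup>+y. ?F (\<lambda>i\<in>I. y i - ?T x i) * g y \<partial>?L) \<partial>?L)"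
  proof (rule nn_integral_cong)
    fix x
    have "(\<integral>\<^sup>+y. ?F (\<lambda>i\<in>I. y i - ?T x i) * g y \<partial>?L)
      = (\<integral>\<^sup>+y. ?F (\<lambda>i\<in>I. (\<lambda>i\<in>I. y i + ?T x i) i - ?T x i) * g (\<lambda>i\<in>I. y i + ?T x i) \<partial>?L)"
      by (rule nn_integral_lebesgue_on_pi_shift[OF fin, symmetric]) measurable
    also have "\<dots> = (\<integral>\<^sup>+y. ?F y * g (\<lambda>i\<in>I. y i + ?T x i) \<partial>?L)"
      by (intro nn_integral_cong) (simp add: gauss_density_def cong: prod.cong)
    finally show "(\<integral>\<^sup>+y. ?F y * g (\<lambda>i\<in>I. y i + ?T x i) \<partial>?L)
      = (\<integral>\<^sup>+y. ?F (\<lambda>i\<in>I. y i - ?T x i) * g y \<partial>?L)" ..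
  qed
  also have "\<dots> = (\<integral>\<^sup>+y. (\<integral>\<^sup>+x. ?F (\<lambda>i\<in>I. y i - ?T x i) * g y \<partial>?L) \<partial>?L)"
    by (rule P.Fubini') measurable
  \<comment> \<open>A last shift of \<open>x\<close> by \<open>?T y\<close> turns the weight into
    that of \<open>- ?T x\<close>, which equals the weight of \<open>x\<close>.\<close>
  also have "\<dots> = (\<integral>\<^sup>+y. (\<integral>\<^sup>+x. ?F x * g y \<partial>?L) \<partial>?L)"
  proof (rule nn_integral_cong)
    fix y
    show "(\<integral>\<^sup>+x. ?F (\<lambda>i\<in>I. y i - ?T x i) * g y \<partial>?L) = (\<integral>\<^sup>+x. ?F x * g y \<partial>?L)"
      by (subst nn_integral_lebesgue_on_pi_shift[OF fin, of "\<lambda>x. ?F (\<lambda>i\<in>I. y i - ?T x i) * g y" "?T y", symmetric])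
        (simp_all add: T1 F1)
  qed
  also have "\<dots> = (\<integral>\<^sup>+y. g y \<partial>?L)"
    by (simp add: nn_integral_multc nn_integral_gauss_density[OF fin])
  finally show ?thesis .
qed

lemma nn_integral_gauss_orth:
  assumes fin: "finite I" and U: "sym_orth I U" and [measurable]: "g \<in> borel_measurable (PiM I (\<lambda>_. borel))"
  shows "(\<integral>\<^sup>+x. g (lin I U x) \<partial>gauss I) = (\<integral>\<^sup>+x. g x \<partial>gauss I)"
proof -
  have F: "gauss_density I (lin I U x) = gauss_density I x" for x
    by (simp add: gauss_density_eq[OF fin] inner_lin_lin[OF fin U])
  have "(\<integral>\<^sup>+x. g (lin I U x) \<partial>gauss I) = (\<integral>\<^sup>+x. gauss_density I (lin I U x) * g (lin I U x) \<partial>lebesgue_on_pi I)"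
    by (subst nn_integral_gauss[OF fin]) (simp_all add: F)
  also have "\<dots> = (\<integral>\<^sup>+x. gauss_density I x * g x \<partial>lebesgue_on_pi I)"
    by (rule nn_integral_lebesgue_on_pi_orth[OF fin U]) measurable
  finally show ?thesis by (simp add: nn_integral_gauss[OF fin])
qed

section \<open>Measurable projections, reflections and block sums\<close>

text \<open>Projections of measurable sets can fail to be measurable. Here compactness turns the
  existence of a zero into an infimum being \<open>0\<close>, and continuity lets a countable dense
  subset of \<open>K\<close> detect this infimum.\<close>

lemma sets_ex_compact:
  fixes F :: "'w \<Rightarrow> 'a::{metric_space,second_countable_topology} \<Rightarrow> real"
  assumes K: "compact K" and F[measurable]: "\<And>v. v \<in> K \<Longrightarrow> (\<lambda>w. F w v) \<in> borel_measurable M"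
    and cont: "\<And>w. w \<in> space M \<Longrightarrow> continuous_on K (F w)"
  shows "{w \<in> space M. \<exists>v\<in>K. F w v = 0} \<in> sets M"
proof -
  obtain T where T: "countable T" "T \<subseteq> K" "K \<subseteq> closure T"
    by (rule separable)
  have "(\<exists>v\<in>K. F w v = 0) \<longleftrightarrow> (\<forall>k::nat. \<exists>q\<in>T. \<bar>F w q\<bar> < 1 / real (Suc k))" if w: "w \<in> space M" for w
  proof (intro iffI allI)
    fix k :: nat
    assume "\<exists>v\<in>K. F w v = 0"
    then obtain v where v: "v \<in> K" "F w v = 0" by auto
    have "\<exists>d>0. \<forall>x'\<in>K. dist x' v < d \<longrightarrow> dist (F w x') (F w v) < 1 / real (Suc k)"
      using cont[OF w] v(1) unfolding continuous_on_iff by simp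
    then obtain \<delta> where \<delta>: "\<delta> > 0" "\<And>x. x \<in> K \<Longrightarrow> dist x v < \<delta> \<Longrightarrow> dist (F w x) (F w v) < 1 / real (Suc k)"
      by auto
    obtain q where "q \<in> T" "dist q v < \<delta>"
      using T(3) v(1) \<delta>(1) closure_approachable by blast
    then show "\<exists>q\<in>T. \<bar>F w q\<bar> < 1 / real (Suc k)"
      using \<delta>(2)[of q] T(2) v(2) by (auto simp: dist_real_def)
  next
    assume *: "\<forall>k::nat. \<exists>q\<in>T. \<bar>F w q\<bar> < 1 / real (Suc k)"
    then have "K \<noteq> {}" using T(2) by auto
    moreover have "continuous_on K (\<lambda>v. \<bar>F w v\<bar>)"
      using cont[OF w] by (rule continuous_on_rabs)
    ultimately obtain v where v: "v \<in> K" "\<And>y. y \<in> K \<Longrightarrow> \<bar>F w v\<bar> \<le> \<bar>F w y\<bar>"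
      using continuous_attains_inf[OF K] by blast
    have "\<bar>F w v\<bar> < 1 / real (Suc k)" for k
      using * v(2) T(2) by (meson le_less_trans subsetD)
    then have "\<not> 0 < \<bar>F w v\<bar>"
      by (meson nat_approx_posE less_asym)
    then have "F w v = 0" by simp
    then show "\<exists>v\<in>K. F w v = 0" using v(1) by auto
  qed
  then have "{w \<in> space M. \<exists>v\<in>K. F w v = 0} =
      {w \<in> space M. \<forall>k::nat. \<exists>q\<in>T. \<bar>F w q\<bar> < 1 / real (Suc k)}"
    by auto
  also have "\<dots> \<in> sets M"
  proof -
    have "{w \<in> space M. \<bar>F w q\<bar> < 1 / real (Suc k)} \<in> sets M" if "q \<in> T" for q k
    proof -
      have [measurable]: "(\<lambda>w. F w q) \<in> borel_measurable M" using that T(2) by auto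
      show ?thesis by measurable
    qed
    then show ?thesis
      using T(1) by (intro sets.sets_Collect_countable_All sets.sets_Collect_countable_Bex) auto
  qed
  finally show ?thesis .
qed

lemma continuous_on_coordinate [continuous_intros]: "continuous_on S (\<lambda>v. v i :: real)"
  by (rule continuous_on_subset[OF continuous_on_product_coordinates]) simp

text \<open>In the product topology the box is a product of compact intervals, with the factors
  \<open>{0}\<close> beyond \<open>n\<close>.\<close>

lemma compact_rvec_box: "compact {v \<in> rvec n. \<forall>i<n. \<bar>v i\<bar> \<le> b}"
proof -
  have "compactin (product_topology (\<lambda>_. euclidean) UNIV)
     (PiE UNIV (\<lambda>i::nat. if i < n then {- b..b} else {0::real}))"
    by (subst compactin_PiE) auto
  then have "compact (PiE UNIV (\<lambda>i::nat. if i < n then {- b..b} else {0::real}))"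
    by (simp add: euclidean_product_topology)
  also have "PiE UNIV (\<lambda>i::nat. if i < n then {- b..b} else {0::real}) = {v \<in> rvec n. \<forall>i<n. \<bar>v i\<bar> \<le> b}"
  proof (intro Set.set_eqI)
    fix v :: "nat \<Rightarrow> real"
    have "v i \<in> (if i < n then {- b..b} else {0}) \<longleftrightarrow> (i < n \<longrightarrow> \<bar>v i\<bar> \<le> b) \<and> (i \<ge> n \<longrightarrow> v i = 0)" for i
      by (auto simp: abs_le_iff)
    then show "v \<in> PiE UNIV (\<lambda>i::nat. if i < n then {- b..b} else {0::real}) \<longleftrightarrow> v \<in> {v \<in> rvec n. \<forall>i<n. \<bar>v i\<bar> \<le> b}"
      by (simp add: PiE_iff rvec_def) blast
  qed
  finally show ?thesis .
qed

lemma abs_le_one_of_sum_squares: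
  assumes "finite I" "(\<Sum>i\<in>I. v i * v i) \<le> (1::real)" "i \<in> I"
  shows "\<bar>v i\<bar> \<le> 1"
proof -
  have "v i * v i \<le> (\<Sum>i\<in>I. v i * v i)"
    using assms by (intro member_le_sum) auto
  then have "(v i)\<^sup>2 \<le> 1" using assms(2) by (simp add: power2_eq_square)
  then show ?thesis by (simp add: abs_square_le_1)
qed

lemma compact_rvec_inter:
  assumes "closed C" "C \<subseteq> {v. (\<Sum>i<n. v i * v i) \<le> 1}"
  shows "compact (rvec n \<inter> C)"
proof -
  have "rvec n \<inter> C = {v \<in> rvec n. \<forall>i<n. \<bar>v i\<bar> \<le> 1} \<inter> C"
    using assms(2) abs_le_one_of_sum_squares[of "{..<n}"] by auto
  then show ?thesis
    using compact_Int_closed[OF compact_rvec_box assms(1)] by simp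
qed

lemma compact_rvec_sphere: "compact {v \<in> rvec n. (\<Sum>i<n. v i * v i) = 1}"
proof -
  have "closed {v. (\<Sum>i<n. v i * v i) = (1::real)}"
    by (intro closed_Collect_eq continuous_intros)
  from compact_rvec_inter[OF this, of n] show ?thesis
    by (simp add: Int_def subset_eq)
qed

lemma compact_rvec_ball: "compact {v \<in> rvec n. v 0 = 0 \<and> (\<Sum>i<n. v i * v i) \<le> 1}"
proof -
  have "closed {v. v 0 = (0::real) \<and> (\<Sum>i<n. v i * v i) \<le> (1::real)}"
    by (intro closed_Collect_conj closed_Collect_eq closed_Collect_le continuous_intros)
  from compact_rvec_inter[OF this, of n] show ?thesis
    by (simp add: Int_def subset_eq)
qed

text \<open>Fubini for null sets. It lets an almost sure statement be verified along a single
  coordinate, on which a polynomial or a determinant depends in a nontrivial way.\<close>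

lemma (in product_sigma_finite) AE_PiM_insert:
  assumes "finite I" "i \<notin> I"
    and P[measurable]: "Measurable.pred (PiM (insert i I) M) P"
    and ae: "AE x in PiM I M. AE y in M i. P (x(i := y))"
  shows "AE x in PiM (insert i I) M. P x"
proof -
  have "(\<integral>\<^sup>+x. indicator {x \<in> space (PiM (insert i I) M). \<not> P x} x \<partial>PiM (insert i I) M)
    = (\<integral>\<^sup>+x. (\<integral>\<^sup>+y. indicator {x \<in> space (PiM (insert i I) M). \<not> P x} (x(i := y)) \<partial>M i) \<partial>PiM I M)"
    by (rule product_nn_integral_insert[OF assms(1,2)]) measurable
  also have "\<dots> = (\<integral>\<^sup>+x. 0 \<partial>PiM I M)"
  proof (rule nn_integral_cong_AE)
    show "AE x in PiM I M. (\<integral>\<^sup>+y. indicator {x \<in> space (PiM (insert i I) M). \<not> P x} (x(i := y)) \<partial>M i) = 0"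
      using ae
    proof eventually_elim
      case (elim x)
      then have "(\<integral>\<^sup>+y. indicator {x \<in> space (PiM (insert i I) M). \<not> P x} (x(i := y)) \<partial>M i) = (\<integral>\<^sup>+y. 0 \<partial>M i)"
        by (intro nn_integral_cong_AE) (auto elim: eventually_mono)
      then show ?case by simp
    qed
  qed
  finally have "emeasure (PiM (insert i I) M) {x \<in> space (PiM (insert i I) M). \<not> P x} = 0"
    by simp
  then show ?thesis
    by (subst AE_iff_measurable[OF _ refl]) auto
qed

section \<open>Householder reflections\<close>

text \<open>The reflection in the hyperplane orthogonal to \<open>u\<close>; if \<open>u\<close>
  vanishes on \<open>I\<close>, the division by \<open>0\<close> turns it into the identity.\<close>

definition householder :: "'i set \<Rightarrow> ('i \<Rightarrow> real) \<Rightarrow> 'i \<Rightarrow> 'i \<Rightarrow> real" where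
  "householder I u i j = of_bool (i = j) - 2 * u i * u j / (\<Sum>k\<in>I. u k * u k)"

lemma lin_householder:
  assumes "finite I" "i \<in> I"
  shows "lin I (householder I u) x i = x i - 2 * u i * (\<Sum>k\<in>I. u k * x k) / (\<Sum>k\<in>I. u k * u k)"
proof -
  have "lin I (householder I u) x i
      = (\<Sum>j\<in>I. of_bool (i = j) * x j) - (\<Sum>j\<in>I. 2 * u i * u j / (\<Sum>k\<in>I. u k * u k) * x j)"
    using assms(2) by (simp add: lin_def householder_def left_diff_distrib sum_subtractf)
  also have "(\<Sum>j\<in>I. of_bool (i = j) * x j) = x i"
    using assms by (simp add: of_bool_def if_distrib[of "\<lambda>a. a * _"] sum.delta cong: if_cong)
  also have "(\<Sum>j\<in>I. 2 * u i * u j / (\<Sum>k\<in>I. u k * u k) * x j)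
      = 2 * u i * (\<Sum>k\<in>I. u k * x k) / (\<Sum>k\<in>I. u k * u k)"
    by (simp add: sum_distrib_left sum_divide_distrib mult_ac)
  finally show ?thesis .
qed

lemma sym_orth_householder:
  assumes "finite I"
  shows "sym_orth I (householder I u)"
  unfolding sym_orth_def
proof (intro ballI conjI)
  fix i j assume ij: "i \<in> I" "j \<in> I"
  let ?s = "\<Sum>k\<in>I. u k * u k"
  show "householder I u i j = householder I u j i"
    by (auto simp: householder_def)
  have "(\<Sum>k\<in>I. householder I u i k * householder I u k j) = lin I (householder I u) (\<lambda>k. householder I u k j) i"
    using ij by (simp add: lin_def)
  also have "\<dots> = householder I u i j - 2 * u i * (\<Sum>k\<in>I. u k * householder I u k j) / ?s"
    by (rule lin_householder[OF assms ij(1)])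
  also have "(\<Sum>k\<in>I. u k * householder I u k j) = (\<Sum>k\<in>I. of_bool (k = j) * u k) - (\<Sum>k\<in>I. u k * u k * (2 * u j / ?s))"
    unfolding householder_def sum_subtractf[symmetric]
    by (intro sum.cong) (auto simp: algebra_simps)
  also have "\<dots> = u j - ?s * (2 * u j / ?s)"
    using assms ij by (simp add: of_bool_def if_distrib[of "\<lambda>a. a * _"] sum.delta sum_distrib_right sum_divide_distrib cong: if_cong)
  finally show "(\<Sum>k\<in>I. householder I u i k * householder I u k j) = of_bool (i = j)"
    by (cases "?s = 0") (auto simp: householder_def)
qed

lemma ex_sym_orth_to_axis:
  fixes w :: "'i \<Rightarrow> real"
  assumes fin: "finite I" and e: "e \<in> I"
  obtains U where "sym_orth I U"
    "\<And>i. i \<in> I \<Longrightarrow> lin I U w i = (if i = e then sqrt (\<Sum>k\<in>I. w k * w k) else 0)"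
proof
  define s where "s = sqrt (\<Sum>k\<in>I. w k * w k)"
  \<comment> \<open>The hyperplane orthogonal to \<open>u\<close> bisects \<open>w\<close> and
    \<open>s\<close> times the axis vector, which have equal length, so the reflection exchanges
    them.\<close>
  define u where "u i = w i - (if i = e then s else 0)" for i
  have ss: "s * s = (\<Sum>k\<in>I. w k * w k)"
    unfolding s_def by (simp add: sum_nonneg)
  show "sym_orth I (householder I u)" by (rule sym_orth_householder[OF fin])
  have ux: "(\<Sum>k\<in>I. u k * x k) = (\<Sum>k\<in>I. w k * x k) - s * x e" for x
    using fin e by (simp add: u_def left_diff_distrib sum_subtractf if_distrib[of "\<lambda>a. a * _"] sum.delta cong: if_cong)
  have uw: "(\<Sum>k\<in>I. u k * w k) = s * s - s * w e"
    by (simp add: ux ss)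
  have "(\<Sum>k\<in>I. w k * u k) = (\<Sum>k\<in>I. u k * w k)" by (simp add: mult.commute)
  \<comment> \<open>The squared norm of \<open>u\<close> is twice its inner product with
    \<open>w\<close>, so the reflection subtracts exactly \<open>u\<close> from
    \<open>w\<close>.\<close>
  then have uu: "(\<Sum>k\<in>I. u k * u k) = 2 * (s * s - s * w e)"
    unfolding ux[of u] uw by (simp add: u_def algebra_simps)
  fix i assume i: "i \<in> I"
  have "lin I (householder I u) w i = w i - u i"
  proof (cases "(\<Sum>k\<in>I. u k * u k) = 0")
    case True
    then have "u i * u i = 0"
      using sum_nonneg_eq_0_iff[of I "\<lambda>k. u k * u k"] fin i by auto
    then show ?thesis by (simp add: lin_householder[OF fin i])
  next
    case False
    have "2 * u i * (\<Sum>k\<in>I. u k * w k) / (\<Sum>k\<in>I. u k * u k) = u i"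
      using False uu uw by (subst nonzero_divide_eq_eq) auto
    then show ?thesis
      by (simp only: lin_householder[OF fin i])
  qed
  then show "lin I (householder I u) w i = (if i = e then sqrt (\<Sum>k\<in>I. w k * w k) else 0)"
    by (simp add: u_def s_def)
qed

text \<open>Sums over disjoint blocks of independent standard Gaussians are independent Gaussians
  whose variances are the block sizes; dividing by the square roots makes them standard. This yields
  the law of the linear part of the eigenvector equation.\<close>

lemma gauss_block_sums:
  assumes fin: "finite K" and L: "finite L" "L \<noteq> {}" and S: "\<And>l. l \<in> L \<Longrightarrow> S l \<subseteq> K" "\<And>l. l \<in> L \<Longrightarrow> S l \<noteq> {}"
    and disj: "disjoint_family_on S L"
  shows "distr (gauss K) (PiM L (\<lambda>_. borel)) (\<lambda>x. \<lambda>l\<in>L. (\<Sum>k\<in>S l. x k) / sqrt (real (card (S l)))) = gauss L"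
proof -
  interpret prob_space "gauss K" by (rule prob_space_gauss)
  let ?N = "density lborel std_normal_density"
  have comp: "distr (gauss K) borel (\<lambda>x. x k) = ?N" if "k \<in> K" for k
  proof -
    have "distr (gauss K) borel (\<lambda>x. x k) = distr (gauss K) ?N (\<lambda>x. x k)"
      by (intro distr_cong) auto
    also have "\<dots> = ?N"
      unfolding gauss_def using that by (intro distr_PiM_component prob_space_std_normal)
    finally show ?thesis .
  qed
  have finS: "finite (S l)" if "l \<in> L" for l using S(1)[OF that] fin by (rule finite_subset)
  have "K \<noteq> {}" using L S by blast
  have rest: "restrict x K = x" if "x \<in> space (gauss K)" for x
    using that by (simp add: space_gauss extensional_restrict)
  have "distr (gauss K) (PiM K (\<lambda>_. borel)) (\<lambda>x. \<lambda>k\<in>K. x k) = distr (gauss K) (gauss K) (\<lambda>x. x)"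
    by (intro distr_cong) (auto simp: sets_gauss rest)
  also have "\<dots> = PiM K (\<lambda>k. distr (gauss K) borel (\<lambda>x. x k))"
    by (simp add: distr_id2 gauss_def comp[unfolded gauss_def] cong: PiM_cong)
  finally have ind: "indep_vars (\<lambda>_. borel) (\<lambda>k x. x k) K"
    using \<open>K \<noteq> {}\<close> by (subst indep_vars_iff_distr_eq_PiM') auto
  let ?X = "\<lambda>l x. (\<Sum>k\<in>S l. x k) / sqrt (real (card (S l)))"
  have "indep_vars (\<lambda>l. PiM (S l) (\<lambda>_. borel)) (\<lambda>l x. \<lambda>k\<in>S l. x k) L"
    by (rule indep_vars_restrict[OF ind S(1) disj])
  then have "indep_vars (\<lambda>_. borel) (\<lambda>l x. (\<lambda>y. (\<Sum>k\<in>S l. y k) / sqrt (real (card (S l)))) (\<lambda>k\<in>S l. x k)) L"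
    by (rule indep_vars_compose2) measurable
  then have indX: "indep_vars (\<lambda>_. borel) ?X L"
    by (simp cong: sum.cong)
  have distX: "distr (gauss K) borel (?X l) = ?N" if l: "l \<in> L" for l
  proof -
    have "distributed (gauss K) lborel (\<lambda>x. \<Sum>k\<in>S l. x k)
        (normal_density (\<Sum>k\<in>S l. 0) (sqrt (\<Sum>k\<in>S l. 1\<^sup>2)))"
    proof (rule sum_indep_normal[OF finS[OF l] S(2)[OF l]])
      show "indep_vars (\<lambda>_. borel) (\<lambda>k x. x k) (S l)"
        using ind S(1)[OF l] by (rule indep_vars_subset)
      fix k assume "k \<in> S l"
      then have "k \<in> K" using S(1)[OF l] by auto
      then show "distributed (gauss K) lborel (\<lambda>x. x k) (\<lambda>x. ennreal (std_normal_density x))"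
        using comp[of k] by (auto simp: distributed_def cong: distr_cong)
    qed simp
    then have *: "distributed (gauss K) lborel (\<lambda>x. \<Sum>k\<in>S l. x k) (normal_density 0 (sqrt (real (card (S l)))))"
      by simp
    have pos: "0 < sqrt (real (card (S l)))"
      using finS[OF l] S(2)[OF l] by (simp add: card_gt_0_iff)
    have "distributed (gauss K) lborel (\<lambda>x. 0 + (1 / sqrt (real (card (S l)))) * (\<Sum>k\<in>S l. x k))
       (normal_density (0 + (1 / sqrt (real (card (S l)))) * 0) (\<bar>1 / sqrt (real (card (S l)))\<bar> * sqrt (real (card (S l)))))"
      using pos by (intro normal_density_affine *) auto
    then have "distributed (gauss K) lborel (?X l) std_normal_density"
      using pos by simp
    then have "distr (gauss K) lborel (?X l) = ?N"
      by (simp add: distributed_def)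
    then show ?thesis by (simp cong: distr_cong)
  qed
  have meas: "?X l \<in> borel_measurable (gauss K)" if "l \<in> L" for l
    using S(1)[OF that]
    by (intro borel_measurable_divide borel_measurable_sum) (auto intro: measurable_component_singleton simp: measurable_cong_sets[OF sets_gauss refl])
  have "distr (gauss K) (PiM L (\<lambda>_. borel)) (\<lambda>x. \<lambda>l\<in>L. ?X l x) = PiM L (\<lambda>l. distr (gauss K) borel (?X l))"
    using indX L meas by (subst (asm) indep_vars_iff_distr_eq_PiM') auto
  also have "\<dots> = gauss L"
    unfolding gauss_def by (intro PiM_cong refl distX[unfolded gauss_def])
  finally show ?thesis .
qed

section \<open>The expected number of lines in a random cone\<close>

definition ip :: "nat \<Rightarrow> (nat \<Rightarrow> real) \<Rightarrow> (nat \<Rightarrow> real) \<Rightarrow> real" where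
  "ip n v w = (\<Sum>i<n. v i * w i)"

text \<open>The condition says that the angle between the lines spanned by \<open>v\<close> and \<open>w\<close>
  has tangent at most \<open>sqrt e\<close>.\<close>

definition near :: "nat \<Rightarrow> real \<Rightarrow> (nat \<Rightarrow> real) \<Rightarrow> (nat \<Rightarrow> real) \<Rightarrow> bool" where
  "near n e v w \<longleftrightarrow> 0 < ip n w w \<and> ip n v v * ip n w w \<le> (1 + e) * (ip n v w)\<^sup>2"

definition first_axis :: "nat \<Rightarrow> real" where
  "first_axis i = of_bool (i = 0)"

definition cap_prob :: "nat \<Rightarrow> real \<Rightarrow> ennreal" where
  "cap_prob n e = emeasure (gauss {..<n}) {x \<in> space (gauss {..<n}). near n e first_axis x}"

lemma ip_commute: "ip n v w = ip n w v"
  by (simp add: ip_def mult.commute)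

lemma ip_cong: "(\<And>i. i < n \<Longrightarrow> v i = v' i) \<Longrightarrow> (\<And>i. i < n \<Longrightarrow> w i = w' i) \<Longrightarrow> ip n v w = ip n v' w'"
  by (simp add: ip_def)

lemma near_cong:
  "(\<And>i. i < n \<Longrightarrow> v i = v' i) \<Longrightarrow> (\<And>i. i < n \<Longrightarrow> w i = w' i) \<Longrightarrow> near n e v w = near n e v' w'"
  using ip_cong[of n v v' w w'] ip_cong[of n v v' v v'] ip_cong[of n w w' w w'] by (simp add: near_def)

lemma ip_scale_left: "ip n (\<lambda>i. c * v i) w = c * ip n v w"
  by (simp add: ip_def sum_distrib_left mult.assoc)

lemma ip_scale_right: "ip n v (\<lambda>i. c * w i) = c * ip n v w"
  by (simp add: ip_def sum_distrib_left mult_ac)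

lemma ip_lin:
  "sym_orth {..<n} U \<Longrightarrow> ip n (lin {..<n} U v) (lin {..<n} U w) = ip n v w"
  unfolding ip_def by (rule inner_lin_lin) auto

lemma near_lin:
  "sym_orth {..<n} U \<Longrightarrow> near n e (lin {..<n} U v) (lin {..<n} U w) = near n e v w"
  by (simp add: near_def ip_lin)

lemma near_scale_left: "c \<noteq> 0 \<Longrightarrow> near n e (\<lambda>i. c * v i) w = near n e v w"
proof -
  assume "c \<noteq> 0"
  then have "c * (c * ip n v v) * ip n w w \<le> (1 + e) * (c * ip n v w)\<^sup>2
      \<longleftrightarrow> c\<^sup>2 * (ip n v v * ip n w w) \<le> c\<^sup>2 * ((1 + e) * (ip n v w)\<^sup>2)"
    by (simp add: power2_eq_square mult_ac)
  also have "\<dots> \<longleftrightarrow> ip n v v * ip n w w \<le> (1 + e) * (ip n v w)\<^sup>2"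
    using \<open>c \<noteq> 0\<close> by (intro mult_le_cancel_left_pos) simp
  finally show ?thesis by (simp add: near_def ip_scale_left ip_scale_right)
qed

lemma near_scale_right: "c \<noteq> 0 \<Longrightarrow> near n e v (\<lambda>i. c * w i) = near n e v w"
proof -
  assume "c \<noteq> 0"
  then have "ip n v v * (c * (c * ip n w w)) \<le> (1 + e) * (c * ip n v w)\<^sup>2
      \<longleftrightarrow> c\<^sup>2 * (ip n v v * ip n w w) \<le> c\<^sup>2 * ((1 + e) * (ip n v w)\<^sup>2)"
    by (simp add: power2_eq_square mult_ac)
  also have "\<dots> \<longleftrightarrow> ip n v v * ip n w w \<le> (1 + e) * (ip n v w)\<^sup>2"
    using \<open>c \<noteq> 0\<close> by (intro mult_le_cancel_left_pos) simp
  finally have "ip n v v * (c * (c * ip n w w)) \<le> (1 + e) * (c * ip n v w)\<^sup>2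
      \<longleftrightarrow> ip n v v * ip n w w \<le> (1 + e) * (ip n v w)\<^sup>2" .
  moreover have "0 < c * (c * ip n w w) \<longleftrightarrow> 0 < ip n w w"
    using \<open>c \<noteq> 0\<close> by (auto simp: zero_less_mult_iff mult_less_0_iff)
  ultimately show ?thesis
    by (simp add: near_def ip_scale_left ip_scale_right)
qed

lemma measurable_ip [measurable]:
  "(\<lambda>x. ip n v x) \<in> borel_measurable (PiM {..<n} (\<lambda>_. borel))"
  "(\<lambda>x. ip n x x) \<in> borel_measurable (PiM {..<n} (\<lambda>_. borel))"
  unfolding ip_def by measurable

lemma measurable_near [measurable]:
  "Measurable.pred (PiM {..<n} (\<lambda>_. borel)) (near n e v)"
  unfolding near_def[abs_def] pred_def
  by (intro sets.sets_Collect_conj borel_measurable_less borel_measurable_le borel_measurable_times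
      borel_measurable_power measurable_ip borel_measurable_const)

lemma ip_first_axis:
  assumes "n > 0"
  shows "ip n v first_axis = v 0" "ip n first_axis v = v 0" "ip n first_axis first_axis = 1"
proof -
  have "ip n v first_axis = (\<Sum>i<n. if i = 0 then v i else 0)" for v
    unfolding ip_def by (intro sum.cong) (auto simp: first_axis_def)
  then have "ip n v first_axis = v 0" for v using assms by (simp add: sum.delta)
  then show "ip n v first_axis = v 0" "ip n first_axis v = v 0" "ip n first_axis first_axis = 1"
    by (simp_all add: ip_commute[of n first_axis v]) (simp add: first_axis_def)
qed

lemma ex_sym_orth_axis:
  assumes "n > 0" "0 < ip n x x"
  obtains U where "sym_orth {..<n} U" "\<And>i. i < n \<Longrightarrow> lin {..<n} U x i = sqrt (ip n x x) * first_axis i"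
proof -
  from assms(1) have "0 \<in> {..<n}" by simp
  from ex_sym_orth_to_axis[OF finite_lessThan this, of x]
  obtain U where "sym_orth {..<n} U"
    "\<And>i. i \<in> {..<n} \<Longrightarrow> lin {..<n} U x i = (if i = 0 then sqrt (\<Sum>k<n. x k * x k) else 0)"
    by metis
  then show ?thesis using that[of U] by (auto simp: first_axis_def ip_def)
qed

text \<open>A reflection taking \<open>z\<close> to the positive first axis preserves both the
  Gaussian measure and nearness.\<close>

lemma cap_prob_eq:
  assumes n: "n > 0" and z: "0 < ip n z z"
  shows "emeasure (gauss {..<n}) {x \<in> space (gauss {..<n}). near n e z x} = cap_prob n e"
proof -
  obtain U where U: "sym_orth {..<n} U" "\<And>i. i < n \<Longrightarrow> lin {..<n} U z i = sqrt (ip n z z) * first_axis i"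
    using ex_sym_orth_axis[OF n z] by metis
  have "near n e first_axis (lin {..<n} U x) = near n e z x" for x
  proof -
    have "near n e first_axis (lin {..<n} U x) = near n e (\<lambda>i. sqrt (ip n z z) * first_axis i) (lin {..<n} U x)"
      using z by (simp add: near_scale_left)
    also have "\<dots> = near n e (lin {..<n} U z) (lin {..<n} U x)"
      using U(2) by (intro near_cong) auto
    finally show ?thesis by (simp add: near_lin[OF U(1)])
  qed
  then have "(\<integral>\<^sup>+x. indicator {x. near n e z x} x \<partial>gauss {..<n})
      = (\<integral>\<^sup>+x. indicator {x. near n e first_axis x} (lin {..<n} U x) \<partial>gauss {..<n})"
    by (simp add: indicator_def)
  also have "\<dots> = (\<integral>\<^sup>+x. indicator {x. near n e first_axis x} x \<partial>gauss {..<n})"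
    by (rule nn_integral_gauss_orth[OF finite_lessThan U(1)]) measurable
  finally have eq: "(\<integral>\<^sup>+x. indicator {x. near n e z x} x \<partial>gauss {..<n}) = (\<integral>\<^sup>+x. indicator {x. near n e first_axis x} x \<partial>gauss {..<n})" .
  have "(\<integral>\<^sup>+x. indicator {x. near n e v x} x \<partial>gauss {..<n}) =
     emeasure (gauss {..<n}) {x \<in> space (gauss {..<n}). near n e v x}" for v
  proof -
    have "(\<integral>\<^sup>+x. indicator {x. near n e v x} x \<partial>gauss {..<n})
        = (\<integral>\<^sup>+x. indicator {x \<in> space (gauss {..<n}). near n e v x} x \<partial>gauss {..<n})"
      by (intro nn_integral_cong) (simp add: indicator_def)
    also have "\<dots> = emeasure (gauss {..<n}) {x \<in> space (gauss {..<n}). near n e v x}"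
      by (rule nn_integral_indicator) measurable
    finally show ?thesis .
  qed
  then show ?thesis using eq by (simp add: cap_prob_def)
qed

lemma std_normal_interval_pos:
  assumes "a < b"
  shows "0 < emeasure (density lborel std_normal_density) {a..b}"
proof (rule ccontr)
  assume "\<not> ?thesis"
  then have "{a..b} \<in> null_sets (density lborel std_normal_density)"
    by (auto simp: null_sets_def not_less)
  then have "AE x in lborel. x \<in> {a..b} \<longrightarrow> ennreal (std_normal_density x) = 0"
    by (subst (asm) null_sets_density_iff) auto
  moreover have "ennreal (std_normal_density x) \<noteq> 0" for x
    using normal_density_pos[of 1 0 x] by (simp add: ennreal_eq_0_iff not_le)
  ultimately have "AE x in lborel. x \<notin> {a..b}"
    by simp
  then have "{a..b} \<in> null_sets lborel"
    by (subst AE_iff_null_sets) auto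
  then have "emeasure lborel {a..b} = 0" by (rule null_setsD1)
  then show False using assms by simp
qed

lemma prod_ennreal_nonzero:
  fixes f :: "'a \<Rightarrow> ennreal"
  shows "finite A \<Longrightarrow> (\<And>i. i \<in> A \<Longrightarrow> f i \<noteq> 0) \<Longrightarrow> prod f A \<noteq> 0"
  by (induction rule: finite_induct) auto

lemma cap_prob_pos:
  assumes n: "n > 0" and e: "e > 0"
  shows "0 < cap_prob n e"
proof -
  \<comment> \<open>The choice makes \<open>n\<close> squares of numbers bounded by \<open>d\<close>
    add up to at most \<open>e\<close>, hence to at most \<open>e\<close> times the square of
    \<open>x 0\<close>, which is at least \<open>1\<close> on the box below.\<close>
  define d where "d = sqrt (e / real n)"
  have d: "d > 0" "real n * d\<^sup>2 = e" using n e by (auto simp: d_def)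
  define B where "B = PiE {..<n} (\<lambda>i. if i = 0 then {1..2} else {- d..d})"
  have B: "B \<subseteq> {x \<in> space (gauss {..<n}). near n e first_axis x}"
  proof safe
    fix x assume x: "x \<in> B"
    then show "x \<in> space (gauss {..<n})"
      by (auto simp: B_def space_gauss PiE_def)
    have mem: "x i \<in> (if i = 0 then {1..2} else {- d..d})" if "i < n" for i
      using PiE_mem[OF x[unfolded B_def], of i] that by simp
    have x0: "1 \<le> x 0" using mem[OF n] by simp
    have xi: "x i * x i \<le> d\<^sup>2" if "0 < i" "i < n" for i
    proof -
      have "\<bar>x i\<bar> \<le> \<bar>d\<bar>" using mem[of i] that d by auto
      then show ?thesis by (metis abs_le_square_iff power2_eq_square)
    qed
    have x00: "1 \<le> (x 0)\<^sup>2" using x0 by (simp add: one_le_power)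
    have ipx: "ip n x x = (x 0)\<^sup>2 + (\<Sum>i\<in>{..<n} - {0}. x i * x i)"
      unfolding ip_def using n by (subst sum.remove[of _ 0]) (auto simp: power2_eq_square)
    have "(\<Sum>i\<in>{..<n} - {0}. x i * x i) \<le> (\<Sum>i\<in>{..<n} - {0}. d\<^sup>2)"
      using xi by (intro sum_mono) auto
    also have "\<dots> \<le> real n * d\<^sup>2"
      using card_mono[of "{..<n}" "{..<n} - {0}"] by (simp add: mult_right_mono del: card_Diff_insert)
    also have "\<dots> \<le> e * (x 0)\<^sup>2"
      using mult_left_mono[OF x00, of e] e d by simp
    finally have "ip n x x \<le> (1 + e) * (x 0)\<^sup>2" by (simp add: ipx distrib_right)
    moreover have "0 \<le> (\<Sum>i\<in>{..<n} - {0}. x i * x i)" by (intro sum_nonneg) auto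
    ultimately show "near n e first_axis x"
      using x00 by (simp add: near_def ip_first_axis[OF n] ipx) (simp add: first_axis_def)
  qed
  have "emeasure (gauss {..<n}) B = (\<Prod>i<n. emeasure (density lborel std_normal_density) (if i = 0 then {1..2} else {- d..d}))"
    unfolding gauss_def B_def by (intro gau.emeasure_PiM) auto
  also have "\<dots> > 0"
  proof -
    have "emeasure (density lborel std_normal_density) (if i = 0 then {1..2} else {- d..d}) \<noteq> 0" for i :: nat
      using std_normal_interval_pos[of 1 2] std_normal_interval_pos[of "- d" d] d(1) by (cases "i = 0") auto
    then show ?thesis
      unfolding zero_less_iff_neq_zero by (intro prod_ennreal_nonzero) auto
  qed
  finally have "0 < emeasure (gauss {..<n}) B" .
  also have "\<dots> \<le> cap_prob n e"
    unfolding cap_prob_def using B by (intro emeasure_mono) auto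
  finally show ?thesis .
qed

lemma cap_prob_le_1: "cap_prob n e \<le> 1"
  unfolding cap_prob_def by (rule prob_space.emeasure_le_1[OF prob_space_gauss])

lemma ip_Cauchy_Schwarz: "(ip n v w)\<^sup>2 \<le> ip n v v * ip n w w"
  using Cauchy_Schwarz_ineq_sum[of v w "{..<n}"] by (simp add: ip_def power2_eq_square)

text \<open>Two unit vectors whose lines are close to a common line are almost parallel: apply
  Cauchy-Schwarz to their components orthogonal to that line.\<close>

lemma near_near:
  assumes z: "ip n z z = 1" "ip n z' z' = 1" and near: "near n e z x" "near n e z' x" and e: "0 < e"
  shows "1 - 2 * e \<le> \<bar>ip n z z'\<bar>"
proof -
  define S a b g where "S = ip n x x" and "a = ip n z x" and "b = ip n z' x" and "g = ip n z z'"
  have S: "0 < S" "S \<le> (1 + e) * a\<^sup>2" "S \<le> (1 + e) * b\<^sup>2"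
    using near z by (auto simp: near_def S_def a_def b_def)
  have ab: "a\<^sup>2 \<le> S" "b\<^sup>2 \<le> S"
    using ip_Cauchy_Schwarz[of n z x] ip_Cauchy_Schwarz[of n z' x] z by (auto simp: S_def a_def b_def)
  \<comment> \<open>\<open>S\<close> times the components of \<open>z\<close> and \<open>z'\<close>
    orthogonal to \<open>x\<close>.\<close>
  define q q' where "q i = S * z i - a * x i" and "q' i = S * z' i - b * x i" for i
  have expand: "ip n (\<lambda>i. S * v i - c * x i) (\<lambda>i. S * v' i - c' * x i)
      = S * S * ip n v v' - S * c' * ip n v x - S * c * ip n v' x + c * c' * S" for v v' c c'
  proof -
    have "ip n (\<lambda>i. S * v i - c * x i) (\<lambda>i. S * v' i - c' * x i)
      = (\<Sum>i<n. S * S * (v i * v' i) - S * c' * (v i * x i) - S * c * (v' i * x i) + c * c' * (x i * x i))"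
      unfolding ip_def by (intro sum.cong) (auto simp: algebra_simps)
    then show ?thesis
      by (simp add: sum.distrib sum_subtractf ip_def S_def sum_distrib_left)
  qed
  have "(ip n q q')\<^sup>2 \<le> ip n q q * ip n q' q'" by (rule ip_Cauchy_Schwarz)
  also have "ip n q q' = S * (S * g - a * b)"
    unfolding q_def q'_def expand by (simp add: a_def[symmetric] b_def[symmetric] g_def algebra_simps)
  also have "ip n q q = S * (S - a\<^sup>2)"
    unfolding q_def expand by (simp add: a_def[symmetric] z algebra_simps power2_eq_square)
  also have "ip n q' q' = S * (S - b\<^sup>2)"
    unfolding q'_def expand by (simp add: b_def[symmetric] z algebra_simps power2_eq_square)
  finally have "S\<^sup>2 * (S * g - a * b)\<^sup>2 \<le> S\<^sup>2 * ((S - a\<^sup>2) * (S - b\<^sup>2))"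
    by (simp add: power2_eq_square mult_ac)
  then have "(S * g - a * b)\<^sup>2 \<le> (S - a\<^sup>2) * (S - b\<^sup>2)"
    using S(1) by (simp add: mult_le_cancel_left_pos)
  also have "\<dots> \<le> (e * S) * (e * S)"
  proof (intro mult_mono)
    have "e * a\<^sup>2 \<le> e * S" "e * b\<^sup>2 \<le> e * S"
      using ab e by (auto intro: mult_left_mono)
    then show "S - a\<^sup>2 \<le> e * S" "S - b\<^sup>2 \<le> e * S"
      using S(2,3) unfolding distrib_right by linarith+
  qed (use ab S e in auto)
  finally have 1: "\<bar>S * g - a * b\<bar> \<le> e * S"
    using abs_le_square_iff[of "S * g - a * b" "e * S"] S e by (simp add: power2_eq_square)
  have "S * S \<le> ((1 + e) * a\<^sup>2) * ((1 + e) * b\<^sup>2)"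
    using S e by (intro mult_mono) auto
  then have "S\<^sup>2 \<le> ((1 + e) * (a * b))\<^sup>2" by (simp add: power2_eq_square mult_ac)
  then have 2: "S \<le> (1 + e) * \<bar>a * b\<bar>"
    using abs_le_square_iff[of S "(1 + e) * (a * b)"] S e by (simp add: abs_mult)
  have "\<bar>a\<bar>\<^sup>2 * \<bar>b\<bar>\<^sup>2 \<le> S * S"
    using ab S by (intro mult_mono) auto
  then have "(\<bar>a * b\<bar>)\<^sup>2 \<le> S\<^sup>2"
    by (simp add: power2_eq_square abs_mult mult_ac)
  then have 3: "\<bar>a * b\<bar> \<le> S" using abs_le_square_iff[of "a * b" S] S by simp
  \<comment> \<open>By 2 and 3, \<open>S\<close> exceeds \<open>\<bar>a * b\<bar>\<close> by at most
    \<open>e * S\<close>. The second \<open>e\<close> in the final bound comes from 1.\<close>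
  have "S * (1 - e) \<le> \<bar>a * b\<bar>"
  proof -
    have "e * \<bar>a * b\<bar> \<le> e * S" using 3 e by (intro mult_left_mono) auto
    then show ?thesis using 2 by (simp only: distrib_right right_diff_distrib mult.commute[of e S])
  qed
  then have "S * (1 - 2 * e) \<le> S * \<bar>g\<bar>"
    using 1 S(1) abs_mult[of S g] by (simp add: algebra_simps abs_if split: if_splits)
  then show ?thesis
    using S(1) by (simp add: g_def mult_le_cancel_left_pos)
qed

section \<open>Counting lines through nearby directions\<close>

definition ecard :: "'a set \<Rightarrow> ennreal" where
  "ecard Q = (if finite Q then of_nat (card Q) else \<infinity>)"

text \<open>\<open>R\<close> picks one of the two unit vectors on each line where \<open>Z\<close>
  holds: the strict bound on \<open>\<bar>ip n v w\<bar>\<close> says that distinct elements are not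
  antipodal either. In this form classes of eigenpairs and kernels of linear systems are counted
  alike.\<close>

definition line_reps :: "nat \<Rightarrow> ((nat \<Rightarrow> real) \<Rightarrow> bool) \<Rightarrow> (nat \<Rightarrow> real) set \<Rightarrow> bool" where
  "line_reps n Z R \<longleftrightarrow>
     (\<forall>v\<in>R. v \<in> rvec n \<and> ip n v v = 1 \<and> Z v) \<and>
     (\<forall>v\<in>rvec n. ip n v v = 1 \<longrightarrow> Z v \<longrightarrow> v \<in> R \<or> (\<lambda>i. - v i) \<in> R) \<and>
     (\<forall>v\<in>R. \<forall>w\<in>R. v \<noteq> w \<longrightarrow> \<bar>ip n v w\<bar> < 1)"

lemma line_repsD:
  assumes "line_reps n Z R" "v \<in> R"
  shows "v \<in> rvec n" "ip n v v = 1" "Z v"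
  using assms by (auto simp: line_reps_def)

text \<open>The cone is the zero set of \<open>f w\<close>. Rotation invariance of its law is
  expressed by a measure preserving map \<open>T\<close> of the probability space that turns the
  cone by \<open>U\<close>, so that no measure on a space of sets or functions enters.\<close>

locale random_cone = prob_space M for M :: "'w measure" +
  fixes n :: nat and f :: "'w \<Rightarrow> (nat \<Rightarrow> real) \<Rightarrow> real"
  assumes n_pos: "0 < n"
    and f_measurable: "\<And>v. (\<lambda>w. f w v) \<in> borel_measurable M"
    and f_continuous: "\<And>w. w \<in> space M \<Longrightarrow> continuous_on UNIV (f w)"
    and f_cong: "\<And>w v v'. (\<And>i. i < n \<Longrightarrow> v i = v' i) \<Longrightarrow> f w v = f w v'"
    and f_homogeneous: "\<And>w v c. f w v = 0 \<Longrightarrow> f w (\<lambda>i. c * v i) = 0"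
    and rotation: "\<And>U. sym_orth {..<n} U \<Longrightarrow>
      \<exists>T\<in>M \<rightarrow>\<^sub>M M. distr M M T = M \<and> (\<forall>w\<in>space M. \<forall>v. f (T w) v = 0 \<longleftrightarrow> f w (lin {..<n} U v) = 0)"
begin

definition hits :: "real \<Rightarrow> 'w \<Rightarrow> (nat \<Rightarrow> real) \<Rightarrow> bool" where
  "hits e w x \<longleftrightarrow> (\<exists>v\<in>{v \<in> rvec n. (\<Sum>i<n. v i * v i) = 1}. f w v = 0 \<and> near n e v x)"

definition hit_prob :: "real \<Rightarrow> ennreal" where
  "hit_prob e = emeasure M {w \<in> space M. hits e w first_axis}"

definition hit_fraction :: "real \<Rightarrow> 'w \<Rightarrow> ennreal" where
  "hit_fraction e w = emeasure (gauss {..<n}) {x \<in> space (gauss {..<n}). hits e w x}"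

text \<open>Rewrites the two conditions on \<open>v\<close> as the vanishing of one function that is
  continuous on the compact unit sphere, the form required by
  \<open>sets_ex_compact\<close>.\<close>

lemma hits_alt:
  "hits e w x \<longleftrightarrow> 0 < ip n x x \<and> (\<exists>v\<in>{v \<in> rvec n. (\<Sum>i<n. v i * v i) = 1}.
      \<bar>f w v\<bar> + max 0 (ip n v v * ip n x x - (1 + e) * (ip n v x)\<^sup>2) = 0)"
proof -
  have "f w v = 0 \<and> near n e v x \<longleftrightarrow> 0 < ip n x x \<and> 
      \<bar>f w v\<bar> + max 0 (ip n v v * ip n x x - (1 + e) * (ip n v x)\<^sup>2) = 0" for v
    by (auto simp: near_def add_nonneg_eq_0_iff max_def split: if_splits)
  then show ?thesis by (auto simp: hits_def)
qed

lemma sets_hits: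
  "{p \<in> space (M \<Otimes>\<^sub>M gauss {..<n}). hits e (fst p) (snd p)} \<in> sets (M \<Otimes>\<^sub>M gauss {..<n})"
proof -
  let ?P = "M \<Otimes>\<^sub>M gauss {..<n}"
  let ?F = "\<lambda>p v. \<bar>f (fst p) v\<bar> + max 0 (ip n v v * ip n (snd p) (snd p) - (1 + e) * (ip n v (snd p))\<^sup>2)"
  note f_measurable[measurable]
  have "{p \<in> space ?P. \<exists>v\<in>{v \<in> rvec n. (\<Sum>i<n. v i * v i) = 1}. ?F p v = 0} \<in> sets ?P"
  proof (rule sets_ex_compact[OF compact_rvec_sphere])
    fix v :: "nat \<Rightarrow> real"
    show "(\<lambda>p. ?F p v) \<in> borel_measurable ?P" by measurable
  next
    fix p assume "p \<in> space ?P"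
    then have "continuous_on {v \<in> rvec n. (\<Sum>i<n. v i * v i) = 1} (f (fst p))"
      using f_continuous[of "fst p"] by (auto simp: space_pair_measure intro: continuous_on_subset)
    then show "continuous_on {v \<in> rvec n. (\<Sum>i<n. v i * v i) = 1} (?F p)"
      unfolding ip_def by (intro continuous_intros)
  qed
  moreover have "(\<lambda>p. ip n (snd p) (snd p)) \<in> borel_measurable ?P"
    unfolding ip_def by measurable
  then have "{p \<in> space ?P. 0 < ip n (snd p) (snd p)} \<in> sets ?P"
    by (intro borel_measurable_less) auto
  ultimately have "{p \<in> space ?P. 0 < ip n (snd p) (snd p)} \<inter> {p \<in> space ?P. \<exists>v\<in>{v \<in> rvec n. (\<Sum>i<n. v i * v i) = 1}. ?F p v = 0} \<in> sets ?P"
    by (intro sets.Int)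
  moreover have "{p \<in> space ?P. 0 < ip n (snd p) (snd p)} \<inter> {p \<in> space ?P. \<exists>v\<in>{v \<in> rvec n. (\<Sum>i<n. v i * v i) = 1}. ?F p v = 0}
      = {p \<in> space ?P. hits e (fst p) (snd p)}"
    unfolding hits_alt by blast
  ultimately show ?thesis by simp
qed

lemma sets_hits_right: "{w \<in> space M. hits e w x} \<in> sets M" if "x \<in> space (gauss {..<n})" for x
proof -
  have "(\<lambda>w. (w, x)) -` {p \<in> space (M \<Otimes>\<^sub>M gauss {..<n}). hits e (fst p) (snd p)} = {w \<in> space M. hits e w x}"
    using that by (auto simp: space_pair_measure)
  then show ?thesis using sets_Pair2[OF sets_hits[of e], of x] by simp
qed

lemma sets_hits_left: "{x \<in> space (gauss {..<n}). hits e w x} \<in> sets (gauss {..<n})" if "w \<in> space M" for w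
proof -
  have "Pair w -` {p \<in> space (M \<Otimes>\<^sub>M gauss {..<n}). hits e (fst p) (snd p)} = {x \<in> space (gauss {..<n}). hits e w x}"
    using that by (auto simp: space_pair_measure)
  then show ?thesis using sets_Pair1[OF sets_hits[of e], of w] by simp
qed

lemma sets_hits_first_axis: "{w \<in> space M. hits e w first_axis} \<in> sets M"
proof -
  have "hits e w first_axis = hits e w (restrict first_axis {..<n})" for w
    unfolding hits_def using near_cong[of n _ _ first_axis "restrict first_axis {..<n}"] by simp
  then show ?thesis
    using sets_hits_right[of "restrict first_axis {..<n}"] by (simp add: space_gauss)
qed

text \<open>Turn \<open>x\<close> to the first axis by \<open>U\<close> and let \<open>T\<close>
  turn the cone along with it; \<open>T\<close> preserves the probability.\<close>

lemma hits_rotate: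
  assumes x: "0 < ip n x x"
  shows "emeasure M {w \<in> space M. hits e w x} = hit_prob e"
proof -
  obtain U where U: "sym_orth {..<n} U" "\<And>i. i < n \<Longrightarrow> lin {..<n} U x i = sqrt (ip n x x) * first_axis i"
    using ex_sym_orth_axis[OF n_pos x] by metis
  obtain T where T: "T \<in> M \<rightarrow>\<^sub>M M" "distr M M T = M"
      "\<And>w v. w \<in> space M \<Longrightarrow> f (T w) v = 0 \<longleftrightarrow> f w (lin {..<n} U v) = 0"
    using rotation[OF U(1)] by blast
  \<comment> \<open>\<open>lin\<close> is \<open>undefined\<close> outside \<open>{..<n}\<close>;
    extending by \<open>0\<close> instead keeps the vectors in \<open>rvec n\<close>.\<close>
  define V where "V v = (\<lambda>i. if i < n then lin {..<n} U v i else 0)" for v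
  have V: "V v \<in> rvec n" for v by (auto simp: V_def rvec_def)
  have V_lin: "V v i = lin {..<n} U v i" if "i < n" for v i using that by (simp add: V_def)
  have VV: "lin {..<n} U (V v) i = v i" if "i < n" for v i
  proof -
    have "lin {..<n} U (V v) i = lin {..<n} U (lin {..<n} U v) i"
      using that by (auto simp: lin_def V_def intro!: sum.cong)
    then show ?thesis using lin_lin[OF finite_lessThan U(1), of i v] that by simp
  qed
  have ipV: "ip n (V v) (V v) = ip n v v" for v
    using ip_cong[of n "V v" "lin {..<n} U v" "V v" "lin {..<n} U v"] V_lin ip_lin[OF U(1)] by simp
  have nearV: "near n e (V v) first_axis = near n e v x" for v
  proof -
    have "near n e (V v) first_axis = near n e (V v) (\<lambda>i. sqrt (ip n x x) * first_axis i)"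
      using x by (simp add: near_scale_right)
    also have "\<dots> = near n e (lin {..<n} U v) (lin {..<n} U x)"
      using U(2) V_lin by (intro near_cong) auto
    finally show ?thesis by (simp add: near_lin[OF U(1)])
  qed
  have V2: "V (V v) = v" if "v \<in> rvec n" for v
  proof
    fix i show "V (V v) i = v i"
      using VV[of i v] that by (cases "i < n") (auto simp: V_def rvec_def)
  qed
  have "hits e w x \<longleftrightarrow> hits e (T w) first_axis" if w: "w \<in> space M" for w
  proof
    assume "hits e w x"
    then obtain v where v: "v \<in> rvec n" "ip n v v = 1" "f w v = 0" "near n e v x"
      by (auto simp: hits_def ip_def)
    have "f w (lin {..<n} U (V v)) = 0"
      using v(3) f_cong[of "lin {..<n} U (V v)" v w] VV by simp
    then show "hits e (T w) first_axis"
      unfolding hits_def using v V[of v] ipV[of v] nearV[of v] T(3)[OF w] by (intro bexI[of _ "V v"]) (simp_all add: ip_def)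
  next
    assume "hits e (T w) first_axis"
    then obtain v where v: "v \<in> rvec n" "ip n v v = 1" "f (T w) v = 0" "near n e v first_axis"
      by (auto simp: hits_def ip_def)
    have "f w (V v) = 0"
      using v(3) T(3)[OF w] f_cong[of "V v" "lin {..<n} U v" w] V_lin by simp
    then show "hits e w x"
      unfolding hits_def using v V[of v] ipV[of v] nearV[of "V v"] V2[of v] by (intro bexI[of _ "V v"]) (simp_all add: ip_def)
  qed
  then have eq: "{w \<in> space M. hits e w x} = T -` {w \<in> space M. hits e w first_axis} \<inter> space M"
    using measurable_space[OF T(1)] by auto
  have "emeasure M {w \<in> space M. hits e w x} = emeasure (distr M M T) {w \<in> space M. hits e w first_axis}"
    unfolding eq using sets_hits_first_axis by (subst emeasure_distr[OF T(1)]) auto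
  then show ?thesis by (simp add: T(2) hit_prob_def)
qed

lemma AE_gauss_nonzero: "AE x in gauss {..<n}. 0 < ip n x x"
proof -
  have "AE y in density lborel std_normal_density. y \<noteq> 0"
    by (subst AE_density) (auto intro: AE_mp[OF AE_lborel_singleton[of 0]])
  then have "AE x in gauss {..<n}. x 0 \<noteq> 0"
    unfolding gauss_def using n_pos by (intro AE_PiM_component prob_space_std_normal) auto
  then show ?thesis
  proof eventually_elim
    case (elim x)
    have "x 0 * x 0 \<le> ip n x x"
      unfolding ip_def using n_pos by (intro member_le_sum[of 0 "{..<n}" "\<lambda>i. x i * x i"]) auto
    then show ?case using elim by (smt (verit) mult_neg_neg mult_pos_pos)
  qed
qed

lemma measurable_hit_fraction [measurable]: "hit_fraction e \<in> borel_measurable M"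
proof -
  interpret G: prob_space "gauss {..<n}" by (rule prob_space_gauss)
  have "(\<lambda>w. emeasure (gauss {..<n}) (Pair w -` {p \<in> space (M \<Otimes>\<^sub>M gauss {..<n}). hits e (fst p) (snd p)})) \<in> borel_measurable M"
    by (rule G.measurable_emeasure_Pair[OF sets_hits])
  then show ?thesis
    by (rule measurable_cong[THEN iffD1, rotated])
      (auto simp: hit_fraction_def space_pair_measure vimage_def intro!: arg_cong2[where f=emeasure])
qed

text \<open>Fubini: integrating over \<open>w\<close> first gives the same probability
  \<open>hit_prob e\<close> for every direction \<open>x\<close> other than
  \<open>0\<close>.\<close>

lemma nn_integral_hit_fraction: "(\<integral>\<^sup>+w. hit_fraction e w \<partial>M) = hit_prob e"
proof -
  interpret G: prob_space "gauss {..<n}" by (rule prob_space_gauss)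
  interpret P: pair_sigma_finite M "gauss {..<n}" ..
  let ?S = "{p \<in> space (M \<Otimes>\<^sub>M gauss {..<n}). hits e (fst p) (snd p)}"
  have "(\<integral>\<^sup>+w. hit_fraction e w \<partial>M) = (\<integral>\<^sup>+w. emeasure (gauss {..<n}) (Pair w -` ?S) \<partial>M)"
    by (intro nn_integral_cong)
      (auto simp: hit_fraction_def space_pair_measure vimage_def intro!: arg_cong2[where f=emeasure])
  also have "\<dots> = emeasure (M \<Otimes>\<^sub>M gauss {..<n}) ?S"
    by (rule G.emeasure_pair_measure_alt[OF sets_hits, symmetric])
  also have "\<dots> = (\<integral>\<^sup>+x. emeasure M ((\<lambda>w. (w, x)) -` ?S) \<partial>gauss {..<n})"
    by (rule P.emeasure_pair_measure_alt2[OF sets_hits])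
  also have "\<dots> = (\<integral>\<^sup>+x. hit_prob e \<partial>gauss {..<n})"
  proof (rule nn_integral_cong_AE, use AE_space AE_gauss_nonzero in eventually_elim)
    case (elim x)
    then have "(\<lambda>w. (w, x)) -` ?S = {w \<in> space M. hits e w x}"
      by (auto simp: space_pair_measure)
    then show ?case using hits_rotate[of x e] elim by simp
  qed
  finally show ?thesis by (simp add: G.emeasure_space_1)
qed

text \<open>Double counting pairs of a line in the cone and a nearby Gaussian direction: every line
  attracts a fraction \<open>cap_prob n e\<close> of the directions, and the caps are eventually disjoint.\<close>

lemma hit_fraction_le:
  assumes R: "line_reps n (\<lambda>v. f w v = 0) R" and e: "e > 0"
  shows "hit_fraction e w / cap_prob n e \<le> ecard R"
proof (cases "finite R")
  case True
  let ?G = "gauss {..<n}"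
  have "{x \<in> space ?G. hits e w x} \<subseteq> (\<Union>z\<in>R. {x \<in> space ?G. near n e z x})"
  proof safe
    fix x assume x: "x \<in> space ?G" "hits e w x"
    then obtain v where v: "v \<in> rvec n" "ip n v v = 1" "f w v = 0" "near n e v x"
      by (auto simp: hits_def ip_def)
    then have "v \<in> R \<or> (\<lambda>i. - v i) \<in> R" using R by (auto simp: line_reps_def)
    moreover have "near n e (\<lambda>i. - v i) x"
      using v(4) near_scale_left[of "- 1" n e v x] by simp
    ultimately show "x \<in> (\<Union>z\<in>R. {x \<in> space ?G. near n e z x})" using v(4) x(1) by auto
  qed
  then have "hit_fraction e w \<le> emeasure ?G (\<Union>z\<in>R. {x \<in> space ?G. near n e z x})"
    unfolding hit_fraction_def using True by (intro emeasure_mono sets.finite_UN) auto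
  also have "\<dots> \<le> (\<Sum>z\<in>R. emeasure ?G {x \<in> space ?G. near n e z x})"
    using True by (intro emeasure_subadditive_finite) auto
  also have "\<dots> = (\<Sum>z\<in>R. cap_prob n e)"
    using R by (intro sum.cong refl cap_prob_eq[OF n_pos]) (auto simp: line_reps_def)
  finally have "hit_fraction e w \<le> ecard R * cap_prob n e"
    using True by (simp add: ecard_def)
  then show ?thesis
    using cap_prob_pos[OF n_pos e] cap_prob_le_1[of n e]
    by (intro divide_le_posI_ennreal) (auto simp: mult.commute)
qed (simp add: ecard_def)

text \<open>The caps of finitely many lines are disjoint as soon as \<open>1 - 2 * e k\<close>
  exceeds all inner products \<open>\<bar>ip n z z'\<bar>\<close>, by \<open>near_near\<close>. The
  hit fraction is then at least the number of these lines times the mass of a cap. Finite subsets of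
  every size settle the case of infinite \<open>R\<close>.\<close>

lemma ecard_le_liminf:
  assumes w: "w \<in> space M" and R: "line_reps n (\<lambda>v. f w v = 0) R" and e: "\<And>k. e k > 0" "e \<longlonglongrightarrow> 0"
  shows "ecard R \<le> liminf (\<lambda>k. hit_fraction (e k) w / cap_prob n (e k))"
proof -
  let ?G = "gauss {..<n}" and ?L = "liminf (\<lambda>k. hit_fraction (e k) w / cap_prob n (e k))"
  have *: "of_nat (card F) \<le> ?L" if F: "finite F" "F \<subseteq> R" for F
  proof (rule Liminf_bounded)
    have "\<forall>\<^sub>F k in sequentially. \<forall>z\<in>F. \<forall>z'\<in>F. z \<noteq> z' \<longrightarrow> \<bar>ip n z z'\<bar> < 1 - 2 * e k"
    proof (intro eventually_ball_finite F(1) ballI)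
      fix z z' assume z: "z \<in> F" "z' \<in> F"
      show "\<forall>\<^sub>F k in sequentially. z \<noteq> z' \<longrightarrow> \<bar>ip n z z'\<bar> < 1 - 2 * e k"
      proof (cases "z = z'")
        case False
        moreover have "z \<in> R" "z' \<in> R" using F z by auto
        ultimately have "\<bar>ip n z z'\<bar> < 1" using R unfolding line_reps_def by blast
        then have "\<bar>ip n z z'\<bar> < 1 - 2 * 0" by simp
        moreover have "(\<lambda>k. 1 - 2 * e k) \<longlonglongrightarrow> 1 - 2 * 0" by (intro tendsto_intros e)
        ultimately have "\<forall>\<^sub>F k in sequentially. \<bar>ip n z z'\<bar> < 1 - 2 * e k" by (intro order_tendstoD(1)) auto
        then show ?thesis by eventually_elim simp
      qed simp
    qed
    then show "\<forall>\<^sub>F k in sequentially. of_nat (card F) \<le> hit_fraction (e k) w / cap_prob n (e k)"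
    proof eventually_elim
      case (elim k)
      let ?C = "\<lambda>z. {x \<in> space ?G. near n (e k) z x}"
      have "disjoint_family_on ?C F"
        unfolding disjoint_family_on_def
      proof (intro ballI impI equals0I)
        fix z z' x assume *: "z \<in> F" "z' \<in> F" "z \<noteq> z'" "x \<in> ?C z \<inter> ?C z'"
        then have "1 - 2 * e k \<le> \<bar>ip n z z'\<bar>"
          using line_repsD[OF R] F(2) e by (intro near_near[of n z z' "e k" x]) auto
        then show False using elim * by (meson not_less)
      qed
      then have "(\<Sum>z\<in>F. emeasure ?G (?C z)) = emeasure ?G (\<Union>z\<in>F. ?C z)"
        using F(1) by (intro sum_emeasure) auto
      also have "(\<Sum>z\<in>F. emeasure ?G (?C z)) = (\<Sum>z\<in>F. cap_prob n (e k))"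
        using line_repsD[OF R] F(2) by (intro sum.cong refl cap_prob_eq[OF n_pos]) (auto simp: subset_eq)
      also have "emeasure ?G (\<Union>z\<in>F. ?C z) \<le> hit_fraction (e k) w"
        unfolding hit_fraction_def
      proof (rule emeasure_mono)
        show "(\<Union>z\<in>F. ?C z) \<subseteq> {x \<in> space ?G. hits (e k) w x}"
        proof safe
          fix z x assume "z \<in> F" "x \<in> space ?G" "near n (e k) z x"
          moreover have "z \<in> rvec n" "ip n z z = 1" "f w z = 0"
            using line_repsD[OF R] F(2) \<open>z \<in> F\<close> by auto
          ultimately show "hits (e k) w x"
            unfolding hits_def by (intro bexI[of _ z]) (simp_all add: ip_def)
        qed
        show "{x \<in> space ?G. hits (e k) w x} \<in> sets ?G"
          by (rule sets_hits_left[OF w])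
      qed
      finally have "of_nat (card F) * cap_prob n (e k) \<le> hit_fraction (e k) w" by simp
      then show ?case
        using cap_prob_pos[OF n_pos e(1), of k] cap_prob_le_1[of n "e k"]
          divide_right_mono_ennreal[of "of_nat (card F) * cap_prob n (e k)" "hit_fraction (e k) w" "cap_prob n (e k)"]
        by (subst (asm) ennreal_mult_divide_eq) (auto simp: top_unique)
    qed
  qed
  show ?thesis
  proof (cases "finite R")
    case True
    then show ?thesis using *[of R] by (simp add: ecard_def)
  next
    case False
    have "of_nat m \<le> ?L" for m
    proof -
      obtain F where "finite F" "card F = m" "F \<subseteq> R"
        using infinite_arbitrarily_large[OF False] by metis
      then show ?thesis using *[of F] by simp
    qed
    then have "(SUP m. of_nat m) \<le> ?L" by (intro SUP_least) auto
    then show ?thesis by (simp add: ennreal_SUP_of_nat_eq_top top_unique)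
  qed
qed

text \<open>Squeezes the integral of \<open>c\<close> between integrals of measurable functions, so
  \<open>c\<close> may be any function: the normalised hit fractions lie below \<open>c\<close> for
  each \<open>k\<close>, and Fatou's lemma gives the reverse inequality in the limit.\<close>

theorem hit_prob_ratio_tendsto:
  assumes c: "AE w in M. \<exists>R. line_reps n (\<lambda>v. f w v = 0) R \<and> c w = ecard R"
    and e: "\<And>k. e k > 0" "e \<longlonglongrightarrow> 0"
  shows "(\<lambda>k. hit_prob (e k) / cap_prob n (e k)) \<longlonglongrightarrow> (\<integral>\<^sup>+w. c w \<partial>M)"
proof -
  have eq: "hit_prob e / cap_prob n e = (\<integral>\<^sup>+w. hit_fraction e w / cap_prob n e \<partial>M)" for e
    by (subst nn_integral_divide) (auto simp: nn_integral_hit_fraction)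
  have le: "hit_prob (e k) / cap_prob n (e k) \<le> (\<integral>\<^sup>+w. c w \<partial>M)" for k
    unfolding eq
  proof (rule nn_integral_mono_AE, use c in eventually_elim)
    case (elim w)
    then show ?case using hit_fraction_le[OF _ e(1)] by auto
  qed
  have "(\<integral>\<^sup>+w. c w \<partial>M) \<le> (\<integral>\<^sup>+w. liminf (\<lambda>k. hit_fraction (e k) w / cap_prob n (e k)) \<partial>M)"
  proof (rule nn_integral_mono_AE, use AE_space c in eventually_elim)
    case (elim w)
    then show ?case using ecard_le_liminf[OF elim(1) _ e] by auto
  qed
  also have "\<dots> \<le> liminf (\<lambda>k. \<integral>\<^sup>+w. hit_fraction (e k) w / cap_prob n (e k) \<partial>M)"
    by (rule nn_integral_liminf) measurable
  finally have ge: "(\<integral>\<^sup>+w. c w \<partial>M) \<le> liminf (\<lambda>k. hit_prob (e k) / cap_prob n (e k))"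
    by (simp add: eq)
  have le': "limsup (\<lambda>k. hit_prob (e k) / cap_prob n (e k)) \<le> (\<integral>\<^sup>+w. c w \<partial>M)"
    using le by (intro Limsup_bounded) auto
  have "liminf (\<lambda>k. hit_prob (e k) / cap_prob n (e k)) \<le> limsup (\<lambda>k. hit_prob (e k) / cap_prob n (e k))"
    by (rule Liminf_le_Limsup) simp
  with ge le' have "liminf (\<lambda>k. hit_prob (e k) / cap_prob n (e k)) = (\<integral>\<^sup>+w. c w \<partial>M)"
    "limsup (\<lambda>k. hit_prob (e k) / cap_prob n (e k)) = (\<integral>\<^sup>+w. c w \<partial>M)"
    by (meson antisym order_trans)+
  then show ?thesis
    by (simp add: tendsto_iff_Liminf_eq_Limsup)
qed

end

section \<open>Perturbations of linear maps\<close>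

text \<open>Coordinate \<open>0\<close> is the homogenising one: the affine chart around the first axis sets it to
  \<open>1\<close>, so that points of the chart are vectors with index set \<open>{1..<n}\<close> and entry \<open>0\<close> at \<open>0\<close>.\<close>

definition ball0 :: "nat \<Rightarrow> (nat \<Rightarrow> real) set" where
  "ball0 n = {v \<in> rvec n. v 0 = 0 \<and> (\<Sum>i<n. v i * v i) \<le> 1}"

definition mutual_inverses :: "'i set \<Rightarrow> ('i \<Rightarrow> 'i \<Rightarrow> real) \<Rightarrow> ('i \<Rightarrow> 'i \<Rightarrow> real) \<Rightarrow> bool" where
  "mutual_inverses J M N \<longleftrightarrow> (\<forall>x. \<forall>i\<in>J. lin J N (lin J M x) i = x i \<and> lin J M (lin J N x) i = x i)"

lemma ball0_sum:
  fixes v :: "nat \<Rightarrow> real"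
  assumes "v 0 = 0"
  shows "(\<Sum>i<n. v i * v i) = (\<Sum>i\<in>{1..<n}. v i * v i)"
proof (rule sum.mono_neutral_right)
  show "\<forall>i\<in>{..<n} - {1..<n}. v i * v i = 0"
  proof
    fix i assume "i \<in> {..<n} - {1..<n}"
    then have "i = 0" by auto
    then show "v i * v i = 0" using assms by simp
  qed
qed auto

lemma ball0_L2: "v \<in> ball0 n \<longleftrightarrow> v \<in> rvec n \<and> v 0 = 0 \<and> L2_set v {1..<n} \<le> 1"
  by (auto simp: ball0_def ball0_sum L2_set_def power2_eq_square)

lemma ball0_coord: "v \<in> ball0 n \<Longrightarrow> \<bar>v i\<bar> \<le> 1"
  using abs_le_one_of_sum_squares[of "{..<n}" v i]
  by (cases "i < n") (auto simp: ball0_def rvec_def)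

lemma compact_ball0: "compact (ball0 n)"
  unfolding ball0_def by (rule compact_rvec_ball)

section \<open>Fixed points and images of the ball\<close>

text \<open>Banach iteration started at \<open>0\<close>. Distances are measured coordinatewise, so
  convergence follows from a geometric series in each coordinate, while the invariant set is a
  Euclidean ball.\<close>

lemma ball0_contraction_fixpoint:
  assumes T: "\<And>u. u \<in> ball0 n \<Longrightarrow> T u \<in> ball0 n"
    and lip: "\<And>u u' d i. u \<in> ball0 n \<Longrightarrow> u' \<in> ball0 n \<Longrightarrow> (\<And>j. \<bar>u j - u' j\<bar> \<le> d) \<Longrightarrow> \<bar>T u i - T u' i\<bar> \<le> d / 2"
  obtains u where "u \<in> ball0 n" "T u = u"
proof -
  define x where "x k = (T ^^ k) (\<lambda>_. 0)" for k
  have x_Suc: "x (Suc k) = T (x k)" for k by (simp add: x_def)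
  have x_in: "x k \<in> ball0 n" for k
    by (induction k) (auto simp: x_Suc T, auto simp: x_def ball0_def rvec_def)
  \<comment> \<open>Coordinates in the ball are at most \<open>1\<close> in absolute value, so two
    points differ by at most \<open>2\<close>; each iteration halves this bound.\<close>
  have step: "\<bar>x (Suc k) i - x k i\<bar> \<le> 2 * (1 / 2) ^ k" for k i
  proof (induction k arbitrary: i)
    case 0
    show ?case using ball0_coord[OF x_in[of "Suc 0"], of i] ball0_coord[OF x_in[of 0], of i] by simp
  next
    case (Suc k)
    have "\<bar>T (x (Suc k)) i - T (x k) i\<bar> \<le> (2 * (1 / 2) ^ k) / 2"
      by (rule lip[OF x_in x_in Suc.IH])
    then show ?case by (simp add: x_Suc)
  qed
  have conv: "convergent (\<lambda>k. x k i)" for i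
  proof -
    have "summable (\<lambda>k. x (Suc k) i - x k i)"
    proof (rule summable_comparison_test')
      show "summable (\<lambda>k. 2 * (1 / 2 :: real) ^ k)" by (intro summable_mult summable_geometric) simp
      show "norm (x (Suc k) i - x k i) \<le> 2 * (1 / 2) ^ k" if "0 \<le> k" for k using step by simp
    qed
    then have "convergent (\<lambda>m. \<Sum>k<m. x (Suc k) i - x k i)"
      by (simp add: summable_iff_convergent)
    then have "convergent (\<lambda>m. x m i - x 0 i)"
      unfolding sum_lessThan_telescope[of "\<lambda>k. x k i"] .
    then have "convergent (\<lambda>m. (x m i - x 0 i) + x 0 i)" by (intro convergent_add convergent_const)
    then show ?thesis by simp
  qed
  define u where "u i = lim (\<lambda>k. x k i)" for i
  have lim: "(\<lambda>k. x k i) \<longlonglongrightarrow> u i" for i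
    using conv[of i] by (simp add: u_def convergent_LIMSEQ_iff)
  have "(\<lambda>k. \<Sum>i<n. x k i * x k i) \<longlonglongrightarrow> (\<Sum>i<n. u i * u i)"
    by (intro tendsto_intros lim)
  then have "(\<Sum>i<n. u i * u i) \<le> 1"
    by (rule LIMSEQ_le_const2) (use x_in in \<open>auto simp: ball0_def\<close>)
  moreover have zero: "u i = 0" if "i \<ge> n \<or> i = 0" for i
  proof -
    have "x k i = 0" for k using x_in[of k] that by (auto simp: ball0_def rvec_def)
    then have "(\<lambda>k. x k i) \<longlonglongrightarrow> 0" by simp
    then show ?thesis using lim[of i] LIMSEQ_unique by blast
  qed
  ultimately have u_in: "u \<in> ball0 n" by (auto simp: ball0_def rvec_def)
  have "T u i = u i" for i
  proof -
    \<comment> \<open>The sum of the coordinate distances bounds each of them and tends to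
      \<open>0\<close>, so the Lipschitz condition carries the limit through
      \<open>T\<close>.\<close>
    define d where "d k = (\<Sum>j<n. \<bar>x k j - u j\<bar>)" for k
    have d: "\<bar>x k j - u j\<bar> \<le> d k" for k j
    proof (cases "j < n")
      case True
      then show ?thesis unfolding d_def by (intro member_le_sum) auto
    next
      case False
      then have "x k j = 0" "u j = 0" using x_in[of k] zero by (auto simp: ball0_def rvec_def)
      then show ?thesis by (simp add: d_def sum_nonneg)
    qed
    have "(\<lambda>k. d k / 2) \<longlonglongrightarrow> (\<Sum>j<n. \<bar>u j - u j\<bar>) / 2"
      unfolding d_def by (intro tendsto_intros lim) simp
    then have "(\<lambda>k. d k / 2) \<longlonglongrightarrow> 0" by simp
    then have "(\<lambda>k. T (x k) i - T u i) \<longlonglongrightarrow> 0"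
      by (rule Lim_null_comparison[rotated]) (use lip[OF x_in u_in d] in auto)
    then have "(\<lambda>k. x (Suc k) i) \<longlonglongrightarrow> T u i"
      unfolding x_Suc by (simp add: LIM_zero_iff)
    moreover have "(\<lambda>k. x (Suc k) i) \<longlonglongrightarrow> u i" using lim by (rule LIMSEQ_Suc)
    ultimately show ?thesis using LIMSEQ_unique by blast
  qed
  then show ?thesis using that u_in by blast
qed

definition in_image :: "nat \<Rightarrow> ((nat \<Rightarrow> real) \<Rightarrow> nat \<Rightarrow> real) \<Rightarrow> (nat \<Rightarrow> real) \<Rightarrow> bool" where
  "in_image n g a \<longleftrightarrow> (\<exists>u\<in>ball0 n. \<forall>i\<in>{1..<n}. a i = g u i)"

lemma lin_cong: "(\<And>j. j \<in> J \<Longrightarrow> x j = y j) \<Longrightarrow> lin J N x = lin J N y"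
  by (auto simp: lin_def)

text \<open>The image of the ball is an ellipsoid, described through the inverse \<open>N\<close>;
  its boundary is the level set that the perturbation argument has to avoid.\<close>

lemma in_image_lin_iff:
  assumes inv: "mutual_inverses {1..<n} M N"
  shows "in_image n (lin {1..<n} M) a \<longleftrightarrow> L2_set (lin {1..<n} N a) {1..<n} \<le> 1"
proof
  assume "in_image n (lin {1..<n} M) a"
  then obtain u where u: "u \<in> ball0 n" "\<And>i. i \<in> {1..<n} \<Longrightarrow> a i = lin {1..<n} M u i"
    by (auto simp: in_image_def)
  have "lin {1..<n} N a i = u i" if "i \<in> {1..<n}" for i
  proof -
    have "lin {1..<n} N a i = lin {1..<n} N (lin {1..<n} M u) i"
      using lin_cong[of "{1..<n}" a "lin {1..<n} M u" N] u(2) by metis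
    then show ?thesis using inv that by (simp add: mutual_inverses_def)
  qed
  then have "L2_set (lin {1..<n} N a) {1..<n} = L2_set u {1..<n}" by (intro L2_set_cong) auto
  then show "L2_set (lin {1..<n} N a) {1..<n} \<le> 1" using u(1) by (simp add: ball0_L2)
next
  assume *: "L2_set (lin {1..<n} N a) {1..<n} \<le> 1"
  define u where "u i = (if i \<in> {1..<n} then lin {1..<n} N a i else 0)" for i
  have "L2_set u {1..<n} = L2_set (lin {1..<n} N a) {1..<n}"
    by (intro L2_set_cong) (auto simp: u_def)
  then have "u \<in> ball0 n" using * by (auto simp: ball0_L2 u_def rvec_def)
  moreover have "a i = lin {1..<n} M u i" if "i \<in> {1..<n}" for i
  proof -
    have "lin {1..<n} M u i = lin {1..<n} M (lin {1..<n} N a) i"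
      using lin_cong[of "{1..<n}" u "lin {1..<n} N a" M] by (simp add: u_def)
    then show ?thesis using inv that by (simp add: mutual_inverses_def)
  qed
  ultimately show "in_image n (lin {1..<n} M) a" by (auto simp: in_image_def)
qed

lemma abs_lin_le:
  assumes "finite J" "\<And>j. j \<in> J \<Longrightarrow> \<bar>x j\<bar> \<le> c" "i \<in> J"
  shows "\<bar>lin J N x i\<bar> \<le> (\<Sum>j\<in>J. \<bar>N i j\<bar>) * c"
proof -
  have "\<bar>lin J N x i\<bar> \<le> (\<Sum>j\<in>J. \<bar>N i j * x j\<bar>)"
    using assms(3) by (simp add: lin_def)
  also have "\<dots> \<le> (\<Sum>j\<in>J. \<bar>N i j\<bar> * c)"
    using assms by (intro sum_mono) (auto simp: abs_mult intro: mult_left_mono)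
  finally show ?thesis by (simp add: sum_distrib_right)
qed

lemma lin_diff: "i \<in> J \<Longrightarrow> lin J N (\<lambda>j. x j - y j) i = lin J N x i - lin J N y i"
  by (simp add: lin_def right_diff_distrib sum_subtractf)

lemma lin_add: "i \<in> J \<Longrightarrow> lin J N (\<lambda>j. x j + y j) i = lin J N x i + lin J N y i"
  by (simp add: lin_def distrib_left sum.distrib)

text \<open>A map that is \<open>C\<^sup>1\<close>-close to an invertible linear map \<open>M\<close> hits a point \<open>a\<close> off the
  boundary of the image of the ball if and only if \<open>M\<close> does; the preimage is a fixed point of
  \<open>u \<mapsto> N (a - h u)\<close>.\<close>

lemma eventually_in_image_iff:
  assumes inv: "mutual_inverses {1..<n} M N" and a: "L2_set (lin {1..<n} N a) {1..<n} \<noteq> 1"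
    and e: "e \<longlonglongrightarrow> (0::real)"
    and h: "\<And>k u i. u \<in> ball0 n \<Longrightarrow> i \<in> {1..<n} \<Longrightarrow> \<bar>h k u i\<bar> \<le> e k"
    and lip: "\<And>k u u' d i. u \<in> ball0 n \<Longrightarrow> u' \<in> ball0 n \<Longrightarrow> i \<in> {1..<n} \<Longrightarrow>
      (\<And>j. \<bar>u j - u' j\<bar> \<le> d) \<Longrightarrow> \<bar>h k u i - h k u' i\<bar> \<le> e k * d"
  shows "\<forall>\<^sub>F k in sequentially. in_image n (\<lambda>u i. lin {1..<n} M u i + h k u i) a \<longleftrightarrow> in_image n (lin {1..<n} M) a"
proof -
  let ?J = "{1..<n}" and ?l = "L2_set (lin {1..<n} N a) {1..<n}"
  \<comment> \<open>The sum of the absolute values of all entries bounds the Euclidean norm of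
    \<open>N\<close> applied to a vector in terms of its largest coordinate.\<close>
  define B where "B = (\<Sum>i\<in>?J. \<Sum>j\<in>?J. \<bar>N i j\<bar>)"
  have B0: "0 \<le> B" unfolding B_def by (intro sum_nonneg) auto
  have Bi: "(\<Sum>j\<in>?J. \<bar>N i j\<bar>) \<le> B" if "i \<in> ?J" for i
    unfolding B_def using that by (intro member_le_sum) (auto intro: sum_nonneg)
  have l_le: "L2_set (lin ?J N x) ?J \<le> B * c" if "\<And>j. j \<in> ?J \<Longrightarrow> \<bar>x j\<bar> \<le> c" for x c
  proof -
    have "L2_set (lin ?J N x) ?J \<le> (\<Sum>i\<in>?J. \<bar>lin ?J N x i\<bar>)" by (rule L2_set_le_sum_abs)
    also have "\<dots> \<le> (\<Sum>i\<in>?J. (\<Sum>j\<in>?J. \<bar>N i j\<bar>) * c)"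
      using that by (intro sum_mono abs_lin_le) auto
    finally show ?thesis by (simp add: B_def sum_distrib_right)
  qed
  have Be: "(\<lambda>k. B * e k) \<longlonglongrightarrow> B * 0" by (intro tendsto_intros e)
  show ?thesis
  proof (cases "?l \<le> 1")
    case True
    with a have "?l < 1" by simp
    \<comment> \<open>This threshold makes the iteration map the ball into itself; the next one
      makes it halve distances.\<close>
    then have "\<forall>\<^sub>F k in sequentially. B * e k < 1 - ?l"
      by (intro order_tendstoD(2)[OF Be]) simp
    moreover have "\<forall>\<^sub>F k in sequentially. B * e k < 1 / 2"
      by (rule order_tendstoD(2)[OF Be]) simp
    ultimately show ?thesis
    proof eventually_elim
      case (elim k)
      define T where "T u i = (if i \<in> ?J then lin ?J N (\<lambda>j. a j - h k u j) i else 0)" for u i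
      obtain u where u: "u \<in> ball0 n" "T u = u"
      proof (rule ball0_contraction_fixpoint[of n T])
        fix u assume u: "u \<in> ball0 n"
        have "L2_set (T u) ?J = L2_set (\<lambda>i. lin ?J N a i + - lin ?J N (h k u) i) ?J"
          by (intro L2_set_cong) (auto simp: T_def lin_diff)
        also have "\<dots> \<le> ?l + L2_set (\<lambda>i. - lin ?J N (h k u) i) ?J"
          by (rule L2_set_triangle_ineq)
        also have "L2_set (\<lambda>i. - lin ?J N (h k u) i) ?J = L2_set (lin ?J N (h k u)) ?J"
          by (simp add: L2_set_def)
        also have "\<dots> \<le> B * e k" using h[OF u] by (intro l_le) auto
        finally have "L2_set (T u) ?J \<le> 1" using elim(1) by linarith
        moreover have "T u \<in> rvec n" "T u 0 = 0" by (auto simp: T_def rvec_def)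
        ultimately show "T u \<in> ball0 n" unfolding ball0_L2 by blast
      next
        fix u u' d i assume u: "u \<in> ball0 n" "u' \<in> ball0 n" "\<And>j. \<bar>u j - u' j\<bar> \<le> d"
        have d: "0 \<le> d" using u(3)[of 0] by simp
        show "\<bar>T u i - T u' i\<bar> \<le> d / 2"
        proof (cases "i \<in> ?J")
          case True
          have "\<bar>T u i - T u' i\<bar> = \<bar>lin ?J N (\<lambda>j. h k u' j - h k u j) i\<bar>"
            using True by (simp add: T_def lin_diff)
          also have "\<dots> \<le> (\<Sum>j\<in>?J. \<bar>N i j\<bar>) * (e k * d)"
            using u True by (intro abs_lin_le lip) (auto simp: abs_minus_commute)
          also have "\<dots> \<le> B * (e k * d)"
          proof (rule mult_right_mono[OF Bi[OF True]])
            show "0 \<le> e k * d" using lip[OF u(1,2) True u(3), of k] by simp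
          qed
          also have "\<dots> \<le> (1 / 2) * d"
            using mult_right_mono[of "B * e k" "1 / 2" d] elim(2) d by (simp only: mult.assoc)
          finally show ?thesis by simp
        next
          case False
          then have "T u i = 0" "T u' i = 0" by (simp_all only: T_def if_False)
          then show ?thesis using d by simp
        qed
      qed (rule that)
      have "a i = lin ?J M u i + h k u i" if i: "i \<in> ?J" for i
      proof -
        have "u j = lin ?J N (\<lambda>j. a j - h k u j) j" if "j \<in> ?J" for j
        proof -
          have "u j = T u j" using u(2) by simp
          also have "T u j = lin ?J N (\<lambda>j. a j - h k u j) j" unfolding T_def using that by (rule if_P)
          finally show ?thesis .
        qed
        then have "lin ?J M u = lin ?J M (lin ?J N (\<lambda>j. a j - h k u j))"
          by (rule lin_cong)
        then have "lin ?J M u i = lin ?J M (lin ?J N (\<lambda>j. a j - h k u j)) i" by simp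
        also have "\<dots> = a i - h k u i" using inv i by (simp add: mutual_inverses_def)
        finally show ?thesis by simp
      qed
      then have "in_image n (\<lambda>u i. lin ?J M u i + h k u i) a" using u(1) by (auto simp: in_image_def)
      then show ?case using True in_image_lin_iff[OF inv] by simp
    qed
  next
    case False
    \<comment> \<open>For \<open>a\<close> outside the ellipsoid, a preimage \<open>u\<close> under
      the perturbed map would force \<open>?l\<close> to be at most
      \<open>1 + B * e k\<close>.\<close>
    then have "\<forall>\<^sub>F k in sequentially. B * e k < ?l - 1"
      using Be by (intro order_tendstoD(2)) auto
    then show ?thesis
    proof eventually_elim
      case (elim k)
      have "\<not> in_image n (\<lambda>u i. lin ?J M u i + h k u i) a"
      proof
        assume "in_image n (\<lambda>u i. lin ?J M u i + h k u i) a"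
        then obtain u where u: "u \<in> ball0 n" "\<And>i. i \<in> ?J \<Longrightarrow> a i = lin ?J M u i + h k u i"
          by (auto simp: in_image_def)
        have "lin ?J N a i = u i + lin ?J N (h k u) i" if "i \<in> ?J" for i
        proof -
          have "lin ?J N a i = lin ?J N (\<lambda>j. lin ?J M u j + h k u j) i"
            using lin_cong[of ?J a "\<lambda>j. lin ?J M u j + h k u j" N] u(2) by simp
          also have "\<dots> = lin ?J N (lin ?J M u) i + lin ?J N (h k u) i"
            using that by (rule lin_add)
          finally show ?thesis using inv that by (simp add: mutual_inverses_def)
        qed
        then have "?l = L2_set (\<lambda>i. u i + lin ?J N (h k u) i) ?J" by (intro L2_set_cong) auto
        also have "\<dots> \<le> L2_set u ?J + L2_set (lin ?J N (h k u)) ?J"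
          by (rule L2_set_triangle_ineq)
        also have "\<dots> \<le> 1 + B * e k"
          using u(1) h[OF u(1)] by (intro add_mono l_le) (auto simp: ball0_L2)
        finally show False using elim by simp
      qed
      then show ?case using False in_image_lin_iff[OF inv] by simp
    qed
  qed
qed

text \<open>With all coordinates but one fixed, the squared norm minus \<open>1\<close> is a
  quadratic polynomial in the remaining coordinate. Its leading coefficient is the squared norm of a
  column of \<open>N\<close>, nonzero by invertibility, so only finitely many values are
  bad.\<close>

lemma AE_not_on_ellipsoid:
  assumes fin: "finite J" and J: "J \<noteq> {}" and inv: "mutual_inverses J M N"
  shows "AE a in lebesgue_on_pi J. L2_set (lin J N a) J \<noteq> 1"
proof -
  obtain i0 where i0: "i0 \<in> J" using J by auto
  have J': "J = insert i0 (J - {i0})" using i0 by auto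
  have [measurable]: "Measurable.pred (lebesgue_on_pi J) (\<lambda>a. L2_set (lin J N a) J \<noteq> 1)"
  proof -
    have "(\<lambda>a. L2_set (lin J N a) J) = (\<lambda>a. sqrt (\<Sum>i\<in>J. (\<Sum>j\<in>J. N i j * a j)\<^sup>2))"
      by (simp add: L2_set_def lin_def cong: sum.cong)
    moreover have "(\<lambda>a. sqrt (\<Sum>i\<in>J. (\<Sum>j\<in>J. N i j * a j)\<^sup>2)) \<in> borel_measurable (PiM J (\<lambda>_. borel))"
      by measurable
    ultimately have [measurable]: "(\<lambda>a. L2_set (lin J N a) J) \<in> borel_measurable (lebesgue_on_pi J)"
      by simp
    show ?thesis by measurable
  qed
  have "AE x in lebesgue_on_pi (J - {i0}). AE y in lborel. L2_set (lin J N (x(i0 := y))) J \<noteq> 1"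
  proof (rule AE_I2)
    fix x :: "'a \<Rightarrow> real"
    define c where "c i = (\<Sum>j\<in>J - {i0}. N i j * x j)" for i
    define p where "p = [:(\<Sum>i\<in>J. c i * c i) - 1, \<Sum>i\<in>J. 2 * c i * N i i0, \<Sum>i\<in>J. N i i0 * N i i0:]"
    have lin_eq: "lin J N (x(i0 := y)) i = c i + N i i0 * y" if "i \<in> J" for i y
      using that i0 fin by (simp add: lin_def c_def sum.remove[of J i0] cong: sum.cong_simp)
    have poly: "poly p y = 0" if "L2_set (lin J N (x(i0 := y))) J = 1" for y
    proof -
      have "(\<Sum>i\<in>J. (lin J N (x(i0 := y)) i)\<^sup>2) = 1"
        using that by (simp add: L2_set_def real_sqrt_eq_1_iff)
      also have "(\<Sum>i\<in>J. (lin J N (x(i0 := y)) i)\<^sup>2) = (\<Sum>i\<in>J. c i * c i + y * (2 * c i * N i i0) + y * (y * (N i i0 * N i i0)))"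
        by (intro sum.cong refl) (simp add: lin_eq power2_eq_square algebra_simps)
      also have "\<dots> = poly p y + 1"
        by (simp add: p_def sum.distrib sum_distrib_left algebra_simps)
      finally show ?thesis by simp
    qed
    have "p \<noteq> 0"
    proof
      assume "p = 0"
      then have "(\<Sum>i\<in>J. N i i0 * N i i0) = 0" by (simp add: p_def)
      then have N0: "N i i0 = 0" if "i \<in> J" for i
        using that fin by (subst (asm) sum_nonneg_eq_0_iff) auto
      define z where "z j = (if j = i0 then 1 else 0 :: real)" for j
      have "lin J N z i = 0" if "i \<in> J" for i
        using N0[OF that] that i0 fin by (simp add: lin_def z_def if_distrib[of "\<lambda>x. _ * x"] sum.delta cong: if_cong)
      then have "lin J M (lin J N z) i0 = 0" using i0 by (simp add: lin_def[of J M])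
      moreover have "lin J M (lin J N z) i0 = 1" using inv i0 by (simp add: mutual_inverses_def z_def)
      ultimately show False by simp
    qed
    then have "finite {y. poly p y = 0}" by (rule poly_roots_finite)
    then have "finite {y. L2_set (lin J N (x(i0 := y))) J = 1}"
      by (rule finite_subset[rotated]) (use poly in auto)
    then have "{y. L2_set (lin J N (x(i0 := y))) J = 1} \<in> null_sets lborel"
      by (intro finite_imp_null_set_lborel)
    then have "AE y in lborel. y \<notin> {y. L2_set (lin J N (x(i0 := y))) J = 1}"
      by (rule AE_not_in)
    then show "AE y in lborel. L2_set (lin J N (x(i0 := y))) J \<noteq> 1" by simp
  qed
  then have "AE a in lebesgue_on_pi (insert i0 (J - {i0})). L2_set (lin J N a) J \<noteq> 1"
    using fin J' by (intro leb.AE_PiM_insert) (auto simp: insert_absorb[OF i0])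
  then show ?thesis unfolding J'[symmetric] .
qed

section \<open>Limits of volumes of random images\<close>

text \<open>A random linear map \<open>M w\<close> with perturbations \<open>h k w\<close> whose
  size and Lipschitz constant are at most a random constant times \<open>e k\<close>.
  \<open>D w\<close> confines all images to one cube, and its moment is the integrated volume of
  these cubes. The weights \<open>\<psi> k\<close> stand for rescaled Gaussian densities. The
  setting serves twice: for the equations of a cone in the chart, and for a linear map whose
  coefficients vary.\<close>

locale image_limit = prob_space W for W :: "'w measure" +
  fixes n :: nat and M :: "'w \<Rightarrow> nat \<Rightarrow> nat \<Rightarrow> real" and h :: "nat \<Rightarrow> 'w \<Rightarrow> (nat \<Rightarrow> real) \<Rightarrow> nat \<Rightarrow> real"
    and e :: "nat \<Rightarrow> real" and D :: "'w \<Rightarrow> real" and \<psi> :: "nat \<Rightarrow> (nat \<Rightarrow> real) \<Rightarrow> ennreal" and c :: real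
  assumes n: "1 < n"
    and M_measurable: "\<And>i j. i \<in> {1..<n} \<Longrightarrow> j \<in> {1..<n} \<Longrightarrow> (\<lambda>w. M w i j) \<in> borel_measurable W"
    and M_inv: "AE w in W. \<exists>N. mutual_inverses {1..<n} (M w) N"
    and h_measurable: "\<And>k u i. i \<in> {1..<n} \<Longrightarrow> (\<lambda>w. h k w u i) \<in> borel_measurable W"
    and h_continuous: "\<And>k w i. w \<in> space W \<Longrightarrow> i \<in> {1..<n} \<Longrightarrow> continuous_on UNIV (\<lambda>u. h k w u i)"
    and e: "e \<longlonglongrightarrow> 0"
    and h: "\<And>w. w \<in> space W \<Longrightarrow> \<exists>C. \<forall>k. \<forall>u\<in>ball0 n. \<forall>i\<in>{1..<n}. \<bar>h k w u i\<bar> \<le> C * e k \<and>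
      (\<forall>u'\<in>ball0 n. \<forall>d. (\<forall>j. \<bar>u j - u' j\<bar> \<le> d) \<longrightarrow> \<bar>h k w u i - h k w u' i\<bar> \<le> C * e k * d)"
    and D_measurable [measurable]: "D \<in> borel_measurable W"
    and D: "\<And>w k u i. w \<in> space W \<Longrightarrow> u \<in> ball0 n \<Longrightarrow> i \<in> {1..<n} \<Longrightarrow>
      \<bar>lin {1..<n} (M w) u i + h k w u i\<bar> \<le> D w"
    and D_moment: "(\<integral>\<^sup>+w. ennreal ((2 * D w) ^ (n - 1)) \<partial>W) < \<infinity>"
    and \<psi>_measurable [measurable]: "\<And>k. \<psi> k \<in> borel_measurable (PiM {1..<n} (\<lambda>_. borel))"
    and \<psi>_le: "\<And>k a. \<psi> k a \<le> ennreal c"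
    and \<psi>_lim: "\<And>a. (\<lambda>k. \<psi> k a) \<longlonglongrightarrow> ennreal c"
begin

lemma measurable_in_image:
  assumes "\<And>u i. i \<in> {1..<n} \<Longrightarrow> (\<lambda>w. g w u i) \<in> borel_measurable W"
    and "\<And>w i. w \<in> space W \<Longrightarrow> i \<in> {1..<n} \<Longrightarrow> continuous_on UNIV (\<lambda>u. g w u i)"
  shows "Measurable.pred (W \<Otimes>\<^sub>M lebesgue_on_pi {1..<n}) (\<lambda>p. in_image n (g (fst p)) (snd p))"
proof -
  let ?P = "W \<Otimes>\<^sub>M lebesgue_on_pi {1..<n}"
  let ?F = "\<lambda>p u. \<Sum>i\<in>{1..<n}. \<bar>snd p i - g (fst p) u i\<bar>"
  have "{p \<in> space ?P. \<exists>u\<in>ball0 n. ?F p u = 0} \<in> sets ?P"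
  proof (rule sets_ex_compact[OF compact_ball0])
    fix u :: "nat \<Rightarrow> real"
    show "(\<lambda>p. ?F p u) \<in> borel_measurable ?P"
    proof (intro borel_measurable_sum borel_measurable_abs borel_measurable_diff)
      fix i assume i: "i \<in> {1..<n}"
      note assms(1)[OF i, measurable]
      show "(\<lambda>p. snd p i) \<in> borel_measurable ?P" using i by measurable
      show "(\<lambda>p. g (fst p) u i) \<in> borel_measurable ?P" by measurable
    qed
  next
    fix p assume "p \<in> space ?P"
    then have "fst p \<in> space W" by (auto simp: space_pair_measure)
    then have "continuous_on (ball0 n) (\<lambda>u. g (fst p) u i)" if "i \<in> {1..<n}" for i
      using assms(2)[OF _ that] continuous_on_subset by blast
    then show "continuous_on (ball0 n) (?F p)"
      by (intro continuous_intros) auto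
  qed
  also have "{p \<in> space ?P. \<exists>u\<in>ball0 n. ?F p u = 0} = {p \<in> space ?P. in_image n (g (fst p)) (snd p)}"
    unfolding in_image_def by (subst sum_nonneg_eq_0_iff) auto
  finally show ?thesis by (simp add: pred_def)
qed

lemma pred_in_image_lin [measurable]:
  "Measurable.pred (W \<Otimes>\<^sub>M lebesgue_on_pi {1..<n}) (\<lambda>p. in_image n (lin {1..<n} (M (fst p))) (snd p))"
proof (rule measurable_in_image)
  fix u i assume i: "i \<in> {1..<n}"
  note M_measurable[OF i, measurable]
  show "(\<lambda>w. lin {1..<n} (M w) u i) \<in> borel_measurable W"
    using i unfolding lin_def by simp
next
  fix w i assume "i \<in> {1..<n}"
  then show "continuous_on UNIV (\<lambda>u. lin {1..<n} (M w) u i)"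
    unfolding lin_def by (simp add: continuous_intros)
qed

text \<open>Dominated convergence twice: in \<open>a\<close> for fixed \<open>w\<close>, dominated
  by the indicator of the cube of half side \<open>D w\<close>, and then in \<open>w\<close>,
  dominated by the volume of that cube. Pointwise convergence in \<open>a\<close> fails at most on
  the boundary of an ellipsoid.\<close>

lemma in_image_limit:
  "(\<lambda>k. \<integral>\<^sup>+w. (\<integral>\<^sup>+a. indicator {a. in_image n (\<lambda>u i. lin {1..<n} (M w) u i + h k w u i) a} a * \<psi> k a
       \<partial>lebesgue_on_pi {1..<n}) \<partial>W)
   \<longlonglongrightarrow> (\<integral>\<^sup>+w. (\<integral>\<^sup>+a. indicator {a. in_image n (lin {1..<n} (M w)) a} a * ennreal c \<partial>lebesgue_on_pi {1..<n}) \<partial>W)"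
proof -
  let ?J = "{1..<n}" and ?L = "lebesgue_on_pi {1..<n}"
  interpret L: sigma_finite_measure ?L by (rule sigma_finite_lebesgue_on_pi) simp
  note M_measurable[measurable] h_measurable[measurable]
  let ?g = "\<lambda>k w u i. lin ?J (M w) u i + h k w u i"
  have lin_meas: "(\<lambda>w. lin ?J (M w) u i) \<in> borel_measurable W" if "i \<in> ?J" for u i
    using that unfolding lin_def by simp
  have lin_cont: "continuous_on UNIV (\<lambda>u. lin ?J (M w) u i)" if "i \<in> ?J" for w i
    using that unfolding lin_def by (simp add: continuous_intros)
  have meas1[measurable]: "Measurable.pred (W \<Otimes>\<^sub>M ?L) (\<lambda>p. in_image n (?g k (fst p)) (snd p))" for k
  proof (rule measurable_in_image)
    fix u i assume "i \<in> ?J"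
    then show "(\<lambda>w. ?g k w u i) \<in> borel_measurable W"
      by (intro borel_measurable_add lin_meas h_measurable)
  next
    fix w i assume "w \<in> space W" "i \<in> ?J"
    then show "continuous_on UNIV (\<lambda>u. ?g k w u i)"
      by (intro continuous_on_add lin_cont h_continuous)
  qed
  have sec1: "Measurable.pred ?L (in_image n (?g k w))" if "w \<in> space W" for k w
    using measurable_Pair2[OF meas1 that] by simp
  have sec2: "Measurable.pred ?L (in_image n (lin ?J (M w)))" if "w \<in> space W" for w
    using measurable_Pair2[OF pred_in_image_lin that] by simp
  have bound: "(\<integral>\<^sup>+a. indicator (PiE ?J (\<lambda>_. {- D w..D w})) a * ennreal c \<partial>?L) \<le> ennreal ((2 * D w) ^ (n - 1)) * ennreal c"
    and D0: "0 \<le> D w" if "w \<in> space W" for w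
  proof -
    show D0: "0 \<le> D w"
      using D[OF that, of "\<lambda>_. 0" 1 0] n by (auto simp: ball0_def rvec_def)
    have "PiE ?J (\<lambda>_. {- D w..D w}) \<in> sets ?L" by (intro sets_PiM_I_finite) auto
    then have "(\<integral>\<^sup>+a. indicator (PiE ?J (\<lambda>_. {- D w..D w})) a * ennreal c \<partial>?L) = emeasure ?L (PiE ?J (\<lambda>_. {- D w..D w})) * ennreal c"
      by (simp add: nn_integral_multc)
    also have "emeasure ?L (PiE ?J (\<lambda>_. {- D w..D w})) = ennreal ((2 * D w) ^ (n - 1))"
      using D0 by (subst leb.emeasure_PiM) (auto simp: ennreal_power)
    finally show "(\<integral>\<^sup>+a. indicator (PiE ?J (\<lambda>_. {- D w..D w})) a * ennreal c \<partial>?L) \<le> ennreal ((2 * D w) ^ (n - 1)) * ennreal c"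
      by simp
  qed
  have le: "indicator {a. in_image n (?g k w) a} a * \<psi> k a \<le> indicator (PiE ?J (\<lambda>_. {- D w..D w})) a * ennreal c"
    if "w \<in> space W" "a \<in> space ?L" for k w a
  proof (cases "in_image n (?g k w) a")
    case True
    then obtain u where "u \<in> ball0 n" "\<And>i. i \<in> ?J \<Longrightarrow> a i = ?g k w u i" by (auto simp: in_image_def)
    then have "\<bar>a i\<bar> \<le> D w" if "i \<in> ?J" for i
      using D[OF \<open>w \<in> space W\<close>, of u i k] that by simp
    then have "a \<in> PiE ?J (\<lambda>_. {- D w..D w})"
      using that(2) by (auto simp: PiE_iff space_PiM abs_le_iff minus_le_iff)
    then show ?thesis using \<psi>_le by (simp add: indicator_def)
  qed (simp add: indicator_def)
  show ?thesis
  proof (rule nn_integral_dominated_convergence[where w="\<lambda>w. ennreal ((2 * D w) ^ (n - 1)) * ennreal c"])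
    show "AE w in W. (\<integral>\<^sup>+a. indicator {a. in_image n (?g k w) a} a * \<psi> k a \<partial>?L) \<le> ennreal ((2 * D w) ^ (n - 1)) * ennreal c" for k
      by (rule AE_I2, rule order_trans[OF nn_integral_mono bound]) (rule le)
    show "(\<integral>\<^sup>+w. ennreal ((2 * D w) ^ (n - 1)) * ennreal c \<partial>W) < \<infinity>"
      using D_moment by (simp add: nn_integral_multc ennreal_mult_less_top)
    show "AE w in W. (\<lambda>k. \<integral>\<^sup>+a. indicator {a. in_image n (?g k w) a} a * \<psi> k a \<partial>?L)
        \<longlonglongrightarrow> (\<integral>\<^sup>+a. indicator {a. in_image n (lin ?J (M w)) a} a * ennreal c \<partial>?L)"
      using M_inv AE_space
    proof eventually_elim
      case (elim w)
      then obtain N where N: "mutual_inverses ?J (M w) N" by auto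
      note [measurable] = sec1[OF elim(2)] sec2[OF elim(2)]
      obtain C where C0: "\<forall>k. \<forall>u\<in>ball0 n. \<forall>i\<in>?J. \<bar>h k w u i\<bar> \<le> C * e k \<and>
          (\<forall>u'\<in>ball0 n. \<forall>d. (\<forall>j. \<bar>u j - u' j\<bar> \<le> d) \<longrightarrow> \<bar>h k w u i - h k w u' i\<bar> \<le> C * e k * d)"
        using h[OF elim(2)] by (rule exE)
      have C: "\<bar>h k w u i\<bar> \<le> C * e k" if "u \<in> ball0 n" "i \<in> ?J" for k u i
        using C0 that by simp
      have C': "\<bar>h k w u i - h k w u' i\<bar> \<le> C * e k * d"
        if "u \<in> ball0 n" "u' \<in> ball0 n" "i \<in> ?J" "\<And>j. \<bar>u j - u' j\<bar> \<le> d" for k u u' d i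
        using C0[rule_format, of u i k] that by simp
      have Ce: "(\<lambda>k. C * e k) \<longlonglongrightarrow> 0" using tendsto_mult[OF tendsto_const[of C] e] by simp
      show ?case
      proof (rule nn_integral_dominated_convergence[where w="\<lambda>a. indicator (PiE ?J (\<lambda>_. {- D w..D w})) a * ennreal c"])
        have "PiE ?J (\<lambda>_. {- D w..D w}) \<in> sets ?L" by (intro sets_PiM_I_finite) auto
        then show "(\<lambda>a. indicator (PiE ?J (\<lambda>_. {- D w..D w})) a * ennreal c) \<in> borel_measurable ?L" by measurable
        show "(\<integral>\<^sup>+a. indicator (PiE ?J (\<lambda>_. {- D w..D w})) a * ennreal c \<partial>?L) < \<infinity>"
          using bound[OF elim(2)] by (rule order.strict_trans1) (simp add: ennreal_mult_less_top)
        show "AE a in ?L. indicator {a. in_image n (?g k w) a} a * \<psi> k a \<le> indicator (PiE ?J (\<lambda>_. {- D w..D w})) a * ennreal c" for k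
          using le[OF elim(2)] by (intro AE_I2)
        have "?J \<noteq> {}" using n by simp
        from AE_not_on_ellipsoid[OF finite_atLeastLessThan this N]
        show "AE a in ?L. (\<lambda>k. indicator {a. in_image n (?g k w) a} a * \<psi> k a)
          \<longlonglongrightarrow> indicator {a. in_image n (lin ?J (M w)) a} a * ennreal c"
        proof eventually_elim
          case (elim a)
          have "\<forall>\<^sub>F k in sequentially. in_image n (?g k w) a \<longleftrightarrow> in_image n (lin ?J (M w)) a"
            by (rule eventually_in_image_iff[OF N elim Ce C C'])
          then have ev: "\<forall>\<^sub>F k in sequentially. indicator {a. in_image n (lin ?J (M w)) a} a * \<psi> k a
              = indicator {a. in_image n (?g k w) a} a * \<psi> k a"
            by eventually_elim (simp add: indicator_def)
          have "(\<lambda>k. indicator {a. in_image n (lin ?J (M w)) a} a * \<psi> k a)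
              \<longlonglongrightarrow> indicator {a. in_image n (lin ?J (M w)) a} a * ennreal c"
            using \<psi>_lim[of a] by (cases "in_image n (lin ?J (M w)) a") (simp_all add: indicator_def)
          then show ?case by (rule Lim_transform_eventually[OF _ ev])
        qed
      qed measurable
    qed
  qed measurable
qed

end

section \<open>The probability of hitting a small cap\<close>

text \<open>Resampling the coefficients with indices in \<open>\<iota> ` J\<close>, for which the system is solved.\<close>

definition overwrite :: "'i set \<Rightarrow> (nat \<Rightarrow> 'i) \<Rightarrow> nat set \<Rightarrow> ('i \<Rightarrow> real) \<Rightarrow> (nat \<Rightarrow> real) \<Rightarrow> 'i \<Rightarrow> real" where
  "overwrite K \<iota> J w a = (\<lambda>k\<in>K. if k \<in> \<iota> ` J then a (the_inv_into J \<iota> k) else w k)"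

lemma measurable_overwrite:
  assumes "inj_on \<iota> J"
  shows "(\<lambda>p. overwrite K \<iota> J (fst p) (snd p)) \<in> gauss K \<Otimes>\<^sub>M gauss J \<rightarrow>\<^sub>M gauss K"
proof -
  have "(\<lambda>p. overwrite K \<iota> J (fst p) (snd p)) \<in> gauss K \<Otimes>\<^sub>M gauss J \<rightarrow>\<^sub>M PiM K (\<lambda>_. borel)"
    unfolding overwrite_def
  proof (rule measurable_restrict)
    fix k assume k: "k \<in> K"
    show "(\<lambda>p. if k \<in> \<iota> ` J then snd p (the_inv_into J \<iota> k) else fst p k) \<in> borel_measurable (gauss K \<Otimes>\<^sub>M gauss J)"
    proof (cases "k \<in> \<iota> ` J")
      case True
      then have "the_inv_into J \<iota> k \<in> J" using assms by (intro the_inv_into_into) auto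
      then show ?thesis using True by simp
    next
      case False
      then show ?thesis using k by simp
    qed
  qed
  then show ?thesis by (simp add: measurable_cong_sets[OF refl sets_gauss])
qed

text \<open>Replacing coordinates by fresh independent Gaussians leaves the law unchanged, as is
  seen on boxes. Keeping \<open>w\<close> on all of \<open>K\<close> avoids splitting the space into
  a product.\<close>

lemma nn_integral_gauss_overwrite:
  assumes K: "finite K" "finite J" and \<iota>: "inj_on \<iota> J" "\<iota> ` J \<subseteq> K"
    and F [measurable]: "F \<in> borel_measurable (gauss K)"
  shows "(\<integral>\<^sup>+w. F w \<partial>gauss K) = (\<integral>\<^sup>+w. (\<integral>\<^sup>+a. F (overwrite K \<iota> J w a) \<partial>gauss J) \<partial>gauss K)"
proof -
  interpret GK: prob_space "gauss K" by (rule prob_space_gauss)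
  interpret GJ: prob_space "gauss J" by (rule prob_space_gauss)
  let ?o = "\<lambda>p. overwrite K \<iota> J (fst p) (snd p)" and ?N = "density lborel std_normal_density"
  note meas[measurable] = measurable_overwrite[OF \<iota>(1), of K]
  have "distr (gauss K \<Otimes>\<^sub>M gauss J) (gauss K) ?o = PiM K (\<lambda>_. ?N)"
  proof (rule gau.PiM_eqI[OF K(1)])
    show "sets (distr (gauss K \<Otimes>\<^sub>M gauss J) (gauss K) ?o) = sets (PiM K (\<lambda>_. ?N))"
      by (simp add: gauss_def)
    fix A :: "'a \<Rightarrow> real set" assume "\<And>i. i \<in> K \<Longrightarrow> A i \<in> sets ?N"
    then have A: "\<And>i. i \<in> K \<Longrightarrow> A i \<in> sets borel" by simp
    let ?B = "PiE K (\<lambda>k. if k \<in> \<iota> ` J then UNIV else A k)" and ?C = "PiE J (\<lambda>j. A (\<iota> j))"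
    have pre: "?o -` PiE K A \<inter> space (gauss K \<Otimes>\<^sub>M gauss J) = ?B \<times> ?C"
    proof (intro Set.set_eqI iffI)
      fix p assume p: "p \<in> ?o -` PiE K A \<inter> space (gauss K \<Otimes>\<^sub>M gauss J)"
      then have sp: "fst p \<in> extensional K" "snd p \<in> extensional J"
        by (auto simp: space_pair_measure space_gauss)
      have mem: "(if k \<in> \<iota> ` J then snd p (the_inv_into J \<iota> k) else fst p k) \<in> A k" if "k \<in> K" for k
        using PiE_mem[of "?o p" K A k] p that by (simp add: overwrite_def)
      have "snd p j \<in> A (\<iota> j)" if "j \<in> J" for j
        using mem[of "\<iota> j"] that \<iota> by (auto simp: the_inv_into_f_f)
      moreover have "fst p k \<in> (if k \<in> \<iota> ` J then UNIV else A k)" if "k \<in> K" for k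
        using mem[OF that] by (cases "k \<in> \<iota> ` J") simp_all
      ultimately have "fst p \<in> ?B" "snd p \<in> ?C" using sp by (simp_all add: PiE_iff)
      then show "p \<in> ?B \<times> ?C" by (simp add: mem_Times_iff)
    next
      fix p assume p: "p \<in> ?B \<times> ?C"
      then have BC: "fst p \<in> ?B" "snd p \<in> ?C" by auto
      have "overwrite K \<iota> J (fst p) (snd p) k \<in> A k" if k: "k \<in> K" for k
      proof (cases "k \<in> \<iota> ` J")
        case True
        then obtain j where j: "j \<in> J" "k = \<iota> j" by auto
        then show ?thesis using PiE_mem[OF BC(2) j(1)] k \<iota> by (simp add: overwrite_def the_inv_into_f_f)
      next
        case False
        then show ?thesis using PiE_mem[OF BC(1) k] k by (simp add: overwrite_def)
      qed
      then have "?o p \<in> PiE K A" by (auto simp: PiE_iff overwrite_def)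
      moreover have "p \<in> space (gauss K \<Otimes>\<^sub>M gauss J)"
        using BC by (auto simp: space_pair_measure space_gauss PiE_def mem_Times_iff)
      ultimately show "p \<in> ?o -` PiE K A \<inter> space (gauss K \<Otimes>\<^sub>M gauss J)" by simp
    qed
    have "PiE K A \<in> sets (gauss K)"
      unfolding gauss_def using K A by (intro sets_PiM_I_finite) auto
    then have "emeasure (distr (gauss K \<Otimes>\<^sub>M gauss J) (gauss K) ?o) (PiE K A) = emeasure (gauss K \<Otimes>\<^sub>M gauss J) (?B \<times> ?C)"
      by (subst emeasure_distr) (simp_all add: pre meas)
    also have "\<dots> = emeasure (gauss K) ?B * emeasure (gauss J) ?C"
    proof (rule GJ.emeasure_pair_measure_Times)
      show "?B \<in> sets (gauss K)" unfolding gauss_def using K A by (intro sets_PiM_I_finite) auto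
      show "?C \<in> sets (gauss J)" unfolding gauss_def using K A \<iota> by (intro sets_PiM_I_finite) auto
    qed
    also have "emeasure (gauss J) ?C = (\<Prod>j\<in>J. emeasure ?N (A (\<iota> j)))"
      unfolding gauss_def using K A \<iota> by (intro gau.emeasure_PiM) auto
    also have "\<dots> = (\<Prod>k\<in>\<iota> ` J. emeasure ?N (A k))"
      using \<iota> by (simp add: prod.reindex)
    also have "emeasure (gauss K) ?B = (\<Prod>k\<in>K. emeasure ?N (if k \<in> \<iota> ` J then UNIV else A k))"
      unfolding gauss_def using K A by (intro gau.emeasure_PiM) auto
    also have "\<dots> = (\<Prod>k\<in>K. if k \<in> \<iota> ` J then 1 else emeasure ?N (A k))"
      using prob_space.emeasure_space_1[OF prob_space_std_normal] by (intro prod.cong) auto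
    also have "\<dots> = (\<Prod>k\<in>K - \<iota> ` J. emeasure ?N (A k))"
      using K by (intro prod.mono_neutral_cong_right) auto
    also have "\<dots> * (\<Prod>k\<in>\<iota> ` J. emeasure ?N (A k)) = (\<Prod>k\<in>K. emeasure ?N (A k))"
      using prod.subset_diff[OF \<iota>(2) K(1), of "\<lambda>k. emeasure ?N (A k)"] by simp
    finally show "emeasure (distr (gauss K \<Otimes>\<^sub>M gauss J) (gauss K) ?o) (PiE K A) = (\<Prod>k\<in>K. emeasure ?N (A k))" .
  qed
  then have "(\<integral>\<^sup>+w. F w \<partial>gauss K) = (\<integral>\<^sup>+w. F w \<partial>distr (gauss K \<Otimes>\<^sub>M gauss J) (gauss K) ?o)"
    by (simp add: gauss_def)
  also have "\<dots> = (\<integral>\<^sup>+p. F (?o p) \<partial>(gauss K \<Otimes>\<^sub>M gauss J))"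
    by (intro nn_integral_distr) measurable
  also have "\<dots> = (\<integral>\<^sup>+w. (\<integral>\<^sup>+a. F (?o (w, a)) \<partial>gauss J) \<partial>gauss K)"
    by (intro GJ.nn_integral_fst[symmetric]) measurable
  finally show ?thesis by simp
qed

section \<open>Expected volume of the image of the ball\<close>

text \<open>This is the absolute value of the determinant of \<open>A\<close> times the volume of
  the unit ball of dimension \<open>n - 1\<close>; the value is never evaluated.\<close>

definition image_vol :: "nat \<Rightarrow> (nat \<Rightarrow> nat \<Rightarrow> real) \<Rightarrow> ennreal" where
  "image_vol n A = emeasure (lebesgue_on_pi {1..<n}) {a \<in> space (lebesgue_on_pi {1..<n}). in_image n (lin {1..<n} A) a}"

context image_limit
begin

lemma sets_in_image_lin:
  "w \<in> space W \<Longrightarrow> {a \<in> space (lebesgue_on_pi {1..<n}). in_image n (lin {1..<n} (M w)) a} \<in> sets (lebesgue_on_pi {1..<n})"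
  using measurable_Pair2[OF pred_in_image_lin, of w] by (simp add: pred_def)

lemma measurable_image_vol [measurable]: "(\<lambda>w. image_vol n (M w)) \<in> borel_measurable W"
proof -
  let ?L = "lebesgue_on_pi {1..<n}"
  interpret L: sigma_finite_measure ?L by (rule sigma_finite_lebesgue_on_pi) simp
  let ?S = "{p \<in> space (W \<Otimes>\<^sub>M ?L). in_image n (lin {1..<n} (M (fst p))) (snd p)}"
  have "?S \<in> sets (W \<Otimes>\<^sub>M ?L)" using pred_in_image_lin by (simp only: pred_def)
  then have "(\<lambda>w. emeasure ?L (Pair w -` ?S)) \<in> borel_measurable W"
    by (rule L.measurable_emeasure_Pair)
  moreover have "emeasure ?L (Pair w -` ?S) = image_vol n (M w)" if "w \<in> space W" for w
    unfolding image_vol_def using that by (intro arg_cong2[where f=emeasure]) (auto simp: space_pair_measure)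
  ultimately show ?thesis by (simp cong: measurable_cong)
qed

lemma image_vol_limit:
  "(\<lambda>k. \<integral>\<^sup>+w. (\<integral>\<^sup>+a. indicator {a. in_image n (\<lambda>u i. lin {1..<n} (M w) u i + h k w u i) a} a * \<psi> k a
       \<partial>lebesgue_on_pi {1..<n}) \<partial>W)
   \<longlonglongrightarrow> ennreal c * (\<integral>\<^sup>+w. image_vol n (M w) \<partial>W)"
proof -
  let ?L = "lebesgue_on_pi {1..<n}"
  have "(\<integral>\<^sup>+w. (\<integral>\<^sup>+a. indicator {a. in_image n (lin {1..<n} (M w)) a} a * ennreal c \<partial>?L) \<partial>W)
      = (\<integral>\<^sup>+w. ennreal c * image_vol n (M w) \<partial>W)"
  proof (rule nn_integral_cong)
    fix w assume w: "w \<in> space W"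
    let ?S = "{a \<in> space ?L. in_image n (lin {1..<n} (M w)) a}"
    have "(\<integral>\<^sup>+a. indicator {a. in_image n (lin {1..<n} (M w)) a} a * ennreal c \<partial>?L)
        = (\<integral>\<^sup>+a. ennreal c * indicator ?S a \<partial>?L)"
      by (intro nn_integral_cong) (simp add: indicator_def)
    also have "\<dots> = ennreal c * image_vol n (M w)"
      unfolding image_vol_def by (rule nn_integral_cmult_indicator[OF sets_in_image_lin[OF w]])
    finally show "(\<integral>\<^sup>+a. indicator {a. in_image n (lin {1..<n} (M w)) a} a * ennreal c \<partial>?L) = ennreal c * image_vol n (M w)" .
  qed
  also have "\<dots> = ennreal c * (\<integral>\<^sup>+w. image_vol n (M w) \<partial>W)"
    by (rule nn_integral_cmult) measurable
  finally show ?thesis using in_image_limit by simp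
qed

lemma image_vol_finite: "(\<integral>\<^sup>+w. image_vol n (M w) \<partial>W) < \<infinity>"
proof -
  let ?L = "lebesgue_on_pi {1..<n}"
  have "image_vol n (M w) \<le> ennreal ((2 * D w) ^ (n - 1))" if w: "w \<in> space W" for w
  proof -
    \<comment> \<open>The bound \<open>D w\<close> is assumed for the perturbed maps and passes to
      the linear one as the perturbation tends to \<open>0\<close>.\<close>
    have lin_le: "\<bar>lin {1..<n} (M w) u i\<bar> \<le> D w" if u: "u \<in> ball0 n" and i: "i \<in> {1..<n}" for u i
    proof -
      obtain C where "\<forall>k. \<forall>u\<in>ball0 n. \<forall>i\<in>{1..<n}. \<bar>h k w u i\<bar> \<le> C * e k \<and>
          (\<forall>u'\<in>ball0 n. \<forall>d. (\<forall>j. \<bar>u j - u' j\<bar> \<le> d) \<longrightarrow> \<bar>h k w u i - h k w u' i\<bar> \<le> C * e k * d)"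
        using h[OF w] by (rule exE)
      then have C: "\<bar>h k w u i\<bar> \<le> C * e k" for k using u i by simp
      have "(\<lambda>k. C * e k) \<longlonglongrightarrow> 0" using tendsto_mult[OF tendsto_const[of C] e] by simp
      then have "(\<lambda>k. h k w u i) \<longlonglongrightarrow> 0"
        by (rule Lim_null_comparison[rotated]) (simp add: C)
      then have "(\<lambda>k. \<bar>lin {1..<n} (M w) u i + h k w u i\<bar>) \<longlonglongrightarrow> \<bar>lin {1..<n} (M w) u i + 0\<bar>"
        by (intro tendsto_intros)
      then have "\<bar>lin {1..<n} (M w) u i + 0\<bar> \<le> D w"
        by (rule LIMSEQ_le_const2) (use D[OF w u i] in auto)
      then show ?thesis by simp
    qed
    have D0: "0 \<le> D w"
      using lin_le[of "\<lambda>_. 0" 1] n by (auto simp: ball0_def rvec_def)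
    have "image_vol n (M w) \<le> emeasure ?L (PiE {1..<n} (\<lambda>_. {- D w..D w}))"
      unfolding image_vol_def
    proof (rule emeasure_mono)
      show "PiE {1..<n} (\<lambda>_. {- D w..D w}) \<in> sets ?L" by (intro sets_PiM_I_finite) auto
      show "{a \<in> space ?L. in_image n (lin {1..<n} (M w)) a} \<subseteq> PiE {1..<n} (\<lambda>_. {- D w..D w})"
      proof (rule subsetI)
        fix a assume "a \<in> {a \<in> space ?L. in_image n (lin {1..<n} (M w)) a}"
        then have a: "a \<in> space ?L" "in_image n (lin {1..<n} (M w)) a" by auto
        then obtain u where "u \<in> ball0 n" "\<And>i. i \<in> {1..<n} \<Longrightarrow> a i = lin {1..<n} (M w) u i"
          unfolding in_image_def by blast
        then have "\<bar>a i\<bar> \<le> D w" if "i \<in> {1..<n}" for i using lin_le[of u i] that by simp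
        then show "a \<in> PiE {1..<n} (\<lambda>_. {- D w..D w})"
          using a(1) by (auto simp: PiE_iff space_PiM abs_le_iff minus_le_iff)
      qed
    qed
    also have "emeasure ?L (PiE {1..<n} (\<lambda>_. {- D w..D w})) = ennreal ((2 * D w) ^ (n - 1))"
      using D0 by (subst leb.emeasure_PiM) (auto simp: ennreal_power)
    finally show ?thesis .
  qed
  then have "(\<integral>\<^sup>+w. image_vol n (M w) \<partial>W) \<le> (\<integral>\<^sup>+w. ennreal ((2 * D w) ^ (n - 1)) \<partial>W)"
    by (intro nn_integral_mono)
  then show ?thesis using D_moment by (rule order.strict_trans1)
qed

end

section \<open>The affine chart around the first axis\<close>

definition chart :: "real \<Rightarrow> (nat \<Rightarrow> real) \<Rightarrow> nat \<Rightarrow> real" where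
  "chart r u i = (if i = 0 then 1 else r * u i)"

lemma sum_lessThan_split0:
  fixes g :: "nat \<Rightarrow> real"
  shows "0 < n \<Longrightarrow> (\<Sum>i<n. g i) = g 0 + (\<Sum>i\<in>{1..<n}. g i)"
  by (simp add: lessThan_atLeast0 sum.atLeast_Suc_lessThan)

text \<open>Tolerance \<open>r\<^sup>2\<close> means an angle with tangent at most \<open>r\<close>.
  Dividing a unit vector in the cap by its coordinate \<open>0\<close>, which cannot vanish, lands
  in the chart; dividing the other coordinates by \<open>r\<close> as well gives \<open>u\<close>,
  whose norm is the tangent divided by \<open>r\<close>.\<close>

lemma (in random_cone) hits_chart:
  assumes r: "0 < r"
  shows "hits (r\<^sup>2) w first_axis \<longleftrightarrow> (\<exists>u\<in>ball0 n. f w (chart r u) = 0)"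
proof
  assume "hits (r\<^sup>2) w first_axis"
  then obtain v where v: "v \<in> rvec n" "ip n v v = 1" "f w v = 0" "near n (r\<^sup>2) v first_axis"
    by (auto simp: hits_def ip_def)
  have v0: "1 \<le> (1 + r\<^sup>2) * (v 0)\<^sup>2"
    using v(4) by (simp add: near_def v(2) ip_first_axis(1)[OF n_pos]) (simp add: first_axis_def)
  then have v0': "v 0 \<noteq> 0" by auto
  define u where "u i = (if i = 0 then 0 else v i / (v 0 * r))" for i
  have "(\<Sum>i<n. u i * u i) = (\<Sum>i\<in>{1..<n}. v i * v i / (v 0 * r)\<^sup>2)"
    by (subst ball0_sum) (auto simp: u_def power2_eq_square intro!: sum.cong)
  also have "\<dots> = (1 - (v 0)\<^sup>2) / (v 0 * r)\<^sup>2"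
    using v(2) by (simp add: ip_def sum_lessThan_split0[OF n_pos] sum_divide_distrib[symmetric] power2_eq_square)
  also have "\<dots> \<le> 1"
  proof -
    have "1 - (v 0)\<^sup>2 \<le> (v 0 * r)\<^sup>2" using v0 by (simp add: power_mult_distrib algebra_simps)
    moreover have "0 < (v 0 * r)\<^sup>2" using v0' r by simp
    ultimately show ?thesis by (simp only: divide_le_eq_1) blast
  qed
  finally have "u \<in> ball0 n" using v(1) by (auto simp: ball0_def rvec_def u_def)
  moreover have "chart r u = (\<lambda>i. (1 / v 0) * v i)"
    using v0' r by (auto simp: chart_def u_def)
  then have "f w (chart r u) = 0" using f_homogeneous[OF v(3), of "1 / v 0"] by simp
  ultimately show "\<exists>u\<in>ball0 n. f w (chart r u) = 0" by auto
next
  assume "\<exists>u\<in>ball0 n. f w (chart r u) = 0"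
  then obtain u where u: "u \<in> ball0 n" "f w (chart r u) = 0" by auto
  let ?c = "chart r u"
  have "ip n ?c ?c = 1 + r\<^sup>2 * (\<Sum>i\<in>{1..<n}. u i * u i)"
    by (simp add: ip_def sum_lessThan_split0[OF n_pos] chart_def sum_distrib_left power2_eq_square mult_ac)
  moreover have "(\<Sum>i\<in>{1..<n}. u i * u i) \<le> 1" "0 \<le> (\<Sum>i\<in>{1..<n}. u i * u i)"
    using u(1) ball0_sum[of u n] by (auto simp: ball0_def intro: sum_nonneg)
  ultimately have c: "1 \<le> ip n ?c ?c" "ip n ?c ?c \<le> 1 + r\<^sup>2"
    using mult_left_mono[of "\<Sum>i\<in>{1..<n}. u i * u i" 1 "r\<^sup>2"] by auto
  define s where "s = 1 / sqrt (ip n ?c ?c)"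
  have s: "s \<noteq> 0" "s * s * ip n ?c ?c = 1"
    using c(1) by (auto simp: s_def)
  have "(\<lambda>i. s * ?c i) \<in> rvec n" using u(1) n_pos by (auto simp: rvec_def chart_def ball0_def)
  moreover have "(\<Sum>i<n. (s * ?c i) * (s * ?c i)) = 1"
    using s(2) ip_scale_left[of n s ?c "\<lambda>i. s * ?c i"] ip_scale_right[of n ?c s ?c] by (simp add: ip_def)
  moreover have "f w (\<lambda>i. s * ?c i) = 0" by (rule f_homogeneous[OF u(2)])
  moreover have "near n (r\<^sup>2) (\<lambda>i. s * ?c i) first_axis"
    unfolding near_scale_left[OF s(1)] using c(2) by (simp add: near_def ip_first_axis(1)[OF n_pos]) (simp add: chart_def first_axis_def)
  ultimately show "hits (r\<^sup>2) w first_axis" unfolding hits_def by (intro bexI[of _ "\<lambda>i. s * ?c i"]) auto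
qed

text \<open>\<open>\<iota> i\<close> is the index of the constant coefficient of equation
  \<open>i\<close>. It enters additively, so \<open>chart_eq\<close> solves the system for the
  resampled values \<open>a\<close>; the factor \<open>r\<close> splits off because all other terms
  vanish on the axis itself.\<close>

locale gauss_cone = random_cone "gauss K" n f for K :: "'i set" and n f +
  fixes \<iota> :: "nat \<Rightarrow> 'i" and A :: "('i \<Rightarrow> real) \<Rightarrow> nat \<Rightarrow> nat \<Rightarrow> real"
    and h :: "real \<Rightarrow> ('i \<Rightarrow> real) \<Rightarrow> (nat \<Rightarrow> real) \<Rightarrow> nat \<Rightarrow> real" and D :: "('i \<Rightarrow> real) \<Rightarrow> real"
  assumes K: "finite K" and n: "1 < n" and \<iota>: "inj_on \<iota> {1..<n}" "\<iota> ` {1..<n} \<subseteq> K"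
    and chart_eq: "\<And>w a r u. w \<in> space (gauss K) \<Longrightarrow> 0 < r \<Longrightarrow> r \<le> 1 \<Longrightarrow> u \<in> ball0 n \<Longrightarrow>
      f (overwrite K \<iota> {1..<n} w a) (chart r u) = 0 \<longleftrightarrow>
      (\<forall>i\<in>{1..<n}. a i = r * (lin {1..<n} (A w) u i + h r w u i))"
    and A_measurable: "\<And>i j. i \<in> {1..<n} \<Longrightarrow> j \<in> {1..<n} \<Longrightarrow> (\<lambda>w. A w i j) \<in> borel_measurable (gauss K)"
    and A_inv: "AE w in gauss K. \<exists>N. mutual_inverses {1..<n} (A w) N"
    and h_measurable: "\<And>r u i. i \<in> {1..<n} \<Longrightarrow> (\<lambda>w. h r w u i) \<in> borel_measurable (gauss K)"
    and h_continuous: "\<And>r w i. w \<in> space (gauss K) \<Longrightarrow> i \<in> {1..<n} \<Longrightarrow> continuous_on UNIV (\<lambda>u. h r w u i)"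
    and h: "\<And>w. w \<in> space (gauss K) \<Longrightarrow> \<exists>C. \<forall>r. 0 < r \<longrightarrow> r \<le> 1 \<longrightarrow> (\<forall>u\<in>ball0 n. \<forall>i\<in>{1..<n}. \<bar>h r w u i\<bar> \<le> C * r \<and>
      (\<forall>u'\<in>ball0 n. \<forall>d. (\<forall>j. \<bar>u j - u' j\<bar> \<le> d) \<longrightarrow> \<bar>h r w u i - h r w u' i\<bar> \<le> C * r * d))"
    and D_measurable: "D \<in> borel_measurable (gauss K)"
    and D: "\<And>w r u i. w \<in> space (gauss K) \<Longrightarrow> 0 < r \<Longrightarrow> r \<le> 1 \<Longrightarrow> u \<in> ball0 n \<Longrightarrow> i \<in> {1..<n} \<Longrightarrow>
      \<bar>lin {1..<n} (A w) u i + h r w u i\<bar> \<le> D w"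
    and D_moment: "(\<integral>\<^sup>+w. ennreal ((2 * D w) ^ (n - 1)) \<partial>gauss K) < \<infinity>"
begin

text \<open>After resampling, the cap is met if and only if \<open>a\<close> lies in
  \<open>r\<close> times the image of the ball. Substituting \<open>r * a\<close> for
  \<open>a\<close> produces the factor \<open>r ^ (n - 1)\<close> and moves the remaining dependence
  on \<open>r\<close> into the perturbation and the density.\<close>

lemma hit_prob_eq:
  assumes r: "0 < r" "r \<le> 1"
  shows "hit_prob (r\<^sup>2) = ennreal (r ^ (n - 1)) *
    (\<integral>\<^sup>+w. (\<integral>\<^sup>+a. indicator {a. in_image n (\<lambda>u i. lin {1..<n} (A w) u i + h r w u i) a} a *
       gauss_density {1..<n} (\<lambda>i. r * a i) \<partial>lebesgue_on_pi {1..<n}) \<partial>gauss K)"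
proof -
  let ?J = "{1..<n}" and ?L = "lebesgue_on_pi {1..<n}"
  interpret L: sigma_finite_measure ?L by (rule sigma_finite_lebesgue_on_pi) simp
  define F :: "('i \<Rightarrow> real) \<Rightarrow> ennreal" where "F = indicator {w \<in> space (gauss K). hits (r\<^sup>2) w first_axis}"
  have F[measurable]: "F \<in> borel_measurable (gauss K)"
    unfolding F_def using sets_hits_first_axis by (rule borel_measurable_indicator)
  let ?s = "\<lambda>a. \<lambda>i\<in>?J. r * a i"
  have ov: "(\<lambda>p. overwrite K \<iota> ?J (fst p) (?s (snd p))) \<in> gauss K \<Otimes>\<^sub>M ?L \<rightarrow>\<^sub>M gauss K"
  proof -
    have "(\<lambda>p. (fst p, ?s (snd p))) \<in> gauss K \<Otimes>\<^sub>M ?L \<rightarrow>\<^sub>M gauss K \<Otimes>\<^sub>M gauss ?J"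
      by measurable
    from measurable_compose[OF this measurable_overwrite[OF \<iota>(1)]] show ?thesis by simp
  qed
  have [measurable]: "(\<lambda>p. F (overwrite K \<iota> ?J (fst p) (?s (snd p)))) \<in> borel_measurable (gauss K \<Otimes>\<^sub>M ?L)"
    by (rule measurable_compose[OF ov F])
  have "hit_prob (r\<^sup>2) = (\<integral>\<^sup>+w. F w \<partial>gauss K)"
    unfolding F_def hit_prob_def by (rule nn_integral_indicator[symmetric, OF sets_hits_first_axis])
  also have "\<dots> = (\<integral>\<^sup>+w. (\<integral>\<^sup>+a. F (overwrite K \<iota> ?J w a) \<partial>gauss ?J) \<partial>gauss K)"
    by (rule nn_integral_gauss_overwrite[OF K finite_atLeastLessThan \<iota> F])
  also have "\<dots> = (\<integral>\<^sup>+w. ennreal (r ^ (n - 1)) * (\<integral>\<^sup>+a. F (overwrite K \<iota> ?J w (?s a)) * gauss_density ?J (?s a) \<partial>?L) \<partial>gauss K)"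
  proof (rule nn_integral_cong)
    fix w assume w: "w \<in> space (gauss K)"
    have "(\<lambda>a. overwrite K \<iota> ?J w a) \<in> gauss ?J \<rightarrow>\<^sub>M gauss K"
      using measurable_Pair2[OF measurable_overwrite[OF \<iota>(1)] w] by simp
    from measurable_compose[OF this F]
    have FO[measurable]: "(\<lambda>a. F (overwrite K \<iota> ?J w a)) \<in> borel_measurable (PiM ?J (\<lambda>_. borel))"
      unfolding measurable_cong_sets[OF sets_gauss refl] .
    have "(\<integral>\<^sup>+a. F (overwrite K \<iota> ?J w a) \<partial>gauss ?J) = (\<integral>\<^sup>+a. gauss_density ?J a * F (overwrite K \<iota> ?J w a) \<partial>?L)"
      by (rule nn_integral_gauss[OF finite_atLeastLessThan FO])
    also have "\<dots> = ennreal (r ^ card ?J) * (\<integral>\<^sup>+a. gauss_density ?J (?s a) * F (overwrite K \<iota> ?J w (?s a)) \<partial>?L)"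
      by (rule nn_integral_lebesgue_on_pi_scale[OF finite_atLeastLessThan _ r(1)]) measurable
    finally show "(\<integral>\<^sup>+a. F (overwrite K \<iota> ?J w a) \<partial>gauss ?J)
        = ennreal (r ^ (n - 1)) * (\<integral>\<^sup>+a. F (overwrite K \<iota> ?J w (?s a)) * gauss_density ?J (?s a) \<partial>?L)"
      by (simp add: mult.commute)
  qed
  also have "\<dots> = ennreal (r ^ (n - 1)) * (\<integral>\<^sup>+w. (\<integral>\<^sup>+a. F (overwrite K \<iota> ?J w (?s a)) * gauss_density ?J (?s a) \<partial>?L) \<partial>gauss K)"
    by (rule nn_integral_cmult) measurable
  also have "(\<integral>\<^sup>+w. (\<integral>\<^sup>+a. F (overwrite K \<iota> ?J w (?s a)) * gauss_density ?J (?s a) \<partial>?L) \<partial>gauss K) =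
    (\<integral>\<^sup>+w. (\<integral>\<^sup>+a. indicator {a. in_image n (\<lambda>u i. lin ?J (A w) u i + h r w u i) a} a *
       gauss_density ?J (\<lambda>i. r * a i) \<partial>?L) \<partial>gauss K)"
  proof (intro nn_integral_cong arg_cong2[where f="(*)"])
    fix w and a :: "nat \<Rightarrow> real"
    assume w: "w \<in> space (gauss K)"
    have "overwrite K \<iota> ?J w (?s a) \<in> space (gauss K)"
      by (simp add: space_gauss overwrite_def)
    moreover have "hits (r\<^sup>2) (overwrite K \<iota> ?J w (?s a)) first_axis \<longleftrightarrow> in_image n (\<lambda>u i. lin ?J (A w) u i + h r w u i) a"
      unfolding hits_chart[OF r(1)] in_image_def
      using chart_eq[OF w r, of _ "?s a"] r(1) by (intro bex_cong refl) simp
    ultimately show "F (overwrite K \<iota> ?J w (?s a)) = indicator {a. in_image n (\<lambda>u i. lin ?J (A w) u i + h r w u i) a} a"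
      by (simp add: F_def indicator_def)
    show "gauss_density ?J (?s a) = gauss_density ?J (\<lambda>i. r * a i)"
      unfolding gauss_density_def by (intro prod.cong refl) simp
  qed
  finally show ?thesis .
qed

text \<open>The constant is the value of the Gaussian density at the origin: it bounds all the
  weights and is their limit as \<open>r k\<close> tends to \<open>0\<close>.\<close>

lemma gauss_image_limit:
  assumes r: "\<And>k. 0 < r k" "\<And>k. r k \<le> 1" "r \<longlonglongrightarrow> 0"
  shows "image_limit (gauss K) n A (\<lambda>k. h (r k)) r D (\<lambda>k a. gauss_density {1..<n} (\<lambda>i. r k * a i)) ((1 / sqrt (2 * pi)) ^ (n - 1))"
proof (intro image_limit.intro image_limit_axioms.intro prob_space_gauss n A_measurable A_inv
    h_measurable h_continuous r(3) D_measurable D[OF _ r(1,2)] D_moment)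
  let ?J = "{1..<n}" and ?c = "(1 / sqrt (2 * pi)) ^ (n - 1)"
  fix w assume "w \<in> space (gauss K)"
  from h[OF this] obtain C where C: "\<forall>r. 0 < r \<longrightarrow> r \<le> 1 \<longrightarrow> (\<forall>u\<in>ball0 n. \<forall>i\<in>{1..<n}. \<bar>h r w u i\<bar> \<le> C * r \<and>
      (\<forall>u'\<in>ball0 n. \<forall>d. (\<forall>j. \<bar>u j - u' j\<bar> \<le> d) \<longrightarrow> \<bar>h r w u i - h r w u' i\<bar> \<le> C * r * d))"
    by (rule exE)
  show "\<exists>C. \<forall>k. \<forall>u\<in>ball0 n. \<forall>i\<in>{1..<n}. \<bar>h (r k) w u i\<bar> \<le> C * r k \<and>
      (\<forall>u'\<in>ball0 n. \<forall>d. (\<forall>j. \<bar>u j - u' j\<bar> \<le> d) \<longrightarrow> \<bar>h (r k) w u i - h (r k) w u' i\<bar> \<le> C * r k * d)"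
    using C r(1,2) by (intro exI[of _ C] allI) simp
next
  let ?J = "{1..<n}" and ?c = "(1 / sqrt (2 * pi)) ^ (n - 1)"
  fix k
  show "(\<lambda>a. gauss_density ?J (\<lambda>i. r k * a i)) \<in> borel_measurable (PiM ?J (\<lambda>_. borel))"
    unfolding gauss_density_def by measurable
  fix a :: "nat \<Rightarrow> real"
  have "0 \<le> (\<Sum>i\<in>?J. (r k * a i) * (r k * a i))" by (intro sum_nonneg) auto
  then show "gauss_density ?J (\<lambda>i. r k * a i) \<le> ennreal ?c"
    unfolding gauss_density_eq[OF finite_atLeastLessThan]
    by (intro ennreal_leI) (auto intro!: mult_left_le)
next
  let ?J = "{1..<n}" and ?c = "(1 / sqrt (2 * pi)) ^ (n - 1)"
  fix a :: "nat \<Rightarrow> real"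
  have "(\<lambda>k. ?c * exp (- (\<Sum>i\<in>?J. (r k * a i) * (r k * a i)) / 2)) \<longlonglongrightarrow> ?c * exp (- (\<Sum>i\<in>?J. (0 * a i) * (0 * a i)) / 2)"
    by (intro tendsto_intros r(3)) simp
  then have "(\<lambda>k. ?c * exp (- (\<Sum>i\<in>?J. (r k * a i) * (r k * a i)) / 2)) \<longlonglongrightarrow> ?c"
    by simp
  then show "(\<lambda>k. gauss_density ?J (\<lambda>i. r k * a i)) \<longlonglongrightarrow> ennreal ?c"
    unfolding gauss_density_eq[OF finite_atLeastLessThan] by (intro tendsto_ennrealI) simp
qed auto

theorem hit_prob_limit:
  assumes r: "\<And>k. 0 < r k" "\<And>k. r k \<le> 1" "r \<longlonglongrightarrow> 0"
  shows "(\<lambda>k. hit_prob ((r k)\<^sup>2) / ennreal (r k ^ (n - 1)))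
    \<longlonglongrightarrow> ennreal ((1 / sqrt (2 * pi)) ^ (n - 1)) * (\<integral>\<^sup>+w. image_vol n (A w) \<partial>gauss K)"
proof -
  interpret L: image_limit "gauss K" n A "\<lambda>k. h (r k)" r D "\<lambda>k a. gauss_density {1..<n} (\<lambda>i. r k * a i)" "(1 / sqrt (2 * pi)) ^ (n - 1)"
    by (rule gauss_image_limit[OF r])
  have eq: "hit_prob ((r k)\<^sup>2) / ennreal (r k ^ (n - 1)) =
    (\<integral>\<^sup>+w. (\<integral>\<^sup>+a. indicator {a. in_image n (\<lambda>u i. lin {1..<n} (A w) u i + h (r k) w u i) a} a *
       gauss_density {1..<n} (\<lambda>i. r k * a i) \<partial>lebesgue_on_pi {1..<n}) \<partial>gauss K)" for k
    unfolding hit_prob_eq[OF r(1,2)] using r(1)[of k]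
    by (subst mult.commute, subst ennreal_mult_divide_eq) (auto simp: ennreal_eq_0_iff not_le)
  show ?thesis
    unfolding eq by (rule L.image_vol_limit)
qed

end

section \<open>Homogeneous linear systems\<close>

text \<open>Induction on the size by expansion along column \<open>0\<close>: the determinant is
  affine in the variable of the corner entry, with slope \<open>s\<close> times the complementary
  minor, which is almost surely nonzero by induction. The terms with \<open>\<tau>\<close> allow a
  common variable \<open>g z\<close> on the diagonal, the role of the random eigenvalue.\<close>

lemma AE_gauss_det_nonzero:
  fixes \<kappa> :: "nat \<Rightarrow> nat \<Rightarrow> 'i"
  assumes "finite L" "z \<in> L" "s \<noteq> 0"
    and "\<And>i j. i < m \<Longrightarrow> j < m \<Longrightarrow> \<kappa> i j \<in> L - {z}"
    and "\<And>i j i' j'. i < m \<Longrightarrow> j < m \<Longrightarrow> i' < m \<Longrightarrow> j' < m \<Longrightarrow> \<kappa> i j = \<kappa> i' j' \<Longrightarrow> i = i' \<and> j = j'"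
  shows "AE g in gauss L. det (mat m m (\<lambda>(i, j). s * g (\<kappa> i j) + \<tau> i j * g z)) \<noteq> 0"
  using assms
proof (induction m arbitrary: \<kappa> \<tau> L)
  case 0
  then show ?case by (simp add: det_def)
next
  case (Suc m)
  let ?X = "\<lambda>g. mat (Suc m) (Suc m) (\<lambda>(i, j). s * g (\<kappa> i j) + \<tau> i j * g z)"
  let ?Y = "\<lambda>g. mat m m (\<lambda>(i, j). s * g (\<kappa> (Suc i) (Suc j)) + \<tau> (Suc i) (Suc j) * g z)"
  define q where "q = \<kappa> 0 0"
  have q: "q \<in> L" "q \<noteq> z" using Suc.prems(4)[of 0 0] by (auto simp: q_def)
  have L: "insert q (L - {q}) = L" using q by auto
  have \<kappa>_neq: "\<kappa> i j \<noteq> q" if "i < Suc m" "j < Suc m" "i \<noteq> 0 \<or> j \<noteq> 0" for i j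
    using Suc.prems(5)[of i j 0 0] that by (auto simp: q_def)
  have IH: "AE g in gauss (L - {q}). det (?Y g) \<noteq> 0"
  proof (rule Suc.IH)
    show "\<kappa> (Suc i) (Suc j) \<in> L - {q} - {z}" if "i < m" "j < m" for i j
      using Suc.prems(4)[of "Suc i" "Suc j"] \<kappa>_neq[of "Suc i" "Suc j"] that by auto
    show "i = i' \<and> j = j'" if "i < m" "j < m" "i' < m" "j' < m" "\<kappa> (Suc i) (Suc j) = \<kappa> (Suc i') (Suc j')" for i j i' j'
      using Suc.prems(5)[of "Suc i" "Suc j" "Suc i'" "Suc j'"] that by simp
  qed (use Suc.prems q in auto)
  have meas: "(\<lambda>g. det (?X g)) \<in> borel_measurable (PiM L (\<lambda>_. borel))"
  proof -
    have "(\<lambda>g. det (?X g)) = (\<lambda>g. \<Sum>p\<in>{p. p permutes {0..<Suc m}}. signof p *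
        (\<Prod>i = 0..<Suc m. s * g (\<kappa> i (p i)) + \<tau> i (p i) * g z))"
    proof
      fix g
      have "det (?X g) = (\<Sum>p\<in>{p. p permutes {0..<Suc m}}. signof p * (\<Prod>i = 0..<Suc m. ?X g $$ (i, p i)))"
        by (rule det_def') simp
      also have "\<dots> = (\<Sum>p\<in>{p. p permutes {0..<Suc m}}. signof p *
        (\<Prod>i = 0..<Suc m. s * g (\<kappa> i (p i)) + \<tau> i (p i) * g z))"
      proof (intro sum.cong refl arg_cong2[where f="(*)"] prod.cong)
        fix p i assume "p \<in> {p. p permutes {0..<Suc m}}" "i \<in> {0..<Suc m}"
        then have "p i < Suc m" "i < Suc m" using permutes_in_image[of p "{0..<Suc m}" i] by auto
        then show "?X g $$ (i, p i) = s * g (\<kappa> i (p i)) + \<tau> i (p i) * g z" by simp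
      qed
      finally show "det (?X g) = (\<Sum>p\<in>{p. p permutes {0..<Suc m}}. signof p *
        (\<Prod>i = 0..<Suc m. s * g (\<kappa> i (p i)) + \<tau> i (p i) * g z))" .
    qed
    also have "\<dots> \<in> borel_measurable (PiM L (\<lambda>_. borel))"
    proof (intro borel_measurable_sum borel_measurable_times borel_measurable_prod borel_measurable_add
        borel_measurable_const measurable_component_singleton)
      fix p i assume "p \<in> {p. p permutes {0..<Suc m}}" "i \<in> {0..<Suc m}"
      then have "p i < Suc m" "i < Suc m" using permutes_in_image[of p "{0..<Suc m}" i] by auto
      then show "\<kappa> i (p i) \<in> L" using Suc.prems(4) by blast
      show "z \<in> L" by (rule Suc.prems(2))
    qed
    finally show ?thesis .
  qed
  have "AE g in PiM (insert q (L - {q})) (\<lambda>_. density lborel std_normal_density). det (?X g) \<noteq> 0"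
  proof (rule gau.AE_PiM_insert)
    have "Measurable.pred (gauss L) (\<lambda>g. det (?X g) \<noteq> 0)"
      using meas by measurable
    then show "Measurable.pred (PiM (insert q (L - {q})) (\<lambda>_. density lborel std_normal_density)) (\<lambda>g. det (?X g) \<noteq> 0)"
      unfolding L gauss_def .
    show "AE x in PiM (L - {q}) (\<lambda>_. density lborel std_normal_density). AE y in density lborel std_normal_density. det (?X (x(q := y))) \<noteq> 0"
      using IH unfolding gauss_def
    proof eventually_elim
      case (elim x)
      \<comment> \<open>Everything in the expansion that does not involve the coordinate
        \<open>q\<close>, including the part of the corner entry that comes from
        \<open>z\<close>.\<close>
      define c where "c = (\<Sum>i\<in>{..<Suc m} - {0}. ?X (x(q := 0)) $$ (i, 0) * cofactor (?X (x(q := 0))) i 0) + \<tau> 0 0 * x z * det (?Y x)"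
      have expand: "det (?X (x(q := y))) = s * y * det (?Y x) + c" for y
      proof -
        have del: "mat_delete (?X (x(q := y))) i 0 = mat_delete (?X (x(q := 0))) i 0" if "i < Suc m" for i
        proof (rule eq_matI)
          fix k l assume "k < dim_row (mat_delete (?X (x(q := 0))) i 0)" "l < dim_col (mat_delete (?X (x(q := 0))) i 0)"
          then have kl: "k < m" "l < m" by (auto simp: mat_delete_def)
          then show "mat_delete (?X (x(q := y))) i 0 $$ (k, l) = mat_delete (?X (x(q := 0))) i 0 $$ (k, l)"
            using \<kappa>_neq[of k "Suc l"] \<kappa>_neq[of "Suc k" "Suc l"] q by (auto simp: mat_delete_def)
        qed (auto simp: mat_delete_def)
        have del0: "mat_delete (?X (x(q := y))) 0 0 = ?Y x"
        proof (rule eq_matI)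
          fix k l assume "k < dim_row (?Y x)" "l < dim_col (?Y x)"
          then have kl: "k < m" "l < m" by auto
          then show "mat_delete (?X (x(q := y))) 0 0 $$ (k, l) = ?Y x $$ (k, l)"
            using \<kappa>_neq[of "Suc k" "Suc l"] q by (auto simp: mat_delete_def)
        qed (auto simp: mat_delete_def)
        have "det (?X (x(q := y))) = (\<Sum>i<Suc m. ?X (x(q := y)) $$ (i, 0) * cofactor (?X (x(q := y))) i 0)"
          by (rule laplace_expansion_column) auto
        also have "\<dots> = ?X (x(q := y)) $$ (0, 0) * cofactor (?X (x(q := y))) 0 0 +
            (\<Sum>i\<in>{..<Suc m} - {0}. ?X (x(q := y)) $$ (i, 0) * cofactor (?X (x(q := y))) i 0)"
          by (subst sum.remove[of _ 0]) auto
        also have "?X (x(q := y)) $$ (0, 0) * cofactor (?X (x(q := y))) 0 0 = (s * y + \<tau> 0 0 * x z) * det (?Y x)"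
          using q del0 by (simp add: cofactor_def q_def[symmetric])
        also have "(\<Sum>i\<in>{..<Suc m} - {0}. ?X (x(q := y)) $$ (i, 0) * cofactor (?X (x(q := y))) i 0)
          = (\<Sum>i\<in>{..<Suc m} - {0}. ?X (x(q := 0)) $$ (i, 0) * cofactor (?X (x(q := 0))) i 0)"
        proof (rule sum.cong[OF refl])
          fix i assume i: "i \<in> {..<Suc m} - {0}"
          then have "?X (x(q := y)) $$ (i, 0) = ?X (x(q := 0)) $$ (i, 0)"
            using \<kappa>_neq[of i 0] q by simp
          then show "?X (x(q := y)) $$ (i, 0) * cofactor (?X (x(q := y))) i 0 = ?X (x(q := 0)) $$ (i, 0) * cofactor (?X (x(q := 0))) i 0"
            using del[of i] i by (simp add: cofactor_def)
        qed
        finally show ?thesis by (simp add: c_def algebra_simps)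
      qed
      have "AE y in lborel. y \<noteq> - c / (s * det (?Y x))"
        by (rule AE_lborel_singleton)
      then have "AE y in lborel. det (?X (x(q := y))) \<noteq> 0"
      proof eventually_elim
        case (elim y)
        show ?case
        proof
          assume "det (?X (x(q := y))) = 0"
          then have "y * (s * det (?Y x)) = - c" using expand[of y] by (simp add: algebra_simps)
          then have "y = - c / (s * det (?Y x))"
            using \<open>det (?Y x) \<noteq> 0\<close> \<open>s \<noteq> 0\<close> by (simp add: field_simps)
          then show False using elim by simp
        qed
      qed
      then show ?case by (subst AE_density) auto
    qed
  qed (use Suc.prems in auto)
  then show ?case unfolding L gauss_def .
qed

lemma mutual_inverses_of_det:
  assumes d: "det (mat (n - 1) (n - 1) (\<lambda>(i, j). A (Suc i) (Suc j))) \<noteq> (0::real)"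
  obtains N where "mutual_inverses {1..<n} A N"
proof -
  let ?X = "mat (n - 1) (n - 1) (\<lambda>(i, j). A (Suc i) (Suc j))"
  have "?X \<in> carrier_mat (n - 1) (n - 1)" by simp
  from det_non_zero_imp_unit[OF this d, of "()"]
  obtain B where B: "B \<in> carrier_mat (n - 1) (n - 1)" "B * ?X = 1\<^sub>m (n - 1)" "?X * B = 1\<^sub>m (n - 1)"
    unfolding Units_def ring_mat_def by auto
  \<comment> \<open>Matrices are indexed from \<open>0\<close>, the coordinates of the chart from
    \<open>1\<close>.\<close>
  define N where "N i j = B $$ (i - 1, j - 1)" for i j
  have J: "sum g {1..<n} = (\<Sum>j<n - 1. g (Suc j))" for g :: "nat \<Rightarrow> real"
  proof -
    have "{1..<n} = Suc ` {..<n - 1}"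
      by (cases n) (simp_all add: lessThan_atLeast0 image_Suc_atLeastLessThan)
    then show ?thesis by (simp add: sum.reindex)
  qed
  have comp: "lin {1..<n} P (lin {1..<n} Q x) i = x i"
    if i: "i \<in> {1..<n}" and PQ: "\<And>a b. a < n - 1 \<Longrightarrow> b < n - 1 \<Longrightarrow> (\<Sum>k<n - 1. P (Suc a) (Suc k) * Q (Suc k) (Suc b)) = of_bool (a = b)"
    for P Q :: "nat \<Rightarrow> nat \<Rightarrow> real" and x i
  proof -
    obtain a where a: "i = Suc a" "a < n - 1" using i by (cases i) auto
    have "lin {1..<n} P (lin {1..<n} Q x) i = (\<Sum>j\<in>{1..<n}. P i j * (\<Sum>k\<in>{1..<n}. Q j k * x k))"
      using i by (simp add: lin_def)
    also have "\<dots> = (\<Sum>j<n - 1. \<Sum>k<n - 1. P i (Suc j) * Q (Suc j) (Suc k) * x (Suc k))"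
      unfolding J by (simp add: sum_distrib_left mult.assoc)
    also have "\<dots> = (\<Sum>k<n - 1. (\<Sum>j<n - 1. P i (Suc j) * Q (Suc j) (Suc k)) * x (Suc k))"
      by (subst sum.swap) (simp add: sum_distrib_right)
    also have "\<dots> = (\<Sum>k<n - 1. of_bool (a = k) * x (Suc k))"
      using PQ a by (intro sum.cong) auto
    also have "\<dots> = x i"
      using a by (simp add: of_bool_def if_distrib[of "\<lambda>a. a * _"] sum.delta cong: if_cong)
    finally show ?thesis .
  qed
  have "(\<Sum>k<n - 1. N (Suc a) (Suc k) * A (Suc k) (Suc b)) = of_bool (a = b)" if "a < n - 1" "b < n - 1" for a b
  proof -
    have "(B * ?X) $$ (a, b) = (\<Sum>k<n - 1. N (Suc a) (Suc k) * A (Suc k) (Suc b))"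
      using that B(1) by (simp add: scalar_prod_def N_def lessThan_atLeast0)
    moreover have "(B * ?X) $$ (a, b) = of_bool (a = b)" unfolding B(2) using that by simp
    ultimately show ?thesis by (rule trans[OF sym])
  qed
  moreover have "(\<Sum>k<n - 1. A (Suc a) (Suc k) * N (Suc k) (Suc b)) = of_bool (a = b)" if "a < n - 1" "b < n - 1" for a b
  proof -
    have "(?X * B) $$ (a, b) = (\<Sum>k<n - 1. A (Suc a) (Suc k) * N (Suc k) (Suc b))"
      using that B(1) by (simp add: scalar_prod_def N_def lessThan_atLeast0)
    moreover have "(?X * B) $$ (a, b) = of_bool (a = b)" unfolding B(3) using that by simp
    ultimately show ?thesis by (rule trans[OF sym])
  qed
  ultimately have "mutual_inverses {1..<n} A N"
    unfolding mutual_inverses_def by (intro allI ballI conjI comp) auto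
  then show ?thesis by (rule that)
qed

text \<open>A zero row put in as row \<open>0\<close> turns the \<open>n - 1\<close> equations into
  a square system with determinant \<open>0\<close>.\<close>

lemma kernel_vector_exists:
  fixes C :: "nat \<Rightarrow> nat \<Rightarrow> real"
  assumes "0 < n"
  obtains v where "v \<in> rvec n" "ip n v v = 1" "\<And>i. i \<in> {1..<n} \<Longrightarrow> (\<Sum>j<n. C i j * v j) = 0"
proof -
  let ?X = "mat n n (\<lambda>(i, j). if i = 0 then 0 else C i j)"
  have X: "?X \<in> carrier_mat n n" by simp
  have "det ?X = (\<Sum>j<n. ?X $$ (0, j) * cofactor ?X 0 j)"
    using assms by (intro laplace_expansion_row[OF X])
  also have "\<dots> = 0" using assms by (intro sum.neutral) auto
  finally obtain x where x: "x \<in> carrier_vec n" "x \<noteq> 0\<^sub>v n" "?X *\<^sub>v x = 0\<^sub>v n"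
    using det_0_iff_vec_prod_zero[OF X] by auto
  define y where "y i = (if i < n then vec_index x i else 0)" for i
  obtain i where i: "i < n" "y i \<noteq> 0"
    using x(1,2) by (auto simp: y_def vec_eq_iff)
  have "y i * y i \<le> ip n y y"
    unfolding ip_def using i by (intro member_le_sum) auto
  then have pos: "0 < ip n y y" using i(2) by (smt (verit) not_real_square_gt_zero)
  have ker: "(\<Sum>j<n. C i j * y j) = 0" if "i \<in> {1..<n}" for i
  proof -
    have "vec_index (?X *\<^sub>v x) i = (\<Sum>j<n. C i j * y j)"
      using that x(1) by (auto simp: scalar_prod_def y_def lessThan_atLeast0 intro!: sum.cong)
    then show ?thesis using x(3) that by simp
  qed
  let ?v = "\<lambda>i. (1 / sqrt (ip n y y)) * y i"
  show ?thesis
  proof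
    show "?v \<in> rvec n" by (auto simp: rvec_def y_def)
    show "ip n ?v ?v = 1"
      unfolding ip_scale_left ip_scale_right using pos by simp
    show "(\<Sum>j<n. C i j * ?v j) = 0" if "i \<in> {1..<n}" for i
      using ker[OF that] by (simp add: sum_divide_distrib[symmetric])
  qed
qed

lemma distr_gauss_orth:
  assumes "finite I" "sym_orth I U"
  shows "lin I U \<in> gauss I \<rightarrow>\<^sub>M gauss I" "distr (gauss I) (gauss I) (lin I U) = gauss I"
proof -
  show m: "lin I U \<in> gauss I \<rightarrow>\<^sub>M gauss I" by measurable
  show "distr (gauss I) (gauss I) (lin I U) = gauss I"
  proof (rule measure_eqI)
    fix S assume "S \<in> sets (distr (gauss I) (gauss I) (lin I U))"
    then have S: "S \<in> sets (gauss I)" by simp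
    then have [measurable]: "S \<in> sets (PiM I (\<lambda>_. borel))" by (simp add: sets_gauss)
    have "emeasure (distr (gauss I) (gauss I) (lin I U)) S = (\<integral>\<^sup>+x. indicator S x \<partial>distr (gauss I) (gauss I) (lin I U))"
      using S by simp
    also have "\<dots> = (\<integral>\<^sup>+x. indicator S (lin I U x) \<partial>gauss I)"
      using m S by (intro nn_integral_distr) auto
    also have "\<dots> = (\<integral>\<^sup>+x. indicator S x \<partial>gauss I)"
      by (rule nn_integral_gauss_orth[OF assms]) measurable
    finally show "emeasure (distr (gauss I) (gauss I) (lin I U)) S = emeasure (gauss I) S"
      using S by simp
  qed simp
qed

section \<open>Moments of Gaussian sums\<close>

lemma std_normal_moment_finite:
  "(\<integral>\<^sup>+x. ennreal ((1 + \<bar>x\<bar>) ^ m) \<partial>density lborel std_normal_density) < \<infinity>"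
proof -
  have le: "(1 + \<bar>x\<bar>) ^ m \<le> 2 ^ m * (1 + \<bar>x\<bar> ^ m)" for x :: real
  proof (cases "\<bar>x\<bar> \<le> 1")
    case True
    then have "(1 + \<bar>x\<bar>) ^ m \<le> 2 ^ m" by (intro power_mono) auto
    also have "\<dots> \<le> 2 ^ m * (1 + \<bar>x\<bar> ^ m)" by simp
    finally show ?thesis .
  next
    case False
    then have "(1 + \<bar>x\<bar>) ^ m \<le> (2 * \<bar>x\<bar>) ^ m" by (intro power_mono) auto
    moreover have "0 \<le> (2::real) ^ m" by simp
    ultimately show ?thesis unfolding power_mult_distrib distrib_left by linarith
  qed
  have int: "integrable lborel (\<lambda>x. 2 ^ m * (std_normal_density x * \<bar>x\<bar> ^ 0 + std_normal_density x * \<bar>x\<bar> ^ m))"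
    by (intro integrable_mult_right Bochner_Integration.integrable_add integrable_std_normal_moment_abs)
  have "(\<integral>\<^sup>+x. ennreal ((1 + \<bar>x\<bar>) ^ m) \<partial>density lborel std_normal_density)
      = (\<integral>\<^sup>+x. ennreal (std_normal_density x) * ennreal ((1 + \<bar>x\<bar>) ^ m) \<partial>lborel)"
    by (subst nn_integral_density) auto
  also have "\<dots> \<le> (\<integral>\<^sup>+x. ennreal (2 ^ m * (std_normal_density x * \<bar>x\<bar> ^ 0 + std_normal_density x * \<bar>x\<bar> ^ m)) \<partial>lborel)"
  proof (rule nn_integral_mono)
    fix x :: real
    have "std_normal_density x * (1 + \<bar>x\<bar>) ^ m \<le> std_normal_density x * (2 ^ m * (1 + \<bar>x\<bar> ^ m))"
      using le[of x] by (intro mult_left_mono) auto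
    also have "\<dots> = 2 ^ m * (std_normal_density x * \<bar>x\<bar> ^ 0 + std_normal_density x * \<bar>x\<bar> ^ m)"
      by (simp add: algebra_simps)
    finally have "ennreal (std_normal_density x * (1 + \<bar>x\<bar>) ^ m)
        \<le> ennreal (2 ^ m * (std_normal_density x * \<bar>x\<bar> ^ 0 + std_normal_density x * \<bar>x\<bar> ^ m))"
      by (rule ennreal_leI)
    then show "ennreal (std_normal_density x) * ennreal ((1 + \<bar>x\<bar>) ^ m) \<le> ennreal (2 ^ m * (std_normal_density x * \<bar>x\<bar> ^ 0 + std_normal_density x * \<bar>x\<bar> ^ m))"
      by (simp only: ennreal_mult'[OF normal_density_nonneg])
  qed
  also have "\<dots> < \<infinity>"
    using int by (subst nn_integral_eq_integral) (auto intro!: AE_I2 add_nonneg_nonneg)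
  finally show ?thesis .
qed

text \<open>The sum is at most the product of the factors \<open>1 + \<bar>w k\<bar>\<close>, and
  the expectation of a power of this product factorises over the coordinates.\<close>

lemma gauss_abs_sum_moment_finite:
  assumes "finite K" "0 \<le> c"
  shows "(\<integral>\<^sup>+w. ennreal ((c * (\<Sum>k\<in>K. \<bar>w k\<bar>)) ^ m) \<partial>gauss K) < \<infinity>"
proof -
  have le: "(\<Sum>k\<in>K. \<bar>w k\<bar>) \<le> (\<Prod>k\<in>K. 1 + \<bar>w k\<bar>)" for w :: "'a \<Rightarrow> real"
    using assms(1) by (intro sum_le_prod) auto
  have "(\<integral>\<^sup>+w. ennreal ((c * (\<Sum>k\<in>K. \<bar>w k\<bar>)) ^ m) \<partial>gauss K)
      \<le> (\<integral>\<^sup>+w. ennreal (c ^ m) * (\<Prod>k\<in>K. ennreal ((1 + \<bar>w k\<bar>) ^ m)) \<partial>gauss K)"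
  proof (rule nn_integral_mono)
    fix w :: "'a \<Rightarrow> real"
    have "(c * (\<Sum>k\<in>K. \<bar>w k\<bar>)) ^ m \<le> (c * (\<Prod>k\<in>K. 1 + \<bar>w k\<bar>)) ^ m"
      using le assms by (intro power_mono mult_left_mono) (auto intro: sum_nonneg)
    also have "\<dots> = c ^ m * (\<Prod>k\<in>K. (1 + \<bar>w k\<bar>) ^ m)"
      by (simp add: power_mult_distrib prod_power_distrib)
    finally have "ennreal ((c * (\<Sum>k\<in>K. \<bar>w k\<bar>)) ^ m) \<le> ennreal (c ^ m * (\<Prod>k\<in>K. (1 + \<bar>w k\<bar>) ^ m))"
      by (rule ennreal_leI)
    also have "\<dots> = ennreal (c ^ m) * (\<Prod>k\<in>K. ennreal ((1 + \<bar>w k\<bar>) ^ m))"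
      using assms by (subst ennreal_mult) (auto simp: prod_ennreal prod_nonneg)
    finally show "ennreal ((c * (\<Sum>k\<in>K. \<bar>w k\<bar>)) ^ m) \<le> \<dots>" .
  qed
  also have "\<dots> = ennreal (c ^ m) * (\<integral>\<^sup>+w. (\<Prod>k\<in>K. ennreal ((1 + \<bar>w k\<bar>) ^ m)) \<partial>gauss K)"
    by (rule nn_integral_cmult) measurable
  also have "(\<integral>\<^sup>+w. (\<Prod>k\<in>K. ennreal ((1 + \<bar>w k\<bar>) ^ m)) \<partial>gauss K)
      = (\<Prod>k\<in>K. \<integral>\<^sup>+x. ennreal ((1 + \<bar>x\<bar>) ^ m) \<partial>density lborel std_normal_density)"
    unfolding gauss_def using assms by (intro gau.product_nn_integral_prod) auto
  also have "ennreal (c ^ m) * \<dots> < \<infinity>"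
    using std_normal_moment_finite[of m]
    by (auto simp: ennreal_mult_less_top power_less_top_ennreal)
  finally show ?thesis .
qed

text \<open>This cone almost surely consists of a single line; comparing it with the eigenvector cone
  makes the computation of the constants in the limit unnecessary.\<close>

definition linear_cone :: "nat \<Rightarrow> (nat \<times> nat \<Rightarrow> real) \<Rightarrow> (nat \<Rightarrow> real) \<Rightarrow> real" where
  "linear_cone n C v = (\<Sum>i\<in>{1..<n}. \<bar>\<Sum>j<n. C (i, j) * v j\<bar>)"

lemma linear_cone_eq_0: "linear_cone n C v = 0 \<longleftrightarrow> (\<forall>i\<in>{1..<n}. (\<Sum>j<n. C (i, j) * v j) = 0)"
  unfolding linear_cone_def by (subst sum_nonneg_eq_0_iff) auto

section \<open>The solution line of a Gaussian linear system\<close>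

text \<open>A reflection applied to every row of the coefficient matrix acts on the family of all
  coefficients by the block matrix \<open>Q\<close>, which is again symmetric orthogonal and hence
  preserves the Gaussian law.\<close>

lemma random_cone_linear:
  assumes n: "0 < n"
  shows "random_cone (gauss ({1..<n} \<times> {..<n})) n (linear_cone n)"
proof (intro random_cone.intro prob_space_gauss random_cone_axioms.intro n)
  let ?K = "{1..<n} \<times> {..<n}"
  show "(\<lambda>w. linear_cone n w v) \<in> borel_measurable (gauss ?K)" for v
    unfolding linear_cone_def
    by (intro borel_measurable_sum borel_measurable_abs borel_measurable_times borel_measurable_const)
       (auto simp: measurable_cong_sets[OF sets_gauss refl] intro!: measurable_component_singleton)
  show "continuous_on UNIV (linear_cone n w)" for w
    unfolding linear_cone_def[abs_def] by (intro continuous_intros)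
  show "linear_cone n w v = linear_cone n w v'" if "\<And>i. i < n \<Longrightarrow> v i = v' i" for w v v'
    using that by (simp add: linear_cone_def)
  show "linear_cone n w (\<lambda>i. c * v i) = 0" if "linear_cone n w v = 0" for w v c
  proof -
    have "(\<Sum>j<n. w (i, j) * (c * v j)) = c * (\<Sum>j<n. w (i, j) * v j)" for i
      by (simp add: sum_distrib_left mult_ac)
    then show ?thesis using that unfolding linear_cone_eq_0 by simp
  qed
  fix U assume U: "sym_orth {..<n} U"
  define Q where "Q p q = of_bool (fst p = fst q) * U (snd p) (snd q)" for p q :: "nat \<times> nat"
  have sumK: "(\<Sum>q\<in>?K. of_bool (i = fst q) * F (fst q) (snd q)) = (\<Sum>j<n. F i j)" if "i \<in> {1..<n}" for i and F :: "nat \<Rightarrow> nat \<Rightarrow> real"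
  proof -
    have "(\<Sum>q\<in>?K. of_bool (i = fst q) * F (fst q) (snd q)) = (\<Sum>i'\<in>{1..<n}. \<Sum>j<n. of_bool (i = i') * F i' j)"
      unfolding sum.cartesian_product by (simp only: case_prod_unfold)
    also have "\<dots> = (\<Sum>i'\<in>{1..<n}. if i' = i then (\<Sum>j<n. F i j) else 0)"
      by (intro sum.cong) auto
    finally show ?thesis using that by simp
  qed
  have Q: "sym_orth ?K Q"
    unfolding sym_orth_def
  proof (intro ballI conjI)
    fix p q assume pq: "p \<in> ?K" "q \<in> ?K"
    show "Q p q = Q q p" using U pq by (auto simp: Q_def sym_orth_def)
    have "(\<Sum>k\<in>?K. Q p k * Q k q) = (\<Sum>k\<in>?K. of_bool (fst p = fst k) * (of_bool (fst k = fst q) * (U (snd p) (snd k) * U (snd k) (snd q))))"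
      by (intro sum.cong) (auto simp: Q_def)
    also have "\<dots> = (\<Sum>j<n. of_bool (fst p = fst q) * (U (snd p) j * U j (snd q)))"
      using pq by (intro sumK[of "fst p" "\<lambda>i j. of_bool (i = fst q) * (U (snd p) j * U j (snd q))"]) auto
    also have "\<dots> = of_bool (fst p = fst q) * of_bool (snd p = snd q)"
    proof -
      have "snd p \<in> {..<n}" "snd q \<in> {..<n}" using pq by auto
      then have "(\<Sum>j<n. U (snd p) j * U j (snd q)) = of_bool (snd p = snd q)"
        using U unfolding sym_orth_def by blast
      then show ?thesis by (simp only: sum_distrib_left[symmetric])
    qed
    finally show "(\<Sum>k\<in>?K. Q p k * Q k q) = of_bool (p = q)" by (auto simp: prod_eq_iff)
  qed
  have "linear_cone n (lin ?K Q w) v = 0 \<longleftrightarrow> linear_cone n w (lin {..<n} U v) = 0" for w v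
  proof -
    have "(\<Sum>j<n. lin ?K Q w (i, j) * v j) = (\<Sum>j<n. w (i, j) * lin {..<n} U v j)" if i: "i \<in> {1..<n}" for i
    proof -
      have "lin ?K Q w (i, j) = lin {..<n} U (\<lambda>j. w (i, j)) j" if "j < n" for j
        using that i sumK[OF i, of "\<lambda>i' j'. U j j' * w (i', j')"] by (simp add: lin_def Q_def mult.assoc)
      then have "(\<Sum>j<n. lin ?K Q w (i, j) * v j) = (\<Sum>j<n. lin {..<n} U (\<lambda>j. w (i, j)) j * v j)" by simp
      also have "\<dots> = (\<Sum>j<n. w (i, j) * lin {..<n} U v j)"
        by (rule inner_lin[OF finite_lessThan U])
      finally show ?thesis .
    qed
    then show ?thesis by (simp add: linear_cone_eq_0)
  qed
  then show "\<exists>T\<in>gauss ?K \<rightarrow>\<^sub>M gauss ?K. distr (gauss ?K) (gauss ?K) T = gauss ?K \<and>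
      (\<forall>w\<in>space (gauss ?K). \<forall>v. linear_cone n (T w) v = 0 \<longleftrightarrow> linear_cone n w (lin {..<n} U v) = 0)"
    using distr_gauss_orth[OF _ Q] by (intro bexI[of _ "lin ?K Q"]) auto
qed

lemma AE_linear_inverse:
  fixes n :: nat
  assumes n: "1 < n"
  shows "AE w in gauss ({1..<n} \<times> {..<n}). \<exists>N. mutual_inverses {1..<n} (\<lambda>i j. - w (i, j)) N"
proof -
  let ?K = "{1..<n} \<times> {..<n}"
  have "AE w in gauss ?K. det (mat (n - 1) (n - 1) (\<lambda>(i, j). - 1 * w (Suc i, Suc j) + 0 * w (1, 0))) \<noteq> 0"
    using n by (intro AE_gauss_det_nonzero[of ?K "(1, 0)" "- 1" "n - 1" "\<lambda>i j. (Suc i, Suc j)" "\<lambda>_ _. 0"]) auto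
  then show ?thesis
  proof eventually_elim
    case (elim w)
    then show ?case
      using mutual_inverses_of_det[of n "\<lambda>i j. - w (i, j)"] by (simp, blast)
  qed
qed

text \<open>As the minor without column \<open>0\<close> is invertible, a kernel vector whose
  coordinate \<open>0\<close> vanishes is zero. So kernel vectors are determined by their coordinate
  \<open>0\<close>, and the kernel is a line.\<close>

lemma linear_cone_line_reps:
  assumes n: "1 < n" and inv: "mutual_inverses {1..<n} (\<lambda>i j. - w (i, j)) N"
  shows "\<exists>R. line_reps n (\<lambda>v. linear_cone n w v = 0) R \<and> 1 = ecard R"
proof -
  obtain z where z: "z \<in> rvec n" "ip n z z = 1" "\<And>i. i \<in> {1..<n} \<Longrightarrow> (\<Sum>j<n. w (i, j) * z j) = 0"
    using kernel_vector_exists[of n "\<lambda>i j. w (i, j)"] n by auto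
  have zero: "v = (\<lambda>_. 0)" if v: "v \<in> rvec n" "v 0 = 0" "linear_cone n w v = 0" for v
  proof
    fix i
    have "lin {1..<n} (\<lambda>i j. - w (i, j)) v i = 0" if "i \<in> {1..<n}" for i
      using v(2,3) n that by (simp add: lin_def linear_cone_eq_0 sum_lessThan_split0 sum_negf)
    then have "lin {1..<n} N (lin {1..<n} (\<lambda>i j. - w (i, j)) v) i = 0" if "i \<in> {1..<n}"
      using that by (simp add: lin_def[of _ N])
    moreover have "i \<in> {1..<n} \<or> i = 0 \<or> n \<le> i" by auto
    ultimately show "v i = 0" using inv v by (auto simp: mutual_inverses_def rvec_def)
  qed
  have z_cone: "linear_cone n w z = 0" using z(3) by (simp add: linear_cone_eq_0)
  have z0: "z 0 \<noteq> 0" using zero[OF z(1) _ z_cone] z(2) by (auto simp: ip_def)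
  have "line_reps n (\<lambda>v. linear_cone n w v = 0) {z}"
    unfolding line_reps_def
  proof (intro conjI ballI impI)
    fix v assume v: "v \<in> rvec n" "ip n v v = 1" "linear_cone n w v = 0"
    define t where "t = v 0 / z 0"
    have "(\<lambda>i. v i - t * z i) = (\<lambda>_. 0)"
    proof (rule zero)
      show "(\<lambda>i. v i - t * z i) \<in> rvec n" using v z by (auto simp: rvec_def)
      show "v 0 - t * z 0 = 0" using z0 by (simp add: t_def)
      have "(\<Sum>j<n. w (i, j) * (v j - t * z j)) = (\<Sum>j<n. w (i, j) * v j) - t * (\<Sum>j<n. w (i, j) * z j)" for i
        by (simp add: right_diff_distrib sum_subtractf sum_distrib_left mult_ac)
      then show "linear_cone n w (\<lambda>i. v i - t * z i) = 0"
        using v(3) z(3) by (simp add: linear_cone_eq_0)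
    qed
    then have vt: "v = (\<lambda>i. t * z i)" by (auto simp: fun_eq_iff)
    then have "t * t = 1" using v(2) z(2) by (simp add: ip_scale_left ip_scale_right)
    then have "t = 1 \<or> t = - 1" by (simp add: square_eq_1_iff)
    then show "v \<in> {z} \<or> (\<lambda>i. - v i) \<in> {z}" using vt by auto
  qed (use z z_cone in auto)
  then show ?thesis by (intro exI[of _ "{z}"]) (simp add: ecard_def)
qed

text \<open>Column \<open>0\<close> holds the constant terms. Moving the other columns to the
  right-hand side yields the minus sign, and linearity leaves no remainder.\<close>

lemma gauss_cone_linear:
  assumes n: "1 < n"
  shows "gauss_cone ({1..<n} \<times> {..<n}) n (linear_cone n) (\<lambda>i. (i, 0)) (\<lambda>w i j. - w (i, j)) (\<lambda>_ _ _ _. 0)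
    (\<lambda>w. \<Sum>k\<in>{1..<n} \<times> {..<n}. \<bar>w k\<bar>)"
proof -
  let ?K = "{1..<n} \<times> {..<n}" and ?J = "{1..<n}"
  show ?thesis
  proof (intro gauss_cone.intro random_cone_linear gauss_cone_axioms.intro n AE_linear_inverse)
    fix w a r u assume "(0::real) < r" "u \<in> ball0 n"
    have "(\<Sum>j<n. overwrite ?K (\<lambda>i. (i, 0)) ?J w a (i, j) * chart r u j) = a i - r * lin ?J (\<lambda>i j. - w (i, j)) u i"
      if i: "i \<in> ?J" for i
    proof -
      have inj: "inj_on (\<lambda>i::nat. (i, 0::nat)) ?J" by (auto simp: inj_on_def)
      have "overwrite ?K (\<lambda>i. (i, 0)) ?J w a (i, 0) = a i"
        using i n the_inv_into_f_f[OF inj i] by (auto simp: overwrite_def)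
      moreover have "overwrite ?K (\<lambda>i. (i, 0)) ?J w a (i, j) = w (i, j)" if "j \<in> ?J" for j
        using i that by (auto simp: overwrite_def)
      then have "(\<Sum>j\<in>?J. overwrite ?K (\<lambda>i. (i, 0)) ?J w a (i, j) * chart r u j) = (\<Sum>j\<in>?J. r * (w (i, j) * u j))"
        by (intro sum.cong refl) (auto simp: chart_def)
      ultimately show ?thesis
        using n i by (simp add: sum_lessThan_split0 lin_def sum_distrib_left[symmetric] sum_negf) (simp add: chart_def)
    qed
    then show "linear_cone n (overwrite ?K (\<lambda>i. (i, 0)) ?J w a) (chart r u) = 0 \<longleftrightarrow>
        (\<forall>i\<in>?J. a i = r * (lin ?J (\<lambda>i j. - w (i, j)) u i + 0))"
      unfolding linear_cone_eq_0 by simp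
  next
    fix i j assume "i \<in> ?J" "j \<in> ?J"
    then show "(\<lambda>w. - w (i, j)) \<in> borel_measurable (gauss ?K)"
      by (intro borel_measurable_uminus) (auto simp: measurable_cong_sets[OF sets_gauss refl] intro!: measurable_component_singleton)
  next
    show "(\<lambda>w. \<Sum>k\<in>?K. \<bar>w k\<bar>) \<in> borel_measurable (gauss ?K)" by measurable
  next
    fix w u i assume u: "u \<in> ball0 n" and i: "i \<in> ?J"
    have "\<bar>lin ?J (\<lambda>i j. - w (i, j)) u i\<bar> \<le> (\<Sum>j\<in>?J. \<bar>- w (i, j)\<bar>) * 1"
      using i by (intro abs_lin_le ball0_coord[OF u]) auto
    also have "\<dots> = (\<Sum>k\<in>Pair i ` ?J. \<bar>w k\<bar>)"
      by (subst sum.reindex) (auto simp: inj_on_def)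
    also have "\<dots> \<le> (\<Sum>k\<in>?K. \<bar>w k\<bar>)"
      using i by (intro sum_mono2) auto
    finally show "\<bar>lin ?J (\<lambda>i j. - w (i, j)) u i + 0\<bar> \<le> (\<Sum>k\<in>?K. \<bar>w k\<bar>)" by simp
  next
    show "(\<integral>\<^sup>+w. ennreal ((2 * (\<Sum>k\<in>?K. \<bar>w k\<bar>)) ^ (n - 1)) \<partial>gauss ?K) < \<infinity>"
      by (rule gauss_abs_sum_moment_finite) auto
  qed (use n in \<open>auto simp: inj_on_def intro!: exI[of _ 0]\<close>)
qed

section \<open>The cone of eigenvectors\<close>

text \<open>Index functions in \<open>tidx n d\<close> are \<open>0\<close> beyond \<open>d\<close>,
  those in \<open>PiE\<close> are \<open>undefined\<close> there; the bijection transfers the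
  exchange of sums and products to \<open>tidx n d\<close>.\<close>

lemma tidx_bij:
  "bij_betw (\<lambda>j. restrict j {..d}) (tidx n d) (PiE {..d} (\<lambda>_. {..<n}))"
proof (rule bij_betw_byWitness[where f'="\<lambda>j k. if k \<le> d then j k else 0"])
  show "\<forall>j\<in>tidx n d. (\<lambda>k. if k \<le> d then restrict j {..d} k else 0) = j"
    by (auto simp: tidx_def fun_eq_iff)
  show "\<forall>j\<in>PiE {..d} (\<lambda>_. {..<n}). restrict (\<lambda>k. if k \<le> d then j k else 0) {..d} = j"
    by (auto simp: PiE_iff extensional_def fun_eq_iff)
  show "(\<lambda>j. restrict j {..d}) ` tidx n d \<subseteq> PiE {..d} (\<lambda>_. {..<n})"
    by (rule image_subsetI) (simp add: tidx_def PiE_iff)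
  show "(\<lambda>j k. if k \<le> d then j k else 0) ` PiE {..d} (\<lambda>_. {..<n}) \<subseteq> tidx n d"
    by (rule image_subsetI) (simp add: tidx_def PiE_iff)
qed

lemma finite_tidx [simp]: "finite (tidx n d)"
  using bij_betw_finite[OF tidx_bij, of n d] by (simp add: finite_PiE)

lemma sum_prod_tidx:
  fixes g :: "nat \<Rightarrow> nat \<Rightarrow> real"
  shows "(\<Sum>j\<in>tidx n d. \<Prod>k\<le>d. g k (j k)) = (\<Prod>k\<le>d. \<Sum>a<n. g k a)"
proof -
  have "(\<Sum>j\<in>tidx n d. \<Prod>k\<le>d. g k (j k)) = (\<Sum>j\<in>tidx n d. \<Prod>k\<le>d. g k (restrict j {..d} k))"
    by (intro sum.cong prod.cong) auto
  also have "\<dots> = (\<Sum>j\<in>PiE {..d} (\<lambda>_. {..<n}). \<Prod>k\<le>d. g k (j k))"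
    by (rule sum.reindex_bij_betw[OF tidx_bij])
  also have "\<dots> = (\<Prod>k\<le>d. \<Sum>a<n. g k a)"
    by (rule prod_sum_PiE[symmetric]) auto
  finally show ?thesis .
qed

lemma prod_atMost_split0: "(\<Prod>k\<le>d. g k) = g 0 * (\<Prod>k\<in>{1..d}. g k :: real)" for d :: nat
  by (simp add: atMost_atLeast0 prod.atLeast_Suc_atMost)

lemma tapply_cong:
  assumes "\<And>i. i < n \<Longrightarrow> v i = v' i"
  shows "tapply n d A v i = tapply n d A v' i"
  unfolding tapply_def
  by (intro sum.cong refl arg_cong2[where f="(*)"] prod.cong) (use assms in \<open>auto simp: tidx_def\<close>)

lemma tapply_scale: "tapply n d A (\<lambda>i. c * v i) i = c ^ d * tapply n d A v i"
  by (simp add: tapply_def prod.distrib sum_distrib_left mult_ac)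

text \<open>The Kronecker power of \<open>U\<close> with \<open>d + 1\<close> factors, which acts on
  all indices of a tensor at once.\<close>

definition tensor_mat :: "nat \<Rightarrow> (nat \<Rightarrow> nat \<Rightarrow> real) \<Rightarrow> (nat \<Rightarrow> nat) \<Rightarrow> (nat \<Rightarrow> nat) \<Rightarrow> real" where
  "tensor_mat d U j l = (\<Prod>k\<le>d. U (j k) (l k))"

lemma sym_orth_tensor_mat:
  assumes U: "sym_orth {..<n} U"
  shows "sym_orth (tidx n d) (tensor_mat d U)"
  unfolding sym_orth_def
proof (intro ballI conjI)
  fix j l assume jl: "j \<in> tidx n d" "l \<in> tidx n d"
  then have lt: "j k < n" "l k < n" if "k \<le> d" for k using that by (auto simp: tidx_def)
  have Us: "U a b = U b a" "(\<Sum>c<n. U a c * U c b) = of_bool (a = b)" if "a < n" "b < n" for a b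
    using U that unfolding sym_orth_def by blast+
  show "tensor_mat d U j l = tensor_mat d U l j"
    unfolding tensor_mat_def by (intro prod.cong refl Us lt) auto
  have "(\<Sum>k\<in>tidx n d. tensor_mat d U j k * tensor_mat d U k l) = (\<Sum>k\<in>tidx n d. \<Prod>s\<le>d. U (j s) (k s) * U (k s) (l s))"
    by (simp add: tensor_mat_def prod.distrib)
  also have "\<dots> = (\<Prod>s\<le>d. \<Sum>a<n. U (j s) a * U a (l s))"
    by (rule sum_prod_tidx)
  also have "\<dots> = (\<Prod>s\<le>d. of_bool (j s = l s))"
    by (intro prod.cong refl Us lt) auto
  also have "\<dots> = of_bool (j = l)"
  proof (cases "j = l")
    case False
    then obtain s where "j s \<noteq> l s" by auto
    moreover from this have "s \<le> d" using jl by (auto simp: tidx_def) (metis not_le)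
    ultimately have "(\<Prod>s\<le>d. of_bool (j s = l s)) = (0::real)" by (intro prod_zero) auto
    then show ?thesis using False by simp
  qed simp
  finally show "(\<Sum>k\<in>tidx n d. tensor_mat d U j k * tensor_mat d U k l) = of_bool (j = l)" .
qed

text \<open>Equivariance: rotating all indices of the tensor amounts to rotating the argument and
  the result. Symmetry of \<open>U\<close> lets it move from the tensor to the vector, separately at
  each index position.\<close>

lemma tapply_tensor_mat:
  assumes U: "sym_orth {..<n} U" and i: "i < n"
  shows "tapply n d (lin (tidx n d) (tensor_mat d U) A) v i = lin {..<n} U (tapply n d A (lin {..<n} U v)) i"
proof -
  let ?K = "tidx n d"
  have Usym: "U a b = U b a" if "a < n" "b < n" for a b
    using U that unfolding sym_orth_def by blast
  have inner: "(\<Sum>j\<in>?K. of_bool (j 0 = i) * tensor_mat d U j l * (\<Prod>k\<in>{1..d}. v (j k)))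
      = U i (l 0) * (\<Prod>k\<in>{1..d}. lin {..<n} U v (l k))" if l: "l \<in> ?K" for l
  proof -
    have lt: "l k < n" if "k \<le> d" for k using l that by (auto simp: tidx_def)
    \<comment> \<open>Factors by index position: position \<open>0\<close> is pinned to
      \<open>i\<close>, every other position carries one factor of \<open>v\<close>. The sum over
      multi-indices thereby becomes a product of sums.\<close>
    define g where "g k a = (if k = 0 then of_bool (a = i) * U a (l 0) else U a (l k) * v a)" for k a
    have "(\<Sum>j\<in>?K. of_bool (j 0 = i) * tensor_mat d U j l * (\<Prod>k\<in>{1..d}. v (j k))) = (\<Sum>j\<in>?K. \<Prod>k\<le>d. g k (j k))"
    proof (rule sum.cong[OF refl])
      fix j
      have "(\<Prod>k\<in>{1..d}. g k (j k)) = (\<Prod>k\<in>{1..d}. U (j k) (l k) * v (j k))"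
        by (intro prod.cong refl) (auto simp: g_def)
      then have "(\<Prod>k\<le>d. g k (j k)) = of_bool (j 0 = i) * U (j 0) (l 0) * (\<Prod>k\<in>{1..d}. U (j k) (l k) * v (j k))"
        unfolding prod_atMost_split0 by (simp add: g_def)
      then show "of_bool (j 0 = i) * tensor_mat d U j l * (\<Prod>k\<in>{1..d}. v (j k)) = (\<Prod>k\<le>d. g k (j k))"
        unfolding tensor_mat_def prod_atMost_split0 by (simp add: prod.distrib mult_ac)
    qed
    also have "\<dots> = (\<Prod>k\<le>d. \<Sum>a<n. g k a)" by (rule sum_prod_tidx)
    also have "\<dots> = (\<Sum>a<n. g 0 a) * (\<Prod>k\<in>{1..d}. \<Sum>a<n. g k a)" by (rule prod_atMost_split0)
    also have "(\<Sum>a<n. g 0 a) = U i (l 0)"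
      using i by (simp add: g_def of_bool_def if_distrib[of "\<lambda>a. a * _"] sum.delta cong: if_cong)
    also have "(\<Prod>k\<in>{1..d}. \<Sum>a<n. g k a) = (\<Prod>k\<in>{1..d}. lin {..<n} U v (l k))"
    proof (rule prod.cong[OF refl])
      fix k assume k: "k \<in> {1..d}"
      then have "(\<Sum>a<n. g k a) = (\<Sum>a<n. U (l k) a * v a)"
        by (intro sum.cong refl) (use lt[of k] Usym in \<open>auto simp: g_def\<close>)
      then show "(\<Sum>a<n. g k a) = lin {..<n} U v (l k)"
        using lt[of k] k by (simp add: lin_def)
    qed
    finally show ?thesis .
  qed
  have tap: "tapply n d B v i = (\<Sum>j\<in>?K. of_bool (j 0 = i) * (B j * (\<Prod>k\<in>{1..d}. v (j k))))" for B v i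
    unfolding tapply_def by (subst sum.inter_filter[OF finite_tidx]) (intro sum.cong refl, auto)
  have "tapply n d (lin ?K (tensor_mat d U) A) v i
      = (\<Sum>j\<in>?K. of_bool (j 0 = i) * ((\<Sum>l\<in>?K. tensor_mat d U j l * A l) * (\<Prod>k\<in>{1..d}. v (j k))))"
    unfolding tap by (intro sum.cong refl) (auto simp: lin_def)
  also have "\<dots> = (\<Sum>j\<in>?K. \<Sum>l\<in>?K. A l * (of_bool (j 0 = i) * tensor_mat d U j l * (\<Prod>k\<in>{1..d}. v (j k))))"
    by (intro sum.cong refl) (simp add: sum_distrib_left sum_distrib_right mult_ac)
  also have "\<dots> = (\<Sum>l\<in>?K. A l * (\<Sum>j\<in>?K. of_bool (j 0 = i) * tensor_mat d U j l * (\<Prod>k\<in>{1..d}. v (j k))))"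
    by (subst sum.swap) (simp add: sum_distrib_left)
  also have "\<dots> = (\<Sum>l\<in>?K. A l * (U i (l 0) * (\<Prod>k\<in>{1..d}. lin {..<n} U v (l k))))"
    by (intro sum.cong refl) (simp only: inner)
  also have "\<dots> = (\<Sum>l\<in>?K. \<Sum>b<n. U i b * (of_bool (l 0 = b) * (A l * (\<Prod>k\<in>{1..d}. lin {..<n} U v (l k)))))"
  proof (rule sum.cong[OF refl])
    fix l assume "l \<in> ?K"
    then have l0: "l 0 < n" by (auto simp: tidx_def)
    have "(\<Sum>b<n. U i b * (of_bool (l 0 = b) * X)) = U i (l 0) * X" for X
    proof -
      have "(\<Sum>b<n. U i b * (of_bool (l 0 = b) * X)) = (\<Sum>b<n. if b = l 0 then U i b * X else 0)"
        by (intro sum.cong) auto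
      then show ?thesis using l0 by simp
    qed
    then show "A l * (U i (l 0) * (\<Prod>k\<in>{1..d}. lin {..<n} U v (l k)))
        = (\<Sum>b<n. U i b * (of_bool (l 0 = b) * (A l * (\<Prod>k\<in>{1..d}. lin {..<n} U v (l k)))))"
      by simp
  qed
  also have "\<dots> = (\<Sum>b<n. U i b * tapply n d A (lin {..<n} U v) b)"
    unfolding tap by (subst sum.swap) (simp only: sum_distrib_left)
  finally show ?thesis using i by (simp add: lin_def)
qed

section \<open>Eigenvectors as a cone\<close>

text \<open>The vanishing of all 2 by 2 minors expresses proportionality by polynomial equations
  without the unknown eigenvalue. A zero vector is parallel to everything, which admits the
  eigenvalue \<open>0\<close>.\<close>

definition parallel :: "nat \<Rightarrow> (nat \<Rightarrow> real) \<Rightarrow> (nat \<Rightarrow> real) \<Rightarrow> bool" where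
  "parallel n x y \<longleftrightarrow> (\<forall>i<n. \<forall>j<n. x i * y j = x j * y i)"

lemma parallel_lin:
  assumes "parallel n x y"
  shows "parallel n (lin {..<n} U x) (lin {..<n} U y)"
  unfolding parallel_def
proof (intro allI impI)
  fix i j assume ij: "i < n" "j < n"
  have "lin {..<n} U x i * lin {..<n} U y j = (\<Sum>a<n. \<Sum>b<n. U i a * U j b * (x a * y b))"
    using ij by (simp add: lin_def sum_product mult_ac)
  also have "\<dots> = (\<Sum>a<n. \<Sum>b<n. U i a * U j b * (x b * y a))"
    using assms by (intro sum.cong refl) (auto simp: parallel_def)
  also have "\<dots> = lin {..<n} U x j * lin {..<n} U y i"
    using ij by (subst sum.swap) (simp add: lin_def sum_product mult_ac)
  finally show "lin {..<n} U x i * lin {..<n} U y j = lin {..<n} U x j * lin {..<n} U y i" .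
qed

lemma parallel_cong:
  "(\<And>i. i < n \<Longrightarrow> x i = x' i) \<Longrightarrow> (\<And>i. i < n \<Longrightarrow> y i = y' i) \<Longrightarrow> parallel n x y = parallel n x' y'"
  by (simp add: parallel_def)

definition tensor_cone :: "nat \<Rightarrow> nat \<Rightarrow> ((nat \<Rightarrow> nat) \<Rightarrow> real) \<Rightarrow> (nat \<Rightarrow> real) \<Rightarrow> real" where
  "tensor_cone n d A v = (\<Sum>i<n. \<Sum>j<n. \<bar>v i * tapply n d A v j - v j * tapply n d A v i\<bar>)"

lemma tensor_cone_eq_0: "tensor_cone n d A v = 0 \<longleftrightarrow> parallel n v (tapply n d A v)"
proof -
  have "tensor_cone n d A v = 0 \<longleftrightarrow> (\<forall>i<n. (\<Sum>j<n. \<bar>v i * tapply n d A v j - v j * tapply n d A v i\<bar>) = 0)"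
    unfolding tensor_cone_def by (subst sum_nonneg_eq_0_iff) (auto intro: sum_nonneg)
  also have "\<dots> \<longleftrightarrow> parallel n v (tapply n d A v)"
    unfolding parallel_def by (subst sum_nonneg_eq_0_iff) auto
  finally show ?thesis .
qed

text \<open>By equivariance, \<open>v\<close> satisfies the equation of the rotated tensor if and
  only if \<open>?U v\<close> satisfies that of the original one: parallelism survives
  \<open>?U\<close>, and applying the involution again gives the converse.\<close>

lemma random_cone_tensor:
  assumes n: "0 < n"
  shows "random_cone (gauss (tidx n d)) n (tensor_cone n d)"
proof (intro random_cone.intro prob_space_gauss random_cone_axioms.intro n)
  let ?K = "tidx n d"
  have [measurable]: "(\<lambda>w. tapply n d w v i) \<in> borel_measurable (gauss ?K)" for v i
    unfolding tapply_def
    by (intro borel_measurable_sum borel_measurable_times borel_measurable_const)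
       (auto simp: measurable_cong_sets[OF sets_gauss refl] intro!: measurable_component_singleton)
  show "(\<lambda>w. tensor_cone n d w v) \<in> borel_measurable (gauss ?K)" for v
    unfolding tensor_cone_def by measurable
  show "continuous_on UNIV (tensor_cone n d w)" for w
    unfolding tensor_cone_def[abs_def] tapply_def by (intro continuous_intros)
  show "tensor_cone n d w v = tensor_cone n d w v'" if "\<And>i. i < n \<Longrightarrow> v i = v' i" for w v v'
    using that tapply_cong[of n v v' d w] by (simp add: tensor_cone_def)
  show "tensor_cone n d w (\<lambda>i. c * v i) = 0" if "tensor_cone n d w v = 0" for w v c
    using that unfolding tensor_cone_eq_0 parallel_def tapply_scale by (simp add: mult_ac)
  fix U assume U: "sym_orth {..<n} U"
  let ?T = "lin ?K (tensor_mat d U)" and ?U = "lin {..<n} U"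
  have "tensor_cone n d (?T w) v = 0 \<longleftrightarrow> tensor_cone n d w (?U v) = 0" for w v
  proof -
    let ?y = "tapply n d w (?U v)"
    have UU: "?U (?U x) i = x i" if "i < n" for x i
      using lin_lin[OF finite_lessThan U] that by simp
    have "parallel n v (tapply n d (?T w) v) \<longleftrightarrow> parallel n v (?U ?y)"
      by (rule parallel_cong) (auto simp: tapply_tensor_mat[OF U])
    also have "\<dots> \<longleftrightarrow> parallel n (?U v) ?y"
    proof
      assume "parallel n v (?U ?y)"
      from parallel_lin[OF this, of U] show "parallel n (?U v) ?y"
        using parallel_cong[of n "?U v" "?U v" "?U (?U ?y)" ?y] UU by simp
    next
      assume "parallel n (?U v) ?y"
      from parallel_lin[OF this, of U] show "parallel n v (?U ?y)"
        using parallel_cong[of n "?U (?U v)" v "?U ?y" "?U ?y"] UU by simp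
    qed
    finally show ?thesis unfolding tensor_cone_eq_0 .
  qed
  then show "\<exists>T\<in>gauss ?K \<rightarrow>\<^sub>M gauss ?K. distr (gauss ?K) (gauss ?K) T = gauss ?K \<and>
      (\<forall>w\<in>space (gauss ?K). \<forall>v. tensor_cone n d (T w) v = 0 \<longleftrightarrow> tensor_cone n d w (lin {..<n} U v) = 0)"
    using distr_gauss_orth[OF finite_tidx sym_orth_tensor_mat[OF U]] by (intro bexI[of _ ?T]) auto
qed

section \<open>Classes of eigenpairs as lines\<close>

text \<open>Homogeneity of degree \<open>d\<close> forces the eigenvalue to scale by
  \<open>t ^ (d - 1)\<close>, so equivalence of eigenpairs is proportionality of their vectors. For
  positive \<open>d\<close> the integer exponent is a natural number.\<close>

lemma eigen_equiv_iff:
  assumes d: "0 < d"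
  shows "((v, lam), (w, mu)) \<in> eigen_equiv n d A \<longleftrightarrow>
    (v, lam) \<in> real_eigenpairs n d A \<and> (w, mu) \<in> real_eigenpairs n d A \<and> (\<exists>t. t \<noteq> 0 \<and> w = (\<lambda>i. t * v i))"
proof -
  have "mu = t powi (int d - 1) * lam"
    if v: "(v, lam) \<in> real_eigenpairs n d A" and w: "((\<lambda>i. t * v i), mu) \<in> real_eigenpairs n d A" and t: "t \<noteq> 0" for t
  proof -
    obtain i where i: "i < n" "v i \<noteq> 0" using v by (auto simp: real_eigenpairs_def)
    have "t ^ d * tapply n d A v i = mu * (t * v i)" "tapply n d A v i = lam * v i"
      using v w i(1) by (auto simp: real_eigenpairs_def tapply_scale)
    then have "t ^ d * lam = mu * t" using i(2) by simp
    moreover have "t ^ d = t ^ (d - 1) * t" using d by (simp add: power_eq_if)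
    ultimately have "mu = t ^ (d - 1) * lam" using t by simp
    moreover have "int d - 1 = int (d - 1)" using d by simp
    ultimately show ?thesis by (simp only: power_int_of_nat)
  qed
  then show ?thesis unfolding eigen_equiv_def by auto
qed

lemma equiv_eigen_equiv:
  assumes d: "0 < d"
  shows "equiv (real_eigenpairs n d A) (eigen_equiv n d A)"
proof (rule equivI)
  show "eigen_equiv n d A \<subseteq> real_eigenpairs n d A \<times> real_eigenpairs n d A"
    by (auto simp: eigen_equiv_def)
  show "refl_on (real_eigenpairs n d A) (eigen_equiv n d A)"
  proof (rule refl_onI)
    fix x assume "x \<in> real_eigenpairs n d A"
    then show "(x, x) \<in> eigen_equiv n d A"
      by (cases x) (auto simp: eigen_equiv_iff[OF d] intro!: exI[of _ 1])
  qed
  show "sym (eigen_equiv n d A)"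
  proof (rule symI)
    fix x y assume "(x, y) \<in> eigen_equiv n d A"
    then obtain v lam w mu t where xy: "x = (v, lam)" "y = (w, mu)" "x \<in> real_eigenpairs n d A" "y \<in> real_eigenpairs n d A"
        and t: "t \<noteq> 0" "w = (\<lambda>i. t * v i)"
      by (cases x, cases y) (auto simp: eigen_equiv_iff[OF d])
    have "v = (\<lambda>i. (1 / t) * w i)" using t by auto
    then show "(y, x) \<in> eigen_equiv n d A"
      using xy t(1) by (auto simp: eigen_equiv_iff[OF d] intro!: exI[of _ "1 / t"])
  qed
  show "trans (eigen_equiv n d A)"
  proof (rule transI)
    fix x y z assume "(x, y) \<in> eigen_equiv n d A" "(y, z) \<in> eigen_equiv n d A"
    then obtain t s where "x \<in> real_eigenpairs n d A" "z \<in> real_eigenpairs n d A" "t \<noteq> 0" "s \<noteq> 0"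
       "fst y = (\<lambda>i. t * fst x i)" "fst z = (\<lambda>i. s * fst y i)"
      by (cases x, cases y, cases z) (auto simp: eigen_equiv_iff[OF d])
    then show "(x, z) \<in> eigen_equiv n d A"
      by (cases x, cases z) (auto simp: eigen_equiv_iff[OF d] intro!: exI[of _ "s * t"])
  qed
qed

text \<open>Equality case of the Cauchy-Schwarz inequality: with \<open>s\<close> the sign of the
  inner product, the difference of \<open>w\<close> and \<open>s\<close> times \<open>v\<close> has
  squared norm \<open>2 - 2 * \<bar>ip n v w\<bar>\<close>.\<close>

lemma unit_vectors_parallel:
  assumes "ip n v v = 1" "ip n w w = 1" "1 \<le> \<bar>ip n v w\<bar>" "v \<in> rvec n" "w \<in> rvec n"
  obtains s where "s \<noteq> 0" "w = (\<lambda>i. s * v i)"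
proof
  define s where "s = sgn (ip n v w)"
  have s: "s * s = 1" "s * ip n v w = \<bar>ip n v w\<bar>"
    using assms(3) by (auto simp: s_def sgn_if abs_if)
  show "s \<noteq> 0" using s(1) by auto
  have "(\<Sum>i<n. (w i - s * v i) * (w i - s * v i)) = (\<Sum>i<n. w i * w i + s * s * (v i * v i) - 2 * s * (v i * w i))"
    by (intro sum.cong) (auto simp: algebra_simps)
  also have "\<dots> = ip n w w + s * s * ip n v v - 2 * s * ip n v w"
    by (simp add: ip_def sum.distrib sum_subtractf sum_distrib_left)
  also have "\<dots> \<le> 0" using assms s by simp
  finally have "(\<Sum>i<n. (w i - s * v i) * (w i - s * v i)) = 0"
    using sum_nonneg[of "{..<n}" "\<lambda>i. (w i - s * v i) * (w i - s * v i)"] by simp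
  then have "w i = s * v i" if "i < n" for i
    using that by (subst (asm) sum_nonneg_eq_0_iff) auto
  moreover have "w i = s * v i" if "\<not> i < n" for i
    using that assms by (auto simp: rvec_def)
  ultimately show "w = (\<lambda>i. s * v i)" by blast
qed

text \<open>Pairing the eigenvector equation with the unit vector \<open>v\<close> shows which
  eigenvalue it must have.\<close>

lemma real_eigenpair_of_zero:
  assumes "v \<in> rvec n" "ip n v v = 1" "tensor_cone n d A v = 0"
  shows "(v, ip n v (tapply n d A v)) \<in> real_eigenpairs n d A"
proof -
  have "\<exists>i<n. v i \<noteq> 0"
  proof (rule ccontr)
    assume "\<not> ?thesis"
    then have "ip n v v = 0" by (simp add: ip_def)
    then show False using assms(2) by simp
  qed
  moreover have "tapply n d A v i = ip n v (tapply n d A v) * v i" if "i < n" for i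
  proof -
    have "tapply n d A v i = ip n v v * tapply n d A v i" using assms(2) by simp
    also have "\<dots> = (\<Sum>j<n. v j * (v j * tapply n d A v i))"
      by (simp only: ip_def sum_distrib_right mult.assoc)
    also have "\<dots> = (\<Sum>j<n. v j * (v i * tapply n d A v j))"
      using assms(3) that by (intro sum.cong refl) (auto simp: tensor_cone_eq_0 parallel_def)
    also have "\<dots> = ip n v (tapply n d A v) * v i"
      unfolding ip_def sum_distrib_right by (simp add: mult_ac)
    finally show ?thesis .
  qed
  ultimately show ?thesis using assms(1) by (simp add: real_eigenpairs_def)
qed

lemma zero_of_real_eigenpair:
  assumes "(v, lam) \<in> real_eigenpairs n d A"
  shows "tensor_cone n d A v = 0" "v \<in> rvec n" "0 < ip n v v"
proof -
  show "tensor_cone n d A v = 0"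
    unfolding tensor_cone_eq_0 parallel_def using assms by (auto simp: real_eigenpairs_def)
  show "v \<in> rvec n" using assms by (auto simp: real_eigenpairs_def)
  obtain i where i: "i < n" "v i \<noteq> 0" using assms by (auto simp: real_eigenpairs_def)
  have "v i * v i \<le> ip n v v" unfolding ip_def using i by (intro member_le_sum) auto
  moreover have "0 < v i * v i" using i(2) by (simp add: zero_less_mult_iff) linarith
  ultimately show "0 < ip n v v" by simp
qed

text \<open>One eigenpair is chosen from each class and its vector is normalised. The sign of the
  result stays arbitrary, which \<open>line_reps\<close> accommodates by asking for \<open>v\<close>
  or its negative.\<close>

lemma tensor_cone_line_reps:
  assumes n: "0 < n" and d: "0 < d"
  shows "\<exists>R. line_reps n (\<lambda>v. tensor_cone n d A v = 0) R \<and> num_real_eig n d A = ecard R"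
proof -
  interpret random_cone "gauss (tidx n d)" n "tensor_cone n d" by (rule random_cone_tensor[OF n])
  let ?E = "real_eigenpairs n d A" and ?r = "eigen_equiv n d A"
  let ?Q = "?E // ?r"
  note eq = equiv_eigen_equiv[OF d, of n A]
  define pick where "pick q = (SOME x. x \<in> q)" for q :: "((nat \<Rightarrow> real) \<times> real) set"
  define rep where "rep q = (\<lambda>i. (1 / sqrt (ip n (fst (pick q)) (fst (pick q)))) * fst (pick q) i)" for q
  have pick: "pick q \<in> q" "pick q \<in> ?E" if q: "q \<in> ?Q" for q
  proof -
    have "q \<noteq> {}" using in_quotient_imp_non_empty[OF eq q] .
    then show "pick q \<in> q" unfolding pick_def by (simp add: some_in_eq)
    then show "pick q \<in> ?E" using in_quotient_imp_subset[OF eq q] by auto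
  qed
  have rep: "rep q \<in> rvec n" "ip n (rep q) (rep q) = 1" "tensor_cone n d A (rep q) = 0"
    and rep_scale: "\<exists>s. s \<noteq> 0 \<and> rep q = (\<lambda>i. s * fst (pick q) i)" if q: "q \<in> ?Q" for q
  proof -
    let ?v = "fst (pick q)" and ?s = "1 / sqrt (ip n (fst (pick q)) (fst (pick q)))"
    have v: "tensor_cone n d A ?v = 0" "?v \<in> rvec n" "0 < ip n ?v ?v"
      using zero_of_real_eigenpair[of ?v "snd (pick q)" n d A] pick(2)[OF q] by auto
    show "rep q \<in> rvec n" using v(2) by (auto simp: rep_def rvec_def)
    show "ip n (rep q) (rep q) = 1"
      unfolding rep_def ip_scale_left ip_scale_right using v(3) by simp
    show "tensor_cone n d A (rep q) = 0"
      unfolding rep_def by (rule f_homogeneous[OF v(1)])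
    show "\<exists>s. s \<noteq> 0 \<and> rep q = (\<lambda>i. s * fst (pick q) i)"
      using v(3) by (intro exI[of _ ?s]) (auto simp: rep_def)
  qed
  have same: "q = q'" if q: "q \<in> ?Q" "q' \<in> ?Q" and t: "t \<noteq> 0" "rep q' = (\<lambda>i. t * rep q i)" for q q' t
  proof -
    obtain s s' where s: "s \<noteq> 0" "rep q = (\<lambda>i. s * fst (pick q) i)" "s' \<noteq> 0" "rep q' = (\<lambda>i. s' * fst (pick q') i)"
      using rep_scale[OF q(1)] rep_scale[OF q(2)] by blast
    have "fst (pick q') i = (t * s / s') * fst (pick q) i" for i
    proof -
      have "s' * fst (pick q') i = t * (s * fst (pick q) i)"
        using s(2,4) t(2) by (metis)
      then show ?thesis using s(3) by (simp add: field_simps)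
    qed
    then have "fst (pick q') = (\<lambda>i. (t * s / s') * fst (pick q) i)" by (rule ext)
    moreover have "t * s / s' \<noteq> 0" using s t by simp
    ultimately have "\<exists>c. c \<noteq> 0 \<and> fst (pick q') = (\<lambda>i. c * fst (pick q) i)"
      by (intro exI[of _ "t * s / s'"] conjI)
    moreover have "(fst (pick q), snd (pick q)) \<in> ?E" "(fst (pick q'), snd (pick q')) \<in> ?E"
      using pick(2)[OF q(1)] pick(2)[OF q(2)] by simp_all
    ultimately have "((fst (pick q), snd (pick q)), (fst (pick q'), snd (pick q'))) \<in> ?r"
      using eigen_equiv_iff[OF d, of "fst (pick q)" "snd (pick q)" "fst (pick q')" "snd (pick q')" n A] by blast
    then show ?thesis
      using quotient_eq_iff[OF eq q pick(1)[OF q(1)] pick(1)[OF q(2)]] by simp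
  qed
  have "inj_on rep ?Q"
    by (rule inj_onI, rule same[of _ _ 1]) auto
  then have card: "num_real_eig n d A = ecard (rep ` ?Q)"
    by (simp add: num_real_eig_def ecard_def Let_def card_image finite_image_iff)
  have "line_reps n (\<lambda>v. tensor_cone n d A v = 0) (rep ` ?Q)"
    unfolding line_reps_def
  proof (intro conjI ballI impI)
    fix v assume "v \<in> rep ` ?Q"
    then show "v \<in> rvec n" "ip n v v = 1" "tensor_cone n d A v = 0" using rep by auto
  next
    fix v assume v: "v \<in> rvec n" "ip n v v = 1" "tensor_cone n d A v = 0"
    let ?x = "(v, ip n v (tapply n d A v))"
    have x: "?x \<in> ?E" by (rule real_eigenpair_of_zero[OF v])
    define q where "q = ?r `` {?x}"
    have q: "q \<in> ?Q" unfolding q_def using x by (rule quotientI)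
    have "(?x, pick q) \<in> ?r" using pick(1)[OF q] by (simp add: q_def)
    then have "(?x, (fst (pick q), snd (pick q))) \<in> ?r" by simp
    then obtain t where t: "t \<noteq> 0" "fst (pick q) = (\<lambda>i. t * v i)"
      unfolding eigen_equiv_iff[OF d] by blast
    obtain s where s: "rep q = (\<lambda>i. s * fst (pick q) i)" using rep_scale[OF q] by blast
    then have rv: "rep q = (\<lambda>i. (s * t) * v i)" using t by (simp add: mult.assoc)
    then have "(s * t) * ((s * t) * ip n v v) = 1"
      using rep(2)[OF q] unfolding rv ip_scale_left ip_scale_right by simp
    then have "s * t = 1 \<or> s * t = - 1" using v(2) by (simp only: mult_1_right square_eq_1_iff)
    then have "rep q = v \<or> rep q = (\<lambda>i. - v i)" using rv by auto
    then show "v \<in> rep ` ?Q \<or> (\<lambda>i. - v i) \<in> rep ` ?Q" using q by (metis imageI)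
  next
    fix v w assume vw: "v \<in> rep ` ?Q" "w \<in> rep ` ?Q" "v \<noteq> w"
    then obtain q q' where q: "q \<in> ?Q" "q' \<in> ?Q" "v = rep q" "w = rep q'" by auto
    show "\<bar>ip n v w\<bar> < 1"
    proof (rule ccontr)
      assume "\<not> \<bar>ip n v w\<bar> < 1"
      then obtain s where "s \<noteq> 0" "w = (\<lambda>i. s * v i)"
        using unit_vectors_parallel[of n v w] rep[OF q(1)] rep[OF q(2)] q(3,4) by auto
      then have "q = q'" using same[OF q(1,2)] q(3,4) by simp
      then show False using vw(3) q by simp
    qed
  qed
  then show ?thesis using card by blast
qed

section \<open>The eigenvector equation near the first axis\<close>

text \<open>Index of the coefficient of the pure power of \<open>v 0\<close> in component
  \<open>i\<close>, which is the constant term in the chart.\<close>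

definition lead :: "nat \<Rightarrow> nat \<Rightarrow> nat" where
  "lead i k = (if k = 0 then i else 0)"

definition slot :: "nat \<Rightarrow> nat \<Rightarrow> nat \<Rightarrow> nat \<Rightarrow> nat" where
  "slot i l k s = (if s = 0 then i else if s = k then l else 0)"

text \<open>For positive \<open>l\<close> these are the \<open>d\<close> indices whose entries
  multiply \<open>v l\<close> and the power \<open>d - 1\<close> of \<open>v 0\<close> in component
  \<open>i\<close>; the sum of the entries is the linear coefficient in the chart.\<close>

definition block :: "nat \<Rightarrow> nat \<Rightarrow> nat \<Rightarrow> (nat \<Rightarrow> nat) set" where
  "block d i l = slot i l ` {1..d}"

text \<open>The number of these positions is the order in \<open>r\<close> of the corresponding
  monomial in the chart.\<close>

definition supp :: "nat \<Rightarrow> (nat \<Rightarrow> nat) \<Rightarrow> nat set" where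
  "supp d j = {k \<in> {1..d}. j k \<noteq> 0}"

definition high :: "nat \<Rightarrow> nat \<Rightarrow> nat \<Rightarrow> nat \<Rightarrow> (nat \<Rightarrow> nat) set" where
  "high n d q i = {j \<in> tidx n d. j 0 = i \<and> q \<le> card (supp d j)}"

lemma lead_mem: "i < n \<Longrightarrow> lead i \<in> tidx n d"
  by (auto simp: tidx_def lead_def)

lemma lead_eq_iff [simp]: "lead i = lead i' \<longleftrightarrow> i = i'"
  by (metis lead_def)

lemma finite_supp [simp]: "finite (supp d j)"
  by (simp add: supp_def)

lemma supp_lead [simp]: "supp d (lead i) = {}"
  by (auto simp: supp_def lead_def)

lemma slot_mem:
  assumes "i < n" "l \<in> {1..<n}" "k \<in> {1..d}"
  shows "slot i l k \<in> tidx n d" "supp d (slot i l k) = {k}" "slot i l k 0 = i" "slot i l k k = l"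
  using assms by (auto simp: tidx_def slot_def supp_def)

lemma block_subset: "i < n \<Longrightarrow> l \<in> {1..<n} \<Longrightarrow> block d i l \<subseteq> tidx n d"
  unfolding block_def using slot_mem(1) by blast

lemma inj_on_slot: "l \<in> {1..<n} \<Longrightarrow> inj_on (slot i l) {1..d}"
proof (rule inj_onI)
  fix k k' assume l: "l \<in> {1..<n}" and k: "k \<in> {1..d}" "k' \<in> {1..d}" "slot i l k = slot i l k'"
  then have "slot i l k' k = l" using slot_def[of i l k k] by auto
  then show "k = k'" using l k(1) by (auto simp: slot_def split: if_splits)
qed

lemma card_block:
  assumes "l \<in> {1..<n}" shows "card (block d i l) = d"
  unfolding block_def card_image[OF inj_on_slot[OF assms]] by simp

lemma finite_block [simp]: "finite (block d i l)"
  by (simp add: block_def)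

lemma block_disjoint:
  assumes "l \<in> {1..<n}" "l' \<in> {1..<n}" "j \<in> block d i l" "j \<in> block d i' l'"
  shows "i = i' \<and> l = l'"
proof -
  obtain k k' where k: "k \<in> {1..d}" "j = slot i l k" "k' \<in> {1..d}" "j = slot i' l' k'"
    using assms by (auto simp: block_def)
  have "slot i l k 0 = slot i' l' k' 0" "slot i l k k = slot i' l' k' k" using k by auto
  then show ?thesis using k(1,3) assms(1,2) by (auto simp: slot_def split: if_splits)
qed

lemma finite_high [simp]: "finite (high n d q i)"
  by (simp add: high_def)

lemma lead_eqI:
  assumes "j \<in> tidx n d" "j 0 = i" "supp d j = {}"
  shows "j = lead i"
proof
  fix k show "j k = lead i k"
    using assms by (cases "k = 0"; cases "k \<le> d") (auto simp: lead_def tidx_def supp_def)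
qed

lemma block_cover:
  assumes "i < n" shows "{j \<in> tidx n d. j 0 = i \<and> card (supp d j) = 1} = (\<Union>l\<in>{1..<n}. block d i l)"
proof (intro Set.set_eqI iffI)
  fix j assume j: "j \<in> {j \<in> tidx n d. j 0 = i \<and> card (supp d j) = 1}"
  then obtain k where k: "supp d j = {k}" by (auto simp: card_1_singleton_iff)
  then have "k \<in> {1..d}" "j k \<noteq> 0" by (auto simp: supp_def)
  moreover have "j k < n" using j \<open>k \<in> {1..d}\<close> by (auto simp: tidx_def)
  moreover have "j = slot i (j k) k"
  proof
    fix s
    have "j s = 0" if "s \<noteq> 0" "s \<noteq> k"
    proof (cases "s \<le> d")
      case True
      then have "s \<notin> supp d j" using k that by auto
      then show ?thesis using True that by (auto simp: supp_def)
    qed (use j in \<open>auto simp: tidx_def\<close>)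
    then show "j s = slot i (j k) k s" using j by (auto simp: slot_def)
  qed
  ultimately show "j \<in> (\<Union>l\<in>{1..<n}. block d i l)"
    by (intro UN_I[of "j k"]) (auto simp: block_def)
next
  fix j assume "j \<in> (\<Union>l\<in>{1..<n}. block d i l)"
  then obtain l k where "l \<in> {1..<n}" "k \<in> {1..d}" "j = slot i l k" by (auto simp: block_def)
  then show "j \<in> {j \<in> tidx n d. j 0 = i \<and> card (supp d j) = 1}"
    using slot_mem[OF assms, of l k d] by simp
qed

lemma sum_row_split1:
  fixes F :: "(nat \<Rightarrow> nat) \<Rightarrow> real"
  assumes "i < n"
  shows "(\<Sum>j\<in>{j \<in> tidx n d. j 0 = i}. F j) = F (lead i) + (\<Sum>j\<in>high n d 1 i. F j)"
proof -
  have "{j \<in> tidx n d. j 0 = i} = insert (lead i) (high n d 1 i)"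
  proof (intro Set.set_eqI iffI)
    fix j assume "j \<in> {j \<in> tidx n d. j 0 = i}"
    then show "j \<in> insert (lead i) (high n d 1 i)"
      using lead_eqI[of j n d i] by (cases "supp d j = {}") (auto simp: high_def Suc_le_eq card_gt_0_iff)
  next
    fix j assume "j \<in> insert (lead i) (high n d 1 i)"
    then show "j \<in> {j \<in> tidx n d. j 0 = i}"
      using lead_mem[OF assms, of d] by (auto simp: high_def) (simp add: lead_def)
  qed
  moreover have "lead i \<notin> high n d 1 i" by (simp add: high_def)
  ultimately show ?thesis by simp
qed

text \<open>Sorts component \<open>i\<close> by order in \<open>r\<close>: constant term, linear
  terms, and terms of order at least \<open>2\<close>.\<close>

lemma sum_row_split2:
  fixes F :: "(nat \<Rightarrow> nat) \<Rightarrow> real"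
  assumes "i < n"
  shows "(\<Sum>j\<in>{j \<in> tidx n d. j 0 = i}. F j) = F (lead i) + (\<Sum>l\<in>{1..<n}. \<Sum>j\<in>block d i l. F j) + (\<Sum>j\<in>high n d 2 i. F j)"
proof -
  have "high n d 1 i = {j \<in> tidx n d. j 0 = i \<and> card (supp d j) = 1} \<union> high n d 2 i"
    by (auto simp: high_def)
  then have "(\<Sum>j\<in>high n d 1 i. F j) = (\<Sum>j\<in>{j \<in> tidx n d. j 0 = i \<and> card (supp d j) = 1}. F j) + (\<Sum>j\<in>high n d 2 i. F j)"
    by (simp only:) (rule sum.union_disjoint, auto simp: high_def)
  also have "(\<Sum>j\<in>{j \<in> tidx n d. j 0 = i \<and> card (supp d j) = 1}. F j) = (\<Sum>l\<in>{1..<n}. \<Sum>j\<in>block d i l. F j)"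
    unfolding block_cover[OF assms]
    by (rule sum.UNION_disjoint) (auto dest: block_disjoint[rotated 2])
  finally show ?thesis unfolding sum_row_split1[OF assms] by simp
qed

lemma prod_chart:
  "(\<Prod>k\<in>{1..d}. chart r u (j k)) = r ^ card (supp d j) * (\<Prod>k\<in>supp d j. u (j k))"
proof -
  have "(\<Prod>k\<in>{1..d}. chart r u (j k)) = (\<Prod>k\<in>supp d j. r * u (j k))"
    by (rule prod.mono_neutral_cong_right) (auto simp: supp_def chart_def)
  then show ?thesis by (simp add: prod.distrib)
qed

section \<open>Linear part and remainder of the eigenvector equation\<close>

text \<open>To first order, component \<open>i\<close> must equal \<open>u i\<close> times the
  eigenvalue, up to the common factor \<open>r\<close>, and the eigenvalue is
  \<open>w (lead 0)\<close> to leading order. The difference of this term and the linear terms of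
  component \<open>i\<close> remains once the constant term is isolated.\<close>

definition tensor_lin :: "nat \<Rightarrow> ((nat \<Rightarrow> nat) \<Rightarrow> real) \<Rightarrow> nat \<Rightarrow> nat \<Rightarrow> real" where
  "tensor_lin d w i l = of_bool (i = l) * w (lead 0) - (\<Sum>j\<in>block d i l. w j)"

text \<open>Component \<open>0\<close> is the eigenvalue and is multiplied by
  \<open>r * u i\<close>, so after division by \<open>r\<close> its terms of order at least
  \<open>1\<close> belong to the remainder. In component \<open>i\<close> the remainder starts at
  order \<open>2\<close>, and the division lowers each exponent by one.\<close>

definition tensor_rem :: "nat \<Rightarrow> nat \<Rightarrow> real \<Rightarrow> ((nat \<Rightarrow> nat) \<Rightarrow> real) \<Rightarrow> (nat \<Rightarrow> real) \<Rightarrow> nat \<Rightarrow> real" where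
  "tensor_rem n d r w u i =
     (\<Sum>j\<in>high n d 1 0. w j * (r ^ card (supp d j) * (u i * (\<Prod>k\<in>supp d j. u (j k))))) -
     (\<Sum>j\<in>high n d 2 i. w j * (r ^ (card (supp d j) - 1) * (\<Prod>k\<in>supp d j. u (j k))))"

lemma lin_tensor_lin:
  assumes "i \<in> {1..<n}"
  shows "lin {1..<n} (tensor_lin d w) u i = u i * w (lead 0) - (\<Sum>l\<in>{1..<n}. \<Sum>j\<in>block d i l. w j * u l)"
proof -
  have "lin {1..<n} (tensor_lin d w) u i = (\<Sum>l\<in>{1..<n}. (if l = i then u i * w (lead 0) else 0) - (\<Sum>j\<in>block d i l. w j * u l))"
    using assms by (auto simp: lin_def tensor_lin_def left_diff_distrib sum_distrib_right intro!: sum.cong)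
  then show ?thesis using assms by (simp add: sum_subtractf)
qed

text \<open>In the chart coordinate \<open>0\<close> equals \<open>1\<close>, so parallelism makes
  component \<open>0\<close> the eigenvalue and leaves \<open>n - 1\<close> equations, each
  containing one resampled coefficient additively.\<close>

lemma tensor_chart_eq:
  assumes n: "1 < n" and r: "0 < r"
  shows "tensor_cone n d (overwrite (tidx n d) lead {1..<n} w a) (chart r u) = 0 \<longleftrightarrow>
    (\<forall>i\<in>{1..<n}. a i = r * (lin {1..<n} (tensor_lin d w) u i + tensor_rem n d r w u i))"
proof -
  let ?B = "overwrite (tidx n d) lead {1..<n} w a" and ?v = "chart r u"
  let ?m = "\<lambda>j. r ^ card (supp d j) * (\<Prod>k\<in>supp d j. u (j k))"
  have inj: "inj_on lead {1..<n}" by (simp add: inj_on_def)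
  have B_lead: "?B (lead i) = a i" if "i \<in> {1..<n}" for i
    using that lead_mem[of i n d] the_inv_into_f_f[OF inj that] by (simp add: overwrite_def)
  have B_other: "?B j = w j" if "j \<in> tidx n d" "j \<notin> lead ` {1..<n}" for j
    using that by (simp add: overwrite_def)
  have B_high: "?B j = w j" if "j \<in> high n d q i" "0 < q" for j q i
    using that by (intro B_other) (auto simp: high_def)
  have B_high1: "?B j = w j" if "j \<in> high n d 1 i" for j i
    using that by (rule B_high) simp
  have B_high2: "?B j = w j" if "j \<in> high n d 2 i" for j i
    using that by (rule B_high) simp
  have B_block: "?B j = w j" if jb: "j \<in> block d i l" and il: "i < n" "l \<in> {1..<n}" for i l j
  proof (rule B_other)
    obtain k where k: "k \<in> {1..d}" "j = slot i l k" using jb by (auto simp: block_def)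
    then have "supp d j \<noteq> {}" using slot_mem(2)[OF il k(1)] by simp
    then show "j \<notin> lead ` {1..<n}" by auto
    show "j \<in> tidx n d" using slot_mem(1)[OF il k(1)] k(2) by simp
  qed
  have m_block: "?m j = r * u l" if jb: "j \<in> block d i l" and il: "i < n" "l \<in> {1..<n}" for i l j
  proof -
    obtain k where k: "k \<in> {1..d}" "j = slot i l k" using jb by (auto simp: block_def)
    then show ?thesis using slot_mem(2,4)[OF il k(1)] by simp
  qed
  have y: "tapply n d ?B ?v i = (\<Sum>j\<in>{j \<in> tidx n d. j 0 = i}. ?B j * ?m j)" for i
    by (simp only: tapply_def prod_chart)
  have y0: "tapply n d ?B ?v 0 = w (lead 0) + (\<Sum>j\<in>high n d 1 0. w j * ?m j)"
  proof -
    have "lead 0 \<in> tidx n d" using n by (intro lead_mem) auto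
    then have "?B (lead 0) = w (lead 0)" by (intro B_other) auto
    then have "?B (lead 0) * ?m (lead 0) = w (lead 0)" by simp
    moreover have "(\<Sum>j\<in>high n d 1 0. ?B j * ?m j) = (\<Sum>j\<in>high n d 1 0. w j * ?m j)"
      by (intro sum.cong refl) (simp only: B_high1)
    moreover have "tapply n d ?B ?v 0 = ?B (lead 0) * ?m (lead 0) + (\<Sum>j\<in>high n d 1 0. ?B j * ?m j)"
      unfolding y using n by (intro sum_row_split1) simp
    ultimately show ?thesis by simp
  qed
  have yi: "tapply n d ?B ?v i = a i + (\<Sum>l\<in>{1..<n}. \<Sum>j\<in>block d i l. w j * (r * u l)) + (\<Sum>j\<in>high n d 2 i. w j * ?m j)"
    if i: "i \<in> {1..<n}" for i
  proof -
    have "i < n" using i by simp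
    then have "tapply n d ?B ?v i = ?B (lead i) * ?m (lead i) + (\<Sum>l\<in>{1..<n}. \<Sum>j\<in>block d i l. ?B j * ?m j) + (\<Sum>j\<in>high n d 2 i. ?B j * ?m j)"
      unfolding y by (rule sum_row_split2)
    moreover have "?B (lead i) * ?m (lead i) = a i" using B_lead[OF i] by simp
    moreover have "(\<Sum>l\<in>{1..<n}. \<Sum>j\<in>block d i l. ?B j * ?m j) = (\<Sum>l\<in>{1..<n}. \<Sum>j\<in>block d i l. w j * (r * u l))"
      by (intro sum.cong refl) (simp only: B_block[OF _ \<open>i < n\<close>] m_block[OF _ \<open>i < n\<close>])
    moreover have "(\<Sum>j\<in>high n d 2 i. ?B j * ?m j) = (\<Sum>j\<in>high n d 2 i. w j * ?m j)"
      by (intro sum.cong refl) (simp only: B_high2)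
    ultimately show ?thesis by simp
  qed
  \<comment> \<open>In the use below \<open>x\<close> is the constant term of component
    \<open>i\<close>, \<open>p\<close> and \<open>q\<close> are its linear and higher terms,
    \<open>c\<close> is \<open>u i\<close>, and \<open>y + z\<close> is component \<open>0\<close>
    split into its leading entry and the rest.\<close>
  have linear_eq: "x + r * p + r * q = r * c * (y + z) \<longleftrightarrow> x = r * (c * y - p + (c * z - q))" for x p q c y z :: real
    by (auto simp: algebra_simps)
  have "tensor_cone n d ?B ?v = 0 \<longleftrightarrow> (\<forall>i\<in>{1..<n}. tapply n d ?B ?v i = r * u i * tapply n d ?B ?v 0)"
  proof
    assume "tensor_cone n d ?B ?v = 0"
    then have par: "?v 0 * tapply n d ?B ?v i = ?v i * tapply n d ?B ?v 0" if "i < n" for i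
      using n that unfolding tensor_cone_eq_0 parallel_def by auto
    show "\<forall>i\<in>{1..<n}. tapply n d ?B ?v i = r * u i * tapply n d ?B ?v 0"
    proof
      fix i assume i: "i \<in> {1..<n}"
      then have "?v 0 = 1" "?v i = r * u i" by (auto simp: chart_def)
      then show "tapply n d ?B ?v i = r * u i * tapply n d ?B ?v 0"
        using par[of i] i by (simp only: mult_1 atLeastLessThan_iff)
    qed
  next
    assume *: "\<forall>i\<in>{1..<n}. tapply n d ?B ?v i = r * u i * tapply n d ?B ?v 0"
    have ve: "tapply n d ?B ?v i = ?v i * tapply n d ?B ?v 0" if "i < n" for i
    proof (cases "i = 0")
      case True
      then show ?thesis by (simp add: chart_def)
    next
      case False
      then have "i \<in> {1..<n}" "?v i = r * u i" using that by (auto simp: chart_def)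
      then show ?thesis using * by simp
    qed
    show "tensor_cone n d ?B ?v = 0"
      unfolding tensor_cone_eq_0 parallel_def
    proof (intro allI impI)
      fix i j assume ij: "i < n" "j < n"
      have "?v i * tapply n d ?B ?v j = ?v i * (?v j * tapply n d ?B ?v 0)" by (simp only: ve[OF ij(2)])
      also have "\<dots> = ?v j * (?v i * tapply n d ?B ?v 0)" by (rule mult.left_commute)
      also have "\<dots> = ?v j * tapply n d ?B ?v i" by (simp only: ve[OF ij(1)])
      finally show "?v i * tapply n d ?B ?v j = ?v j * tapply n d ?B ?v i" .
    qed
  qed
  also have "\<dots> \<longleftrightarrow> (\<forall>i\<in>{1..<n}. a i = r * (lin {1..<n} (tensor_lin d w) u i + tensor_rem n d r w u i))"
  proof (intro ball_cong refl)
    fix i assume i: "i \<in> {1..<n}"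
    have h2: "(\<Sum>j\<in>high n d 2 i. w j * ?m j) = r * (\<Sum>j\<in>high n d 2 i. w j * (r ^ (card (supp d j) - 1) * (\<Prod>k\<in>supp d j. u (j k))))"
      unfolding sum_distrib_left
    proof (intro sum.cong refl)
      fix j assume "j \<in> high n d 2 i"
      then have "card (supp d j) = Suc (card (supp d j) - 1)" by (auto simp: high_def)
      then have "r ^ card (supp d j) = r * r ^ (card (supp d j) - 1)" by (metis power_Suc)
      then show "w j * ?m j = r * (w j * (r ^ (card (supp d j) - 1) * (\<Prod>k\<in>supp d j. u (j k))))" by simp
    qed
    have h1: "u i * (\<Sum>j\<in>high n d 1 0. w j * ?m j) = (\<Sum>j\<in>high n d 1 0. w j * (r ^ card (supp d j) * (u i * (\<Prod>k\<in>supp d j. u (j k)))))"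
      unfolding sum_distrib_left by (intro sum.cong refl) (simp add: mult_ac)
    have b: "(\<Sum>l\<in>{1..<n}. \<Sum>j\<in>block d i l. w j * (r * u l)) = r * (\<Sum>l\<in>{1..<n}. \<Sum>j\<in>block d i l. w j * u l)"
      unfolding sum_distrib_left by (intro sum.cong refl) simp
    show "tapply n d ?B ?v i = r * u i * tapply n d ?B ?v 0 \<longleftrightarrow>
        a i = r * (lin {1..<n} (tensor_lin d w) u i + tensor_rem n d r w u i)"
      unfolding yi[OF i] y0 lin_tensor_lin[OF i] tensor_rem_def h2 b h1[symmetric]
      by (rule linear_eq)
  qed
  finally show ?thesis .
qed

lemma abs_weighted_sum_le:
  fixes w c :: "'a \<Rightarrow> real"
  assumes "finite K" "S \<subseteq> K" "\<And>j. j \<in> S \<Longrightarrow> \<bar>c j\<bar> \<le> b" "0 \<le> b"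
  shows "\<bar>\<Sum>j\<in>S. w j * c j\<bar> \<le> (\<Sum>j\<in>K. \<bar>w j\<bar>) * b"
proof -
  have "\<bar>\<Sum>j\<in>S. w j * c j\<bar> \<le> (\<Sum>j\<in>S. \<bar>w j * c j\<bar>)" by (rule sum_abs)
  also have "\<dots> \<le> (\<Sum>j\<in>S. \<bar>w j\<bar> * b)"
    using assms by (intro sum_mono) (auto simp: abs_mult intro: mult_left_mono)
  also have "\<dots> \<le> (\<Sum>j\<in>K. \<bar>w j\<bar> * b)"
    using assms by (intro sum_mono2) auto
  finally show ?thesis by (simp add: sum_distrib_right)
qed

lemma supp_prod_le:
  assumes "u \<in> ball0 n"
  shows "\<bar>\<Prod>k\<in>supp d j. u (j k)\<bar> \<le> 1"
  unfolding abs_prod using ball0_coord[OF assms] by (intro prod_le_1) auto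

lemma supp_prod_diff_le:
  assumes u: "u \<in> ball0 n" "u' \<in> ball0 n" and \<delta>: "\<And>j. \<bar>u j - u' j\<bar> \<le> \<delta>"
  shows "\<bar>(\<Prod>k\<in>supp d j. u (j k)) - (\<Prod>k\<in>supp d j. u' (j k))\<bar> \<le> real d * \<delta>"
proof -
  have \<delta>0: "0 \<le> \<delta>" using \<delta>[of 0] by simp
  have "norm ((\<Prod>k\<in>supp d j. u (j k)) - (\<Prod>k\<in>supp d j. u' (j k))) \<le> (\<Sum>k\<in>supp d j. norm (u (j k) - u' (j k)))"
    using ball0_coord[OF u(1)] ball0_coord[OF u(2)] by (intro norm_prod_diff) auto
  also have "\<dots> \<le> (\<Sum>k\<in>supp d j. \<delta>)" using \<delta> by (intro sum_mono) auto
  also have "\<dots> \<le> real d * \<delta>"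
  proof -
    have "card (supp d j) \<le> card {1..d}" by (rule card_mono) (auto simp: supp_def)
    then show ?thesis using \<delta>0 by (simp add: mult_right_mono)
  qed
  finally show ?thesis by simp
qed

text \<open>Each monomial carries a power of \<open>r\<close> with exponent at least
  \<open>1\<close>, and coordinates in the ball are bounded by \<open>1\<close>, so the sum of the
  absolute values of all tensor entries controls everything. A product of at most \<open>d\<close>
  such coordinates has Lipschitz constant \<open>d\<close>.\<close>

lemma tensor_rem_bounds:
  fixes w :: "(nat \<Rightarrow> nat) \<Rightarrow> real" and d :: nat
  assumes r: "0 < r" "r \<le> 1" and u: "u \<in> ball0 n" and i: "i \<in> {1..<n}"
  defines "W \<equiv> (\<Sum>j\<in>tidx n d. \<bar>w j\<bar>)"
  shows "\<bar>tensor_rem n d r w u i\<bar> \<le> 2 * W * r"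
    and "u' \<in> ball0 n \<Longrightarrow> (\<And>j. \<bar>u j - u' j\<bar> \<le> \<delta>) \<Longrightarrow>
      \<bar>tensor_rem n d r w u i - tensor_rem n d r w u' i\<bar> \<le> (2 * real d + 2) * W * r * \<delta>"
proof -
  have W0: "0 \<le> W" unfolding W_def by (intro sum_nonneg) auto
  have rp: "r ^ q \<le> r" "0 \<le> r ^ q" if "1 \<le> q" for q :: nat
    using r that power_decreasing[of 1 q r] by auto
  have rle: "\<bar>r ^ q * x\<bar> \<le> r * b" if "1 \<le> q" "\<bar>x\<bar> \<le> b" for q :: nat and x b
    using rp[OF that(1)] that(2) r by (auto simp: abs_mult intro!: mult_mono)
  have sub: "high n d q i \<subseteq> tidx n d" for q i by (auto simp: high_def)
  have ui: "\<bar>u i\<bar> \<le> 1" by (rule ball0_coord[OF u])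
  have "\<bar>\<Sum>j\<in>high n d 1 0. w j * (r ^ card (supp d j) * (u i * (\<Prod>k\<in>supp d j. u (j k))))\<bar> \<le> W * (r * 1)"
    unfolding W_def
  proof (intro abs_weighted_sum_le rle finite_tidx sub)
    fix j show "\<bar>u i * (\<Prod>k\<in>supp d j. u (j k))\<bar> \<le> 1"
      using mult_mono[OF ui supp_prod_le[OF u, of j d]] by (simp add: abs_mult)
  qed (use r in \<open>auto simp: high_def\<close>)
  moreover have "\<bar>\<Sum>j\<in>high n d 2 i. w j * (r ^ (card (supp d j) - 1) * (\<Prod>k\<in>supp d j. u (j k)))\<bar> \<le> W * (r * 1)"
    unfolding W_def
    by (intro abs_weighted_sum_le rle finite_tidx sub supp_prod_le[OF u]) (use r in \<open>auto simp: high_def\<close>)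
  ultimately show "\<bar>tensor_rem n d r w u i\<bar> \<le> 2 * W * r"
    unfolding tensor_rem_def by simp
  assume u': "u' \<in> ball0 n" and \<delta>: "\<And>j. \<bar>u j - u' j\<bar> \<le> \<delta>"
  have \<delta>0: "0 \<le> \<delta>" using \<delta>[of 0] by simp
  let ?p = "\<lambda>u j. \<Prod>k\<in>supp d j. u (j k)"
  have d1: "\<bar>u i * ?p u j - u' i * ?p u' j\<bar> \<le> (real d + 1) * \<delta>" for j
  proof -
    have "u i * ?p u j - u' i * ?p u' j = u i * (?p u j - ?p u' j) + (u i - u' i) * ?p u' j"
      by (simp add: algebra_simps)
    also have "\<bar>\<dots>\<bar> \<le> \<bar>u i * (?p u j - ?p u' j)\<bar> + \<bar>(u i - u' i) * ?p u' j\<bar>" by (rule abs_triangle_ineq)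
    also have "\<dots> \<le> 1 * (real d * \<delta>) + \<delta> * 1"
      unfolding abs_mult using ui supp_prod_diff_le[OF u u' \<delta>] supp_prod_le[OF u'] \<delta> \<delta>0
      by (intro add_mono mult_mono) auto
    finally show ?thesis by (simp add: algebra_simps)
  qed
  have "tensor_rem n d r w u i - tensor_rem n d r w u' i =
     (\<Sum>j\<in>high n d 1 0. w j * (r ^ card (supp d j) * (u i * ?p u j - u' i * ?p u' j))) -
     (\<Sum>j\<in>high n d 2 i. w j * (r ^ (card (supp d j) - 1) * (?p u j - ?p u' j)))"
    by (simp add: tensor_rem_def right_diff_distrib sum_subtractf)
  moreover have "\<bar>\<Sum>j\<in>high n d 1 0. w j * (r ^ card (supp d j) * (u i * ?p u j - u' i * ?p u' j))\<bar> \<le> W * (r * ((real d + 1) * \<delta>))"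
    unfolding W_def by (intro abs_weighted_sum_le rle finite_tidx sub d1) (use r \<delta>0 in \<open>auto simp: high_def\<close>)
  moreover have "\<bar>\<Sum>j\<in>high n d 2 i. w j * (r ^ (card (supp d j) - 1) * (?p u j - ?p u' j))\<bar> \<le> W * (r * (real d * \<delta>))"
    unfolding W_def by (intro abs_weighted_sum_le rle finite_tidx sub supp_prod_diff_le[OF u u' \<delta>]) (use r \<delta>0 in \<open>auto simp: high_def\<close>)
  ultimately have "\<bar>tensor_rem n d r w u i - tensor_rem n d r w u' i\<bar> \<le> W * (r * ((real d + 1) * \<delta>)) + W * (r * (real d * \<delta>))"
    by linarith
  also have "\<dots> = (2 * real d + 1) * (W * r * \<delta>)" by (simp add: algebra_simps)
  \<comment> \<open>Rounded up so that the same constant also dominates the factor \<open>2\<close>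
    of the first bound, even for \<open>d = 0\<close>.\<close>
  also have "\<dots> \<le> (2 * real d + 2) * (W * r * \<delta>)"
    using W0 r \<delta>0 by (intro mult_right_mono) auto
  finally show "\<bar>tensor_rem n d r w u i - tensor_rem n d r w u' i\<bar> \<le> (2 * real d + 2) * W * r * \<delta>"
    by (simp add: mult_ac)
qed

lemma abs_tensor_lin_le:
  assumes "i < n" "l \<in> {1..<n}"
  shows "\<bar>tensor_lin d w i l\<bar> \<le> 2 * (\<Sum>j\<in>tidx n d. \<bar>w j\<bar>)"
proof -
  let ?W = "\<Sum>j\<in>tidx n d. \<bar>w j\<bar>"
  have "\<bar>\<Sum>j\<in>block d i l. w j * 1\<bar> \<le> ?W * 1"
    using block_subset[OF assms] by (intro abs_weighted_sum_le) auto
  moreover have "\<bar>w (lead 0)\<bar> \<le> ?W"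
    using assms lead_mem[of 0 n d] by (intro member_le_sum) auto
  moreover have "0 \<le> ?W" by (intro sum_nonneg) auto
  ultimately show ?thesis by (auto simp: tensor_lin_def of_bool_def)
qed

section \<open>The law of the linear part\<close>

text \<open>A negative Gaussian matrix plus \<open>t\<close> times an independent Gaussian multiple
  of the identity. The value \<open>t = 1 / sqrt (real d)\<close> belongs to the tensor after
  division by \<open>sqrt (real d)\<close>, and \<open>t = 0\<close> to the linear system.\<close>

definition perturbed :: "real \<Rightarrow> (nat \<times> nat \<Rightarrow> real) \<Rightarrow> nat \<Rightarrow> nat \<Rightarrow> real" where
  "perturbed t g i l = - g (i, l) + of_bool (i = l) * t * g (1, 0)"

text \<open>The entries of the linear part are sums over blocks of \<open>d\<close> tensor entries, hence after
  normalisation again independent standard Gaussians. The coordinate \<open>(1, 0)\<close>, which is not an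
  index of the matrix, carries the eigenvalue.\<close>

definition part :: "nat \<Rightarrow> nat \<times> nat \<Rightarrow> (nat \<Rightarrow> nat) set" where
  "part d p = (if snd p = 0 then {lead (if fst p = 1 then 0 else fst p)} else block d (fst p) (snd p))"

text \<open>The places of column \<open>0\<close> other than \<open>(1, 0)\<close> are filled with
  the entries at \<open>lead i\<close> for \<open>i\<close> at least \<open>2\<close>. The index set
  is then that of the linear system, and both expected volumes are integrals over the same Gaussian
  space.\<close>

definition normalised_sums :: "nat \<Rightarrow> nat \<Rightarrow> ((nat \<Rightarrow> nat) \<Rightarrow> real) \<Rightarrow> nat \<times> nat \<Rightarrow> real" where
  "normalised_sums n d w = (\<lambda>p\<in>{1..<n} \<times> {..<n}. (\<Sum>k\<in>part d p. w k) / sqrt (real (card (part d p))))"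

lemma distr_normalised_sums:
  assumes n: "1 < n" and d: "0 < d"
  shows "distr (gauss (tidx n d)) (PiM ({1..<n} \<times> {..<n}) (\<lambda>_. borel)) (normalised_sums n d) = gauss ({1..<n} \<times> {..<n})"
  unfolding normalised_sums_def
proof (rule gauss_block_sums)
  show "{1..<n} \<times> {..<n} \<noteq> {}" using n by auto
  fix p assume p: "p \<in> {1..<n} \<times> {..<n}"
  show "part d p \<subseteq> tidx n d"
    using p n block_subset[of "fst p" n "snd p" d] lead_mem[of "if fst p = 1 then 0 else fst p" n d] by (auto simp: part_def)
  show "part d p \<noteq> {}" using d by (auto simp: part_def block_def)
next
  have block_lead: "lead i' \<notin> block d i l" if "i < n" "l \<in> {1..<n}" for i i' l
  proof
    assume "lead i' \<in> block d i l"
    then obtain k where k: "k \<in> {1..d}" "lead i' = slot i l k" by (auto simp: block_def)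
    then show False using slot_mem(2)[OF that k(1)] supp_lead[of d i'] by simp
  qed
  show "disjoint_family_on (part d) ({1..<n} \<times> {..<n})"
    unfolding disjoint_family_on_def
  proof (intro ballI impI equals0I)
    fix p q j assume pq: "p \<in> {1..<n} \<times> {..<n}" "q \<in> {1..<n} \<times> {..<n}" "p \<noteq> q" "j \<in> part d p \<inter> part d q"
    show False
    proof (cases "snd p = 0"; cases "snd q = 0")
      assume "snd p = 0" "snd q = 0"
      then show False using pq by (auto simp: part_def prod_eq_iff split: if_splits)
    next
      assume "snd p = 0" "snd q \<noteq> 0"
      then show False using pq block_lead[of "fst q" "snd q"] by (auto simp: part_def)
    next
      assume "snd p \<noteq> 0" "snd q = 0"
      then show False using pq block_lead[of "fst p" "snd p"] by (auto simp: part_def)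
    next
      assume "snd p \<noteq> 0" "snd q \<noteq> 0"
      then show False using pq block_disjoint[of "snd p" n "snd q" j d "fst p" "fst q"]
        by (auto simp: part_def prod_eq_iff)
    qed
  qed
qed auto

lemma measurable_normalised_sums:
  assumes n: "1 < n"
  shows "normalised_sums n d \<in> gauss (tidx n d) \<rightarrow>\<^sub>M PiM ({1..<n} \<times> {..<n}) (\<lambda>_. borel)"
  unfolding normalised_sums_def
proof (rule measurable_restrict)
  fix p assume p: "p \<in> {1..<n} \<times> {..<n}"
  then have "part d p \<subseteq> tidx n d"
    using n block_subset[of "fst p" n "snd p" d] lead_mem[of "if fst p = 1 then 0 else fst p" n d] by (auto simp: part_def)
  then show "(\<lambda>w. (\<Sum>k\<in>part d p. w k) / sqrt (real (card (part d p)))) \<in> borel_measurable (gauss (tidx n d))"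
    by (intro borel_measurable_divide borel_measurable_sum borel_measurable_const)
       (auto simp: measurable_cong_sets[OF sets_gauss refl] intro!: measurable_component_singleton)
qed

lemma tensor_lin_normalised_sums:
  assumes n: "1 < n" and d: "0 < d" and il: "i \<in> {1..<n}" "l \<in> {1..<n}"
  shows "tensor_lin d w i l = sqrt (real d) * perturbed (1 / sqrt (real d)) (normalised_sums n d w) i l"
proof -
  have "normalised_sums n d w (i, l) = (\<Sum>j\<in>block d i l. w j) / sqrt (real d)"
    using il by (simp add: normalised_sums_def part_def card_block[OF il(2)])
  moreover have "normalised_sums n d w (1, 0) = w (lead 0)"
    using n by (simp add: normalised_sums_def part_def)
  ultimately show ?thesis using d by (simp add: tensor_lin_def perturbed_def distrib_left right_diff_distrib)
qed

lemma AE_perturbed_inverse: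
  assumes n: "1 < n"
  shows "AE g in gauss ({1..<n} \<times> {..<n}). \<exists>N. mutual_inverses {1..<n} (perturbed t g) N"
proof -
  let ?K = "{1..<n} \<times> {..<n}"
  have "AE g in gauss ?K. det (mat (n - 1) (n - 1) (\<lambda>(i, j). - 1 * g (Suc i, Suc j) + (of_bool (i = j) * t) * g (1, 0))) \<noteq> 0"
    using n by (intro AE_gauss_det_nonzero[of ?K "(1, 0)" "- 1" "n - 1" "\<lambda>i j. (Suc i, Suc j)" "\<lambda>i j. of_bool (i = j) * t"]) auto
  then show ?thesis
  proof eventually_elim
    case (elim g)
    then have "det (mat (n - 1) (n - 1) (\<lambda>(i, j). perturbed t g (Suc i) (Suc j))) \<noteq> 0"
      by (simp add: perturbed_def)
    then show ?case by (rule mutual_inverses_of_det) blast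
  qed
qed

lemma mutual_inverses_scale:
  assumes "mutual_inverses J M N" "s \<noteq> 0" "\<And>i j. i \<in> J \<Longrightarrow> j \<in> J \<Longrightarrow> M' i j = s * M i j"
  shows "mutual_inverses J M' (\<lambda>i j. N i j / s)"
proof -
  have 1: "lin J M' x i = s * lin J M x i" if "i \<in> J" for x i
    using that assms(3) by (simp add: lin_def sum_distrib_left mult.assoc)
  have 2: "lin J (\<lambda>i j. N i j / s) x i = lin J N x i / s" if "i \<in> J" for x i
    using that by (simp add: lin_def sum_divide_distrib)
  have 3: "lin J N (\<lambda>i. c * x i) i = c * lin J N x i" "lin J M (\<lambda>i. c * x i) i = c * lin J M x i" if "i \<in> J" for c x i
    using that by (simp_all add: lin_def sum_distrib_left mult_ac)
  show ?thesis
    unfolding mutual_inverses_def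
  proof (intro allI ballI conjI)
    fix x i assume i: "i \<in> J"
    have "lin J N (lin J M' x) i = lin J N (\<lambda>i. s * lin J M x i) i"
      using lin_cong[of J "lin J M' x" "\<lambda>i. s * lin J M x i" N] 1 by simp
    also have "\<dots> = s * x i" using 3(1)[OF i] assms(1) i by (simp add: mutual_inverses_def)
    finally show "lin J (\<lambda>i j. N i j / s) (lin J M' x) i = x i" using 2[OF i] assms(2) by simp
    have "lin J M (lin J (\<lambda>i j. N i j / s) x) i = lin J M (\<lambda>i. (1 / s) * lin J N x i) i"
      using lin_cong[of J "lin J (\<lambda>i j. N i j / s) x" "\<lambda>i. (1 / s) * lin J N x i" M] 2 by simp
    also have "\<dots> = (1 / s) * x i" using 3(2)[OF i] assms(1) i by (simp only: mutual_inverses_def)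
    finally show "lin J M' (lin J (\<lambda>i j. N i j / s) x) i = x i" using 1[OF i] assms(2) by simp
  qed
qed

lemma AE_tensor_lin_inverse:
  assumes n: "1 < n" and d: "0 < d"
  shows "AE w in gauss (tidx n d). \<exists>N. mutual_inverses {1..<n} (tensor_lin d w) N"
proof -
  let ?K = "{1..<n} \<times> {..<n}" and ?t = "1 / sqrt (real d)"
  have "AE g in distr (gauss (tidx n d)) (PiM ?K (\<lambda>_. borel)) (normalised_sums n d). \<exists>N. mutual_inverses {1..<n} (perturbed ?t g) N"
    unfolding distr_normalised_sums[OF n d] by (rule AE_perturbed_inverse[OF n])
  then have "AE w in gauss (tidx n d). \<exists>N. mutual_inverses {1..<n} (perturbed ?t (normalised_sums n d w)) N"
    by (rule AE_distrD[OF measurable_normalised_sums[OF n]])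
  then show ?thesis
  proof eventually_elim
    case (elim w)
    then obtain N where N: "mutual_inverses {1..<n} (perturbed ?t (normalised_sums n d w)) N" by auto
    from mutual_inverses_scale[OF this, of "sqrt (real d)" "tensor_lin d w"]
    show ?case using tensor_lin_normalised_sums[OF n d, of _ _ w] d by auto
  qed
qed

text \<open>In the dominating function, \<open>2 * real n\<close> accounts for the linear part,
  whose rows have at most \<open>n\<close> entries, each bounded by twice the sum; the further
  \<open>2\<close> accounts for the remainder when \<open>r\<close> is at most
  \<open>1\<close>.\<close>

lemma gauss_cone_tensor:
  assumes n: "1 < n" and d: "0 < d"
  shows "gauss_cone (tidx n d) n (tensor_cone n d) lead (tensor_lin d) (tensor_rem n d)
    (\<lambda>w. (2 * real n + 2) * (\<Sum>j\<in>tidx n d. \<bar>w j\<bar>))"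
proof -
  let ?K = "tidx n d" and ?J = "{1..<n}"
  have comp: "(\<lambda>w. w j) \<in> borel_measurable (gauss ?K)" if "j \<in> ?K" for j
    using that by (auto simp: measurable_cong_sets[OF sets_gauss refl] intro!: measurable_component_singleton)
  have n0: "0 < n" using n by simp
  show ?thesis
  proof (intro gauss_cone.intro random_cone_tensor gauss_cone_axioms.intro n n0 finite_tidx
      AE_tensor_lin_inverse d tensor_chart_eq)
    show "inj_on lead ?J" by (simp add: inj_on_def)
    show "lead ` ?J \<subseteq> ?K" using lead_mem[of _ n d] by auto
    fix i l assume il: "i \<in> ?J" "l \<in> ?J"
    have "block d i l \<subseteq> ?K" using il by (intro block_subset) auto
    then show "(\<lambda>w. tensor_lin d w i l) \<in> borel_measurable (gauss ?K)"
      unfolding tensor_lin_def using n0 lead_mem[of 0 n d]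
      by (intro borel_measurable_diff borel_measurable_times borel_measurable_const borel_measurable_sum comp) auto
  next
    fix r u i
    show "(\<lambda>w. tensor_rem n d r w u i) \<in> borel_measurable (gauss ?K)"
      unfolding tensor_rem_def
      by (intro borel_measurable_diff borel_measurable_sum borel_measurable_times borel_measurable_const comp) (auto simp: high_def)
  next
    fix r w i
    show "continuous_on UNIV (\<lambda>u. tensor_rem n d r w u i)"
      unfolding tensor_rem_def by (intro continuous_intros)
  next
    fix w :: "(nat \<Rightarrow> nat) \<Rightarrow> real"
    let ?W = "\<Sum>j\<in>?K. \<bar>w j\<bar>"
    have W0: "0 \<le> ?W" by (intro sum_nonneg) auto
    show "\<exists>C. \<forall>r. 0 < r \<longrightarrow> r \<le> 1 \<longrightarrow> (\<forall>u\<in>ball0 n. \<forall>i\<in>?J. \<bar>tensor_rem n d r w u i\<bar> \<le> C * r \<and>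
      (\<forall>u'\<in>ball0 n. \<forall>\<delta>. (\<forall>j. \<bar>u j - u' j\<bar> \<le> \<delta>) \<longrightarrow> \<bar>tensor_rem n d r w u i - tensor_rem n d r w u' i\<bar> \<le> C * r * \<delta>))"
    proof (intro exI[of _ "(2 * real d + 2) * ?W"] allI impI ballI conjI)
      fix r :: real and u i assume *: "0 < r" "r \<le> 1" "u \<in> ball0 n" "i \<in> ?J"
      have "\<bar>tensor_rem n d r w u i\<bar> \<le> 2 * ?W * r" by (rule tensor_rem_bounds(1)[OF *])
      also have "\<dots> \<le> (2 * real d + 2) * ?W * r" using W0 *(1) by (intro mult_right_mono) auto
      finally show "\<bar>tensor_rem n d r w u i\<bar> \<le> (2 * real d + 2) * ?W * r" .
      fix u' \<delta> assume "u' \<in> ball0 n" "\<forall>j. \<bar>u j - u' j\<bar> \<le> \<delta>"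
      then show "\<bar>tensor_rem n d r w u i - tensor_rem n d r w u' i\<bar> \<le> (2 * real d + 2) * ?W * r * \<delta>"
        using tensor_rem_bounds(2)[OF *] by blast
    qed
  next
    show "(\<lambda>w. (2 * real n + 2) * (\<Sum>j\<in>?K. \<bar>w j\<bar>)) \<in> borel_measurable (gauss ?K)"
      by (intro borel_measurable_times borel_measurable_const borel_measurable_sum borel_measurable_abs comp)
  next
    fix w :: "(nat \<Rightarrow> nat) \<Rightarrow> real" and r u i assume *: "0 < r" "r \<le> (1::real)" "u \<in> ball0 n" "i \<in> ?J"
    let ?W = "\<Sum>j\<in>?K. \<bar>w j\<bar>"
    have W0: "0 \<le> ?W" by (intro sum_nonneg) auto
    have "\<bar>lin ?J (tensor_lin d w) u i\<bar> \<le> (\<Sum>l\<in>?J. \<bar>tensor_lin d w i l\<bar>) * 1"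
      using *(4) by (intro abs_lin_le ball0_coord[OF *(3)]) auto
    also have "(\<Sum>l\<in>?J. \<bar>tensor_lin d w i l\<bar>) \<le> (\<Sum>l\<in>?J. 2 * ?W)"
      using *(4) by (intro sum_mono abs_tensor_lin_le) auto
    also have "\<dots> \<le> real n * (2 * ?W)"
      using W0 by (simp add: mult_right_mono)
    finally have 1: "\<bar>lin ?J (tensor_lin d w) u i\<bar> \<le> 2 * real n * ?W" by simp
    have "\<bar>tensor_rem n d r w u i\<bar> \<le> 2 * ?W * r" by (rule tensor_rem_bounds(1)[OF *])
    also have "\<dots> \<le> 2 * ?W * 1" using W0 *(2) by (intro mult_left_mono) auto
    finally show "\<bar>lin ?J (tensor_lin d w) u i + tensor_rem n d r w u i\<bar> \<le> (2 * real n + 2) * ?W"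
      using 1 by (simp add: distrib_right)
  next
    show "(\<integral>\<^sup>+w. ennreal ((2 * ((2 * real n + 2) * (\<Sum>j\<in>?K. \<bar>w j\<bar>))) ^ (n - 1)) \<partial>gauss ?K) < \<infinity>"
      using gauss_abs_sum_moment_finite[of ?K "2 * (2 * real n + 2)" "n - 1"] by (simp only: mult.assoc) simp
  qed
qed

section \<open>The limit\<close>

lemma pred_in_image_lin_fixed:
  "Measurable.pred (PiM {1..<n} (\<lambda>_. borel)) (in_image n (lin {1..<n} A))"
proof -
  let ?P = "PiM {1..<n} (\<lambda>_. borel :: real measure)"
  let ?F = "\<lambda>a u. \<Sum>i\<in>{1..<n}. \<bar>a i - lin {1..<n} A u i\<bar>"
  have "{a \<in> space ?P. \<exists>u\<in>ball0 n. ?F a u = 0} \<in> sets ?P"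
  proof (rule sets_ex_compact[OF compact_ball0])
    show "(\<lambda>a. ?F a u) \<in> borel_measurable ?P" for u by measurable
    have "continuous_on (ball0 n) (\<lambda>u. lin {1..<n} A u i)" if "i \<in> {1..<n}" for i
      using that unfolding lin_def by (simp add: continuous_intros)
    then show "continuous_on (ball0 n) (?F a)" for a
      by (intro continuous_intros) auto
  qed
  also have "{a \<in> space ?P. \<exists>u\<in>ball0 n. ?F a u = 0} = {a \<in> space ?P. in_image n (lin {1..<n} A) a}"
    unfolding in_image_def by (subst sum_nonneg_eq_0_iff) auto
  finally show ?thesis by (simp add: pred_def)
qed

lemma image_vol_eq_nn_integral:
  "image_vol n A = (\<integral>\<^sup>+a. indicator {a. in_image n (lin {1..<n} A) a} a \<partial>lebesgue_on_pi {1..<n})"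
proof -
  let ?L = "lebesgue_on_pi {1..<n}"
  have "{a \<in> space (PiM {1..<n} (\<lambda>_. borel)). in_image n (lin {1..<n} A) a} \<in> sets (PiM {1..<n} (\<lambda>_. borel))"
    using pred_in_image_lin_fixed[of n A] by (simp only: pred_def)
  then have "{a \<in> space ?L. in_image n (lin {1..<n} A) a} \<in> sets ?L"
    by (simp add: sets_lebesgue_on_pi space_PiM)
  then have "image_vol n A = (\<integral>\<^sup>+a. indicator {a \<in> space ?L. in_image n (lin {1..<n} A) a} a \<partial>?L)"
    unfolding image_vol_def by (rule nn_integral_indicator[symmetric])
  also have "\<dots> = (\<integral>\<^sup>+a. indicator {a. in_image n (lin {1..<n} A) a} a \<partial>?L)"
    by (intro nn_integral_cong) (simp add: indicator_def)
  finally show ?thesis .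
qed

lemma image_vol_cong:
  assumes "\<And>i j. i \<in> {1..<n} \<Longrightarrow> j \<in> {1..<n} \<Longrightarrow> A i j = B i j"
  shows "image_vol n A = image_vol n B"
proof -
  have "lin {1..<n} A = lin {1..<n} B"
  proof (intro ext)
    fix x i show "lin {1..<n} A x i = lin {1..<n} B x i"
      using assms unfolding lin_def restrict_def by (auto intro!: sum.cong)
  qed
  then show ?thesis by (simp add: image_vol_def)
qed

text \<open>A dilation in dimension \<open>n - 1\<close>; for \<open>s = sqrt (real d)\<close> the
  factor is the growth rate of the expected count.\<close>

lemma image_vol_scale:
  assumes s: "0 < s"
  shows "image_vol n (\<lambda>i j. s * A i j) = ennreal (s ^ (n - 1)) * image_vol n A"
proof -
  let ?L = "lebesgue_on_pi {1..<n}" and ?sA = "\<lambda>i j. s * A i j"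
  have lin_s: "lin {1..<n} ?sA u i = s * lin {1..<n} A u i" if "i \<in> {1..<n}" for u i
    using that by (simp add: lin_def sum_distrib_left mult.assoc)
  have in_s: "in_image n (lin {1..<n} ?sA) (\<lambda>i\<in>{1..<n}. s * a i) \<longleftrightarrow> in_image n (lin {1..<n} A) a" for a
    unfolding in_image_def using s lin_s by (intro bex_cong ball_cong refl) auto
  have "image_vol n ?sA = (\<integral>\<^sup>+a. indicator {a. in_image n (lin {1..<n} ?sA) a} a \<partial>?L)"
    by (rule image_vol_eq_nn_integral)
  also have "\<dots> = ennreal (s ^ card {1..<n}) * (\<integral>\<^sup>+a. indicator {a. in_image n (lin {1..<n} ?sA) a} (\<lambda>i\<in>{1..<n}. s * a i) \<partial>?L)"
  proof (rule nn_integral_lebesgue_on_pi_scale[OF _ _ s])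
    note pred_in_image_lin_fixed[measurable]
    show "(\<lambda>a. indicator {a. in_image n (lin {1..<n} ?sA) a} a :: ennreal) \<in> borel_measurable (PiM {1..<n} (\<lambda>_. borel))"
      by measurable
  qed simp
  also have "(\<integral>\<^sup>+a. indicator {a. in_image n (lin {1..<n} ?sA) a} (\<lambda>i\<in>{1..<n}. s * a i) \<partial>?L)
      = (\<integral>\<^sup>+a. indicator {a. in_image n (lin {1..<n} A) a} a \<partial>?L)"
    by (intro nn_integral_cong) (simp only: indicator_def mem_Collect_eq in_s)
  also have "\<dots> = image_vol n A" by (rule image_vol_eq_nn_integral[symmetric])
  finally show ?thesis by simp
qed

lemma image_vol_pos:
  assumes inv: "mutual_inverses {1..<n} A N"
  shows "0 < image_vol n A"
proof -
  let ?J = "{1..<n}" and ?L = "lebesgue_on_pi {1..<n}"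
  define B where "B = (\<Sum>i\<in>?J. \<Sum>j\<in>?J. \<bar>N i j\<bar>)"
  have B0: "0 \<le> B" unfolding B_def by (intro sum_nonneg) auto
  \<comment> \<open>\<open>N\<close> maps the cube of half side \<open>c\<close> into the unit ball,
    because \<open>B * c\<close> is at most \<open>1\<close>; adding \<open>1\<close> to
    \<open>B\<close> guards against division by \<open>0\<close>.\<close>
  define c where "c = 1 / (B + 1)"
  have c: "0 < c" "B * c \<le> 1" using B0 by (auto simp: c_def field_simps)
  have "PiE ?J (\<lambda>_. {- c..c}) \<subseteq> {a \<in> space ?L. in_image n (lin ?J A) a}"
  proof (rule subsetI)
    fix a assume a: "a \<in> PiE ?J (\<lambda>_. {- c..c})"
    have "L2_set (lin ?J N a) ?J \<le> (\<Sum>i\<in>?J. \<bar>lin ?J N a i\<bar>)" by (rule L2_set_le_sum_abs)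
    also have "\<dots> \<le> (\<Sum>i\<in>?J. (\<Sum>j\<in>?J. \<bar>N i j\<bar>) * c)"
    proof (intro sum_mono abs_lin_le)
      fix j assume "j \<in> ?J"
      then have "a j \<in> {- c..c}" using a by (rule PiE_mem[rotated])
      then show "\<bar>a j\<bar> \<le> c" by auto
    qed auto
    also have "\<dots> = B * c" by (simp add: B_def sum_distrib_right)
    finally have "in_image n (lin ?J A) a" unfolding in_image_lin_iff[OF inv] using c(2) by linarith
    then show "a \<in> {a \<in> space ?L. in_image n (lin ?J A) a}"
      using a by (auto simp: space_PiM PiE_iff)
  qed
  then have "(\<integral>\<^sup>+a. indicator (PiE ?J (\<lambda>_. {- c..c})) a \<partial>?L) \<le> image_vol n A"
    unfolding image_vol_eq_nn_integral by (intro nn_integral_mono) (auto simp: indicator_def)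
  moreover have "(\<integral>\<^sup>+a. indicator (PiE ?J (\<lambda>_. {- c..c})) a \<partial>?L) = emeasure ?L (PiE ?J (\<lambda>_. {- c..c}))"
    by (intro nn_integral_indicator sets_PiM_I_finite) auto
  moreover have "emeasure ?L (PiE ?J (\<lambda>_. {- c..c})) = ennreal ((2 * c) ^ (n - 1))"
    using c(1) by (subst leb.emeasure_PiM) (auto simp: ennreal_power)
  moreover have "0 < ennreal ((2 * c) ^ (n - 1))" using c(1) by simp
  ultimately show ?thesis by (metis less_le_trans)
qed

section \<open>Continuity in the size of the perturbation\<close>

text \<open>Changing \<open>t\<close> by \<open>s k\<close> adds \<open>s k * g (1, 0)\<close> times
  the identity, a perturbation of order \<open>\<bar>s k\<bar>\<close>. With constant weight
  \<open>1\<close> the limit theorem for images becomes continuity of the expected volume in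
  \<open>t\<close>.\<close>

lemma image_limit_perturbed:
  assumes n: "1 < n" and t: "\<bar>t\<bar> \<le> 1" and s: "\<And>k. \<bar>s k\<bar> \<le> 1" "s \<longlonglongrightarrow> 0"
  shows "image_limit (gauss ({1..<n} \<times> {..<n})) n (perturbed t) (\<lambda>k g u i. s k * g (1, 0) * u i) (\<lambda>k. \<bar>s k\<bar>)
    (\<lambda>g. (2 * real n + 1) * (\<Sum>p\<in>{1..<n} \<times> {..<n}. \<bar>g p\<bar>)) (\<lambda>_ _. 1) 1"
proof -
  let ?K = "{1..<n} \<times> {..<n}" and ?J = "{1..<n}"
  have comp: "(\<lambda>g. g p) \<in> borel_measurable (gauss ?K)" if "p \<in> ?K" for p
    using that by (auto simp: measurable_cong_sets[OF sets_gauss refl] intro!: measurable_component_singleton)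
  have p10: "(1, 0) \<in> ?K" using n by auto
  show ?thesis
  proof (intro image_limit.intro image_limit_axioms.intro prob_space_gauss n AE_perturbed_inverse)
    show "(\<lambda>g. perturbed t g i j) \<in> borel_measurable (gauss ?K)" if "i \<in> ?J" "j \<in> ?J" for i j
      unfolding perturbed_def using that p10
      by (intro borel_measurable_add borel_measurable_uminus borel_measurable_times borel_measurable_const comp) auto
    show "(\<lambda>g. s k * g (1, 0) * u i) \<in> borel_measurable (gauss ?K)" for k u i
      by (intro borel_measurable_times borel_measurable_const comp p10)
    show "continuous_on UNIV (\<lambda>u. s k * g (1, 0) * u i)" for k g i
      by (intro continuous_intros)
    show "(\<lambda>k. \<bar>s k\<bar>) \<longlonglongrightarrow> 0" using tendsto_rabs[OF s(2)] by simp
    show "(\<lambda>g. (2 * real n + 1) * (\<Sum>p\<in>?K. \<bar>g p\<bar>)) \<in> borel_measurable (gauss ?K)"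
      by (intro borel_measurable_times borel_measurable_const borel_measurable_sum borel_measurable_abs comp)
    show "(\<integral>\<^sup>+g. ennreal ((2 * ((2 * real n + 1) * (\<Sum>p\<in>?K. \<bar>g p\<bar>))) ^ (n - 1)) \<partial>gauss ?K) < \<infinity>"
      using gauss_abs_sum_moment_finite[of ?K "2 * (2 * real n + 1)" "n - 1"] by (simp only: mult.assoc) simp
  next
    fix g :: "nat \<times> nat \<Rightarrow> real"
    have "\<bar>s k * g (1, 0) * u i\<bar> \<le> \<bar>g (1, 0)\<bar> * \<bar>s k\<bar> \<and>
      (\<forall>u'\<in>ball0 n. \<forall>d. (\<forall>j. \<bar>u j - u' j\<bar> \<le> d) \<longrightarrow> \<bar>s k * g (1, 0) * u i - s k * g (1, 0) * u' i\<bar> \<le> \<bar>g (1, 0)\<bar> * \<bar>s k\<bar> * d)"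
      if u: "u \<in> ball0 n" for k u i
    proof (intro conjI ballI allI impI)
      show "\<bar>s k * g (1, 0) * u i\<bar> \<le> \<bar>g (1, 0)\<bar> * \<bar>s k\<bar>"
        using mult_left_mono[OF ball0_coord[OF u, of i], of "\<bar>g (1, 0)\<bar> * \<bar>s k\<bar>"] by (simp add: abs_mult mult_ac)
      fix u' d assume "\<forall>j. \<bar>u j - u' j\<bar> \<le> d"
      then have "\<bar>g (1, 0)\<bar> * \<bar>s k\<bar> * \<bar>u i - u' i\<bar> \<le> \<bar>g (1, 0)\<bar> * \<bar>s k\<bar> * d"
        by (intro mult_left_mono) auto
      then show "\<bar>s k * g (1, 0) * u i - s k * g (1, 0) * u' i\<bar> \<le> \<bar>g (1, 0)\<bar> * \<bar>s k\<bar> * d"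
        unfolding right_diff_distrib[symmetric] by (simp only: abs_mult mult_ac)
    qed
    then show "\<exists>C. \<forall>k. \<forall>u\<in>ball0 n. \<forall>i\<in>?J. \<bar>s k * g (1, 0) * u i\<bar> \<le> C * \<bar>s k\<bar> \<and>
      (\<forall>u'\<in>ball0 n. \<forall>d. (\<forall>j. \<bar>u j - u' j\<bar> \<le> d) \<longrightarrow> \<bar>s k * g (1, 0) * u i - s k * g (1, 0) * u' i\<bar> \<le> C * \<bar>s k\<bar> * d)"
      by (intro exI[of _ "\<bar>g (1, 0)\<bar>"]) blast
  next
    fix g :: "nat \<times> nat \<Rightarrow> real" and k u i assume u: "u \<in> ball0 n" and i: "i \<in> ?J"
    let ?W = "\<Sum>p\<in>?K. \<bar>g p\<bar>"
    have mem: "\<bar>g p\<bar> \<le> ?W" if "p \<in> ?K" for p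
      using that by (intro member_le_sum) auto
    have W0: "0 \<le> ?W" by (intro sum_nonneg) auto
    have ent: "\<bar>perturbed t g i l\<bar> \<le> 2 * ?W" if "l \<in> ?J" for l
    proof -
      have "\<bar>t * g (1, 0)\<bar> \<le> 1 * ?W"
        unfolding abs_mult using t mem[OF p10] by (intro mult_mono) auto
      moreover have "\<bar>g (i, l)\<bar> \<le> ?W" using that i by (intro mem) auto
      ultimately show ?thesis using W0 by (auto simp: perturbed_def of_bool_def)
    qed
    have "\<bar>lin ?J (perturbed t g) u i\<bar> \<le> (\<Sum>l\<in>?J. \<bar>perturbed t g i l\<bar>) * 1"
      using i by (intro abs_lin_le ball0_coord[OF u]) auto
    also have "(\<Sum>l\<in>?J. \<bar>perturbed t g i l\<bar>) \<le> (\<Sum>l\<in>?J. 2 * ?W)"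
      by (intro sum_mono ent)
    also have "\<dots> \<le> real n * (2 * ?W)" using W0 by (simp add: mult_right_mono)
    finally have 1: "\<bar>lin ?J (perturbed t g) u i\<bar> \<le> 2 * real n * ?W" by simp
    have "\<bar>s k * g (1, 0) * u i\<bar> \<le> 1 * ?W * 1"
      unfolding abs_mult using s(1)[of k] mem[OF p10] ball0_coord[OF u, of i] W0
      by (intro mult_mono) auto
    then show "\<bar>lin ?J (perturbed t g) u i + s k * g (1, 0) * u i\<bar> \<le> (2 * real n + 1) * ?W"
      using 1 by (simp add: distrib_right)
  qed auto
qed

definition perturbed_vol :: "nat \<Rightarrow> real \<Rightarrow> ennreal" where
  "perturbed_vol n t = (\<integral>\<^sup>+g. image_vol n (perturbed t g) \<partial>gauss ({1..<n} \<times> {..<n}))"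

lemma perturbed_vol_finite:
  assumes "1 < n" "\<bar>t\<bar> \<le> 1"
  shows "perturbed_vol n t < \<infinity>" "(\<lambda>g. image_vol n (perturbed t g)) \<in> borel_measurable (gauss ({1..<n} \<times> {..<n}))"
proof -
  \<comment> \<open>The instance with zero perturbation provides both finiteness and
    measurability.\<close>
  interpret image_limit "gauss ({1..<n} \<times> {..<n})" n "perturbed t" "\<lambda>k g u i. 0 * g (1, 0) * u i" "\<lambda>k. \<bar>0\<bar>"
    "\<lambda>g. (2 * real n + 1) * (\<Sum>p\<in>{1..<n} \<times> {..<n}. \<bar>g p\<bar>)" "\<lambda>_ _. 1" 1
    by (rule image_limit_perturbed) (use assms in auto)
  show "perturbed_vol n t < \<infinity>" unfolding perturbed_vol_def by (rule image_vol_finite)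
  show "(\<lambda>g. image_vol n (perturbed t g)) \<in> borel_measurable (gauss ({1..<n} \<times> {..<n}))"
    by (rule measurable_image_vol)
qed

lemma perturbed_vol_tendsto:
  assumes n: "1 < n" and s: "\<And>k. \<bar>s k\<bar> \<le> 1" "s \<longlonglongrightarrow> 0"
  shows "(\<lambda>k. perturbed_vol n (s k)) \<longlonglongrightarrow> perturbed_vol n 0"
proof -
  interpret image_limit "gauss ({1..<n} \<times> {..<n})" n "perturbed 0" "\<lambda>k g u i. s k * g (1, 0) * u i" "\<lambda>k. \<bar>s k\<bar>"
    "\<lambda>g. (2 * real n + 1) * (\<Sum>p\<in>{1..<n} \<times> {..<n}. \<bar>g p\<bar>)" "\<lambda>_ _. 1" 1
    by (rule image_limit_perturbed) (use n s in auto)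
  have "in_image n (\<lambda>u i. lin {1..<n} (perturbed 0 g) u i + s k * g (1, 0) * u i) a \<longleftrightarrow> in_image n (lin {1..<n} (perturbed (s k) g)) a" for k g a
  proof -
    have "lin {1..<n} (perturbed 0 g) u i + s k * g (1, 0) * u i = lin {1..<n} (perturbed (s k) g) u i" if i: "i \<in> {1..<n}" for u i
    proof -
      have "lin {1..<n} (perturbed (s k) g) u i = (\<Sum>j\<in>{1..<n}. perturbed 0 g i j * u j + (if j = i then s k * g (1, 0) * u i else 0))"
        using i by (auto simp: lin_def perturbed_def algebra_simps intro!: sum.cong)
      then show ?thesis using i by (simp add: sum.distrib lin_def)
    qed
    then show ?thesis unfolding in_image_def by (intro bex_cong ball_cong refl) simp
  qed
  then show ?thesis
    using image_vol_limit by (simp add: perturbed_vol_def image_vol_eq_nn_integral)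
qed

lemma perturbed_vol_pos:
  assumes n: "1 < n"
  shows "0 < perturbed_vol n 0"
proof (rule ccontr)
  assume "\<not> ?thesis"
  then have "perturbed_vol n 0 = 0" by simp
  then have "AE g in gauss ({1..<n} \<times> {..<n}). image_vol n (perturbed 0 g) = 0"
    unfolding perturbed_vol_def using perturbed_vol_finite(2)[OF n, of 0]
    by (intro nn_integral_0_iff_AE[THEN iffD1]) simp_all
  moreover have "AE g in gauss ({1..<n} \<times> {..<n}). \<exists>N. mutual_inverses {1..<n} (perturbed 0 g) N"
    by (rule AE_perturbed_inverse[OF n])
  ultimately have "AE g in gauss ({1..<n} \<times> {..<n}). False"
  proof eventually_elim
    case (elim g)
    then show ?case using image_vol_pos[of n "perturbed 0 g"] by auto
  qed
  then show False using prob_space.AE_False[OF prob_space_gauss[of "{1..<n} \<times> {..<n}"]] by simp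
qed

text \<open>Dividing by \<open>sqrt (real d)\<close> turns the linear part into
  \<open>perturbed\<close> evaluated at the normalised block sums, and these are standard Gaussian
  on the index set of the linear system.\<close>

lemma tensor_vol_eq:
  assumes n: "1 < n" and d: "0 < d"
  shows "(\<integral>\<^sup>+w. image_vol n (tensor_lin d w) \<partial>gauss (tidx n d)) = ennreal (sqrt (real d) ^ (n - 1)) * perturbed_vol n (1 / sqrt (real d))"
proof -
  let ?K = "{1..<n} \<times> {..<n}" and ?t = "1 / sqrt (real d)" and ?c = "ennreal (sqrt (real d) ^ (n - 1))"
  have t: "\<bar>?t\<bar> \<le> 1" using d by simp
  note m = perturbed_vol_finite(2)[OF n t]
  have m': "(\<lambda>g. image_vol n (perturbed ?t g)) \<in> borel_measurable (PiM ?K (\<lambda>_. borel))"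
    using m unfolding measurable_cong_sets[OF sets_gauss refl] .
  have "(\<integral>\<^sup>+w. image_vol n (tensor_lin d w) \<partial>gauss (tidx n d)) = (\<integral>\<^sup>+w. ?c * image_vol n (perturbed ?t (normalised_sums n d w)) \<partial>gauss (tidx n d))"
  proof (rule nn_integral_cong)
    fix w
    have "image_vol n (tensor_lin d w) = image_vol n (\<lambda>i j. sqrt (real d) * perturbed ?t (normalised_sums n d w) i j)"
      by (intro image_vol_cong tensor_lin_normalised_sums n d)
    then show "image_vol n (tensor_lin d w) = ?c * image_vol n (perturbed ?t (normalised_sums n d w))"
      using d by (simp add: image_vol_scale)
  qed
  also have "\<dots> = ?c * (\<integral>\<^sup>+w. image_vol n (perturbed ?t (normalised_sums n d w)) \<partial>gauss (tidx n d))"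
    by (intro nn_integral_cmult measurable_compose[OF measurable_normalised_sums[OF n] m'])
  also have "(\<integral>\<^sup>+w. image_vol n (perturbed ?t (normalised_sums n d w)) \<partial>gauss (tidx n d))
      = (\<integral>\<^sup>+g. image_vol n (perturbed ?t g) \<partial>distr (gauss (tidx n d)) (PiM ?K (\<lambda>_. borel)) (normalised_sums n d))"
    by (rule nn_integral_distr[symmetric, OF measurable_normalised_sums[OF n]])
      (simp only: measurable_distr_eq1 m')
  also have "\<dots> = perturbed_vol n ?t"
    unfolding distr_normalised_sums[OF n d] perturbed_vol_def ..
  finally show ?thesis .
qed

section \<open>Comparison of the two cones\<close>

text \<open>For each cone the hit probability divided by the cap mass tends to the expected count,
  and divided by \<open>r k ^ (n - 1)\<close> it tends to a constant times the expected volume.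
  Cross-multiplying the ratios of the two cones eliminates the unknown asymptotics of the cap
  mass.\<close>

lemma E_nd_eq:
  assumes n: "1 < n" and d: "0 < d"
  shows "E_nd n d = ennreal (sqrt (real d) ^ (n - 1)) * perturbed_vol n (1 / sqrt (real d)) / perturbed_vol n 0"
proof -
  let ?\<kappa> = "ennreal ((1 / sqrt (2 * pi)) ^ (n - 1))"
  interpret T: gauss_cone "tidx n d" n "tensor_cone n d" lead "tensor_lin d" "tensor_rem n d"
    "\<lambda>w. (2 * real n + 2) * (\<Sum>j\<in>tidx n d. \<bar>w j\<bar>)"
    by (rule gauss_cone_tensor[OF n d])
  interpret C: gauss_cone "{1..<n} \<times> {..<n}" n "linear_cone n" "\<lambda>i. (i, 0)" "\<lambda>w i j. - w (i, j)" "\<lambda>_ _ _ _. 0"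
    "\<lambda>w. \<Sum>k\<in>{1..<n} \<times> {..<n}. \<bar>w k\<bar>"
    by (rule gauss_cone_linear[OF n])
  define r where "r k = inverse (real (Suc k))" for k
  have r: "0 < r k" "r k \<le> 1" for k
    by (auto simp: r_def field_simps)
  have r_lim: "r \<longlonglongrightarrow> 0" unfolding r_def by (rule LIMSEQ_inverse_real_of_nat)
  have e: "0 < (r k)\<^sup>2" for k using r(1)[of k] by simp
  have e_lim: "(\<lambda>k. (r k)\<^sup>2) \<longlonglongrightarrow> 0" using tendsto_power[OF r_lim, of 2] by simp
  let ?cap = "\<lambda>k. cap_prob n ((r k)\<^sup>2)" and ?\<rho> = "\<lambda>k. ennreal (r k ^ (n - 1))"
  let ?pT = "\<lambda>k. T.hit_prob ((r k)\<^sup>2)" and ?pC = "\<lambda>k. C.hit_prob ((r k)\<^sup>2)"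
  have T1: "(\<lambda>k. ?pT k / ?cap k) \<longlonglongrightarrow> E_nd n d"
  proof -
    have "E_nd n d = (\<integral>\<^sup>+w. num_real_eig n d w \<partial>gauss (tidx n d))"
      by (simp add: E_nd_def gauss_tensor_def gauss_def)
    moreover have "AE w in gauss (tidx n d). \<exists>R. line_reps n (\<lambda>v. tensor_cone n d w v = 0) R \<and> num_real_eig n d w = ecard R"
      using n d by (intro AE_I2 tensor_cone_line_reps) auto
    ultimately show ?thesis using T.hit_prob_ratio_tendsto[OF _ e e_lim] by simp
  qed
  have C1: "(\<lambda>k. ?pC k / ?cap k) \<longlonglongrightarrow> 1"
  proof -
    have "AE w in gauss ({1..<n} \<times> {..<n}). \<exists>R. line_reps n (\<lambda>v. linear_cone n w v = 0) R \<and> 1 = ecard R"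
      using AE_linear_inverse[OF n]
    proof eventually_elim
      case (elim w)
      then show ?case by (rule exE) (rule linear_cone_line_reps[OF n])
    qed
    from C.hit_prob_ratio_tendsto[OF this e e_lim] show ?thesis
      by (simp add: prob_space.emeasure_space_1[OF prob_space_gauss])
  qed
  have T2: "(\<lambda>k. ?pT k / ?\<rho> k) \<longlonglongrightarrow> ?\<kappa> * (ennreal (sqrt (real d) ^ (n - 1)) * perturbed_vol n (1 / sqrt (real d)))"
    using T.hit_prob_limit[OF r r_lim] by (simp add: tensor_vol_eq[OF n d])
  have p0: "(\<lambda>i j. - w (i, j)) = perturbed 0 w" for w by (simp add: perturbed_def fun_eq_iff)
  have C2: "(\<lambda>k. ?pC k / ?\<rho> k) \<longlonglongrightarrow> ?\<kappa> * perturbed_vol n 0"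
    using C.hit_prob_limit[OF r r_lim] unfolding p0 perturbed_vol_def .
  let ?Z = "ennreal (sqrt (real d) ^ (n - 1)) * perturbed_vol n (1 / sqrt (real d))" and ?V = "perturbed_vol n 0"
  have V: "?V \<noteq> 0" "?V \<noteq> \<infinity>"
    using perturbed_vol_pos[OF n] perturbed_vol_finite(1)[OF n, of 0] by auto
  have \<kappa>: "?\<kappa> \<noteq> 0" "?\<kappa> \<noteq> \<infinity>"
    by (auto simp: ennreal_eq_0_iff not_le)
  \<comment> \<open>At this point \<open>E_nd n d\<close> could still be infinite; the product of
    limits is legitimate because the other limit is finite and nonzero.\<close>
  have A: "(\<lambda>k. (?pT k / ?cap k) * (?pC k / ?\<rho> k)) \<longlonglongrightarrow> E_nd n d * (?\<kappa> * ?V)"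
    using V \<kappa> by (intro tendsto_mult_ennreal T1 C2) (auto simp: ennreal_mult_eq_top_iff)
  have B: "(\<lambda>k. (?pT k / ?\<rho> k) * (?pC k / ?cap k)) \<longlonglongrightarrow> (?\<kappa> * ?Z) * 1"
    by (intro tendsto_mult_ennreal T2 C1) auto
  have eq: "(?pT k / ?cap k) * (?pC k / ?\<rho> k) = (?pT k / ?\<rho> k) * (?pC k / ?cap k)" for k
    by (simp add: divide_ennreal_def mult_ac)
  have "E_nd n d * (?\<kappa> * ?V) = (?\<kappa> * ?Z) * 1"
    by (rule LIMSEQ_unique[OF A]) (unfold eq, rule B)
  then have "E_nd n d * (?\<kappa> * ?V) = ?\<kappa> * ?Z" by (simp only: mult_1_right)
  then have "?\<kappa> * (E_nd n d * ?V) = ?\<kappa> * ?Z" by (simp only: mult_ac)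
  then have "E_nd n d * ?V = ?Z" using \<kappa> by (simp only: ennreal_mult_cancel_left infinity_ennreal_def) blast
  then have "E_nd n d * ?V / ?V = ?Z / ?V" by (rule arg_cong)
  then show ?thesis using V ennreal_mult_divide_eq[of ?V "E_nd n d"] by simp
qed

text \<open>After the top power of \<open>d\<close> is factored out, only the summand with
  \<open>i = n - 1\<close> survives in the limit, where \<open>0 ^ 0 = 1\<close>.\<close>

lemma D_nd_ratio_tendsto:
  assumes n: "1 < n"
  shows "(\<lambda>d. sqrt (real d) ^ (n - 1) / sqrt (D_nd n d)) \<longlonglongrightarrow> 1"
proof -
  have "(\<lambda>d. \<Sum>i<n. inverse (real d) ^ (n - 1 - i)) \<longlonglongrightarrow> (\<Sum>i<n. 0 ^ (n - 1 - i))"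
    by (intro tendsto_intros LIMSEQ_inverse_real_of_nat) (simp add: tendsto_inverse_0_at_top filterlim_real_sequentially)
  also have "(\<Sum>i<n. 0 ^ (n - 1 - i)) = (\<Sum>i<n. if i = n - 1 then 1 else 0 :: real)"
    by (intro sum.cong) auto
  also have "\<dots> = 1" using n by simp
  finally have "(\<lambda>d. 1 / sqrt (\<Sum>i<n. inverse (real d) ^ (n - 1 - i))) \<longlonglongrightarrow> 1 / sqrt 1"
    by (intro tendsto_intros) auto
  then have lim: "(\<lambda>d. 1 / sqrt (\<Sum>i<n. inverse (real d) ^ (n - 1 - i))) \<longlonglongrightarrow> 1" by simp
  show ?thesis
  proof (rule Lim_transform_eventually[OF lim])
    show "\<forall>\<^sub>F d in sequentially. 1 / sqrt (\<Sum>i<n. inverse (real d) ^ (n - 1 - i)) = sqrt (real d) ^ (n - 1) / sqrt (D_nd n d)"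
      using eventually_gt_at_top[of 0]
    proof eventually_elim
      case (elim d)
      have "D_nd n d = real d ^ (n - 1) * (\<Sum>i<n. inverse (real d) ^ (n - 1 - i))"
        unfolding D_nd_def sum_distrib_left
      proof (rule sum.cong[OF refl])
        fix i assume "i \<in> {..<n}"
        then have "n - 1 = i + (n - 1 - i)" by auto
        then have "real d ^ (n - 1) = real d ^ i * real d ^ (n - 1 - i)" by (metis power_add)
        then show "real d ^ i = real d ^ (n - 1) * inverse (real d) ^ (n - 1 - i)"
          using elim by (simp add: power_inverse)
      qed
      then have "sqrt (D_nd n d) = sqrt (real d) ^ (n - 1) * sqrt (\<Sum>i<n. inverse (real d) ^ (n - 1 - i))"
        by (simp add: real_sqrt_mult real_sqrt_power)
      then show ?case using elim by simp
    qed
  qed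
qed

theorem theorem1p1:
  fixes n :: nat
  assumes "n > 1"
  shows "(\<lambda>d. E_nd n d / ennreal (sqrt (D_nd n d))) \<longlonglongrightarrow> 1"
proof -
  let ?t = "\<lambda>d. 1 / sqrt (real d)" and ?c = "\<lambda>d. sqrt (real d) ^ (n - 1)"
  let ?V = "perturbed_vol n 0"
  have V: "?V \<noteq> 0" "?V < \<infinity>"
    using perturbed_vol_pos[OF assms] perturbed_vol_finite(1)[OF assms, of 0] by auto
  have t: "\<bar>?t d\<bar> \<le> 1" for d :: nat
    by (cases d) auto
  have "filterlim (\<lambda>d. sqrt (real d)) at_top sequentially"
    by (rule filterlim_compose[OF sqrt_at_top filterlim_real_sequentially])
  then have "(\<lambda>d. inverse (sqrt (real d))) \<longlonglongrightarrow> 0"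
    by (rule tendsto_inverse_0_at_top)
  then have t_lim: "?t \<longlonglongrightarrow> 0" by (simp add: inverse_eq_divide)
  \<comment> \<open>The eigenvalue enters with weight \<open>1 / sqrt (real d)\<close> and
    disappears in the limit, leaving the expected volume of the linear system.\<close>
  have "(\<lambda>d. perturbed_vol n (?t d) * inverse ?V) \<longlonglongrightarrow> ?V * inverse ?V"
    using V by (intro tendsto_mult_ennreal perturbed_vol_tendsto[OF assms t t_lim] tendsto_const) auto
  moreover have "?V * inverse ?V = 1"
    using ennreal_divide_self[of ?V] V by (simp add: divide_ennreal_def)
  ultimately have "(\<lambda>d. ennreal (?c d / sqrt (D_nd n d)) * (perturbed_vol n (?t d) * inverse ?V)) \<longlonglongrightarrow> ennreal 1 * 1"
    by (intro tendsto_mult_ennreal tendsto_ennrealI D_nd_ratio_tendsto[OF assms]) auto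
  then have lim: "(\<lambda>d. ennreal (?c d / sqrt (D_nd n d)) * (perturbed_vol n (?t d) * inverse ?V)) \<longlonglongrightarrow> 1"
    by simp
  show ?thesis
  proof (rule Lim_transform_eventually[OF lim])
    show "\<forall>\<^sub>F d in sequentially. ennreal (?c d / sqrt (D_nd n d)) * (perturbed_vol n (?t d) * inverse ?V)
        = E_nd n d / ennreal (sqrt (D_nd n d))"
      \<comment> \<open>\<open>E_nd_eq\<close> applies to positive \<open>d\<close>, where
        \<open>D_nd n d\<close> is positive as well.\<close>
      using eventually_gt_at_top[of 0]
    proof eventually_elim
      case (elim d)
      have "0 < D_nd n d"
        unfolding D_nd_def using assms elim by (intro sum_pos) auto
      then have "ennreal (?c d / sqrt (D_nd n d)) = ennreal (?c d) / ennreal (sqrt (D_nd n d))"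
        by (intro divide_ennreal[symmetric]) auto
      then show ?case
        by (simp add: E_nd_eq[OF assms elim] divide_ennreal_def mult_ac)
    qed
  qed
qed

end
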